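(* Let a stochastic sequence $\{\xi(m),m\in\mathbb Z\}$ determine a stationary stochastic $n$th increment sequence $\xi^{(n)}(m,\mu)$, $\mu>0$, with absolutely continuous spectral function $F(\lambda)$ and spectral density $f(\lambda)$ which admits the canonical factorization $f(\lambda)=|\Phi(e^{-i\lambda})|^2$. Then the optimal (minimal mean square error) linear estimate $\hat A_N\xi$ of the functional $A_N\xi=\sum_{k=0}^Na(k)\xi(k)$ from observations of $\xi(m)$ at the points $m=-1,-2,\ldots$ is $$\hat A_N\xi=-\sum_{k=-\mu n}^{-1}v_{\mu,N}(k)\xi(k)+\int_{-\pi}^{\pi}h_{\mu,N}^{(a)}(\lambda)(1-e^{-i\lambda\mu})^n\frac1{(i\lambda)^n}dZ(\lambda),$$ where the spectral characteristic is $$h^{(a)}_{\mu,N}(\lambda)=A_N(e^{i\lambda})-r_{\mu,N}^{(a)}(e^{i\lambda})\Phi_\mu^{-1}(e^{-i\lambda}),$$ $$A_N(e^{i\lambda})=\sum_{k=0}^N(D_N^\mu a_N)_ke^{i\lambda k},\qquad r^{(a)}_{\mu,N}(e^{i\lambda})=\sum_{j=0}^N(D_N^\mu A_N\varphi_{\mu,N})_je^{i\lambda j},$$ and the mean square error is $$\Delta(f,\hat A_N\xi):=\mathrm E|A_N\xi-\hat A_N\xi|^2=\frac1{2\pi}\int_{-\pi}^\pi|r_{\mu,N}^{(a)}(e^{i\lambda})|^2d\lambda=\|D_N^\mu A_N\varphi_{\mu,N}\|^2 .$$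
   Context: Let $n\ge 1$, $\mu>0$, $N\ge0$ be integers. For a stochastic sequence $\{\xi(m),m\in\mathbb Z\}$ put $\xi^{(n)}(m,\mu)=\sum_{l=0}^n(-1)^l\binom nl\xi(m-l\mu)$. The increment sequence is (wide sense) stationary if $\mathrm E\xi^{(n)}(m_0,\mu)$ and $\mathrm E\xi^{(n)}(m_0+m,\mu_1)\overline{\xi^{(n)}(m_0,\mu_2)}$ exist for all integers $m_0,m,\mu,\mu_1,\mu_2$ and do not depend on $m_0$; the mean of the increments is assumed to be $0$. Then there are a left-continuous nondecreasing bounded function $F$ on $[-\pi,\pi]$ with $F(-\pi)=0$ (the spectral function) and an orthogonal stochastic measure $Z$ on $[-\pi,\pi)$ with $\mathrm EZ(A_1)\overline{Z(A_2)}=F(A_1\cap A_2)$ such that $\xi^{(n)}(m,\mu)=\int_{-\pi}^{\pi}e^{i\lambda m}(1-e^{-i\mu\lambda})^n(i\lambda)^{-n}dZ(\lambda)$. The spectral density $f$ is normalized by $dF(\lambda)=\frac1{2\pi}f(\lambda)d\lambda$. Canonical factorization of $f$: $f(\lambda)=|\Phi(e^{-i\lambda})|^2$, $\Phi(z)=\sum_{k\ge0}\varphi(k)z^k$, where the power series has convergence radius $>1$ and $\Phi$ has no zeros in $\{|z|\le1\}$. In this case $\xi^{(n)}(m,\mu)=\sum_{k=0}^\infty\varphi_\mu(k)\varepsilon_{m-k}$, where $\varepsilon$ is the innovation sequence (uncorrelated, mean $0$, variance $1$, with the closed span of $\{\varepsilon_m:m\le t\}$ equal to that of $\{\xi^{(n)}(m,\nu):m\le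 t,\nu>0\}$ for every $t$). Put $\Phi_\mu(z)=\sum_{k\ge0}\varphi_\mu(k)z^k$ and $\varphi_{\mu,N}=(\varphi_\mu(0),\ldots,\varphi_\mu(N))$. One has $|\Phi_\mu(e^{-i\lambda})|^2=|1-e^{-i\lambda\mu}|^{2n}\lambda^{-2n}f(\lambda)$ and $\Phi_\mu=w_\mu\Phi$ with $w_\mu(z)=\exp\{\frac1{4\pi}\int_{-\pi}^{\pi}\frac{e^{i\lambda}+z}{e^{i\lambda}-z}\ln\frac{|1-e^{-i\lambda\mu}|^{2n}}{\lambda^{2n}}d\lambda\}$. The numbers $d_\mu(k)$ are defined by $\sum_{k\ge0}d_\mu(k)x^k=(\sum_{j\ge0}x^{\mu j})^n$. $D_N^\mu$ is the $(N+1)\times(N+1)$ matrix with entries $d_\mu(j-k)$ for $0\le k\le j\le N$ and $0$ for $j<k$; $a_N=(a(0),\ldots,a(N))$; $b_{\mu,N}(k)=(D_N^\mu a_N)_k=\sum_{m=k}^Na(m)d_\mu(m-k)$, $0\le k\le N$. $A_N$ is the $(N+1)\times(N+1)$ matrix with $(A_N)_{k,j}=a(k+j)$ if $k+j\le N$ and $0$ if $k+j>N$. Further $v_{\mu,N}(k)=\sum_{l=[-k/\mu]'}^{\min\{[(N-k)/\mu],n\}}(-1)^l\binom nl b_{\mu,N}(l\mu+k)$, $k=-1,\ldots,-\mu n$, where $[x]'$ is the least integer $\ge x$ and $[x]$ the integer part. Norms are Euclidean. One has $A_N\xi=\sum_{k=0}^Nb_{\mu,N}(k)\xi^{(n)}(k,\mu)-V_N\xi$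 with $V_N\xi=\sum_{k=-\mu n}^{-1}v_{\mu,N}(k)\xi(k)$ observed. $L_2^{0-}(f)$ is the closed subspace of $L_2(f)$ generated by $e^{i\lambda k}(1-e^{-i\lambda\mu})^n(i\lambda)^{-n}$, $k\le-1$. A linear estimate of $A_N\xi$ is $-V_N\xi+\int_{-\pi}^\pi h(\lambda)(1-e^{-i\lambda\mu})^n(i\lambda)^{-n}dZ(\lambda)$ with $h(\lambda)(1-e^{-i\lambda\mu})^n(i\lambda)^{-n}\in L_2^{0-}(f)$; $h$ is its spectral characteristic. *)

theory Defs
  imports
    "HOL-Probability.Probability"
    "HOL-Complex_Analysis.Complex_Analysis"
    "Jordan_Normal_Form.Matrix"
begin

section \<open>Square-integrable functions and closed linear spans\<close>

definition L2 :: "'b measure \<Rightarrow> ('b \<Rightarrow> complex) set" where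
  "L2 M = {g \<in> borel_measurable M. integrable M (\<lambda>x. (cmod (g x))\<^sup>2)}"

text \<open>Elements of \<open>L2 M\<close> are functions, not classes modulo null sets; \<open>L2_span M S\<close> is
  closed under changes on null sets. It is meant for \<open>S \<subseteq> L2 M\<close>.\<close>

definition L2_span :: "'b measure \<Rightarrow> ('b \<Rightarrow> complex) set \<Rightarrow> ('b \<Rightarrow> complex) set" where
  "L2_span M S = {g \<in> L2 M. \<forall>e>0. \<exists>T c. finite T \<and> T \<subseteq> S \<and>
     (\<integral>x. (cmod (g x - (\<Sum>t\<in>T. c t * t x)))\<^sup>2 \<partial>M) < e}"

text \<open>Mean square error \<open>E |X - Y|\<^sup>2\<close>.\<close>

definition mse :: "'a measure \<Rightarrow> ('a \<Rightarrow> complex) \<Rightarrow> ('a \<Rightarrow> complex) \<Rightarrow> real" where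
  "mse P X Y = (\<integral>\<omega>. (cmod (X \<omega> - Y \<omega>))\<^sup>2 \<partial>P)"


section \<open>Stationary increment sequences\<close>

definition increment :: "nat \<Rightarrow> (int \<Rightarrow> 'a \<Rightarrow> complex) \<Rightarrow> int \<Rightarrow> int \<Rightarrow> 'a \<Rightarrow> complex" where
  "increment n \<xi> m \<mu> \<omega> = (\<Sum>l\<le>n. (-1) ^ l * of_nat (n choose l) * \<xi> (m - int l * \<mu>) \<omega>)"

definition stationary_increments :: "'a measure \<Rightarrow> nat \<Rightarrow> (int \<Rightarrow> 'a \<Rightarrow> complex) \<Rightarrow> bool" where
  "stationary_increments P n \<xi> \<longleftrightarrow>
     (\<forall>m\<^sub>0 \<mu>. integrable P (increment n \<xi> m\<^sub>0 \<mu>)) \<and>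
     (\<forall>m\<^sub>0 m\<^sub>0' \<mu>. (\<integral>\<omega>. increment n \<xi> m\<^sub>0 \<mu> \<omega> \<partial>P) = (\<integral>\<omega>. increment n \<xi> m\<^sub>0' \<mu> \<omega> \<partial>P)) \<and>
     (\<forall>m\<^sub>0 m \<mu>\<^sub>1 \<mu>\<^sub>2. integrable P
        (\<lambda>\<omega>. increment n \<xi> (m\<^sub>0 + m) \<mu>\<^sub>1 \<omega> * cnj (increment n \<xi> m\<^sub>0 \<mu>\<^sub>2 \<omega>))) \<and>
     (\<forall>m\<^sub>0 m\<^sub>0' m \<mu>\<^sub>1 \<mu>\<^sub>2.
        (\<integral>\<omega>. increment n \<xi> (m\<^sub>0 + m) \<mu>\<^sub>1 \<omega> * cnj (increment n \<xi> m\<^sub>0 \<mu>\<^sub>2 \<omega>) \<partial>P) =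
        (\<integral>\<omega>. increment n \<xi> (m\<^sub>0' + m) \<mu>\<^sub>1 \<omega> * cnj (increment n \<xi> m\<^sub>0' \<mu>\<^sub>2 \<omega>) \<partial>P))"

definition zero_mean_increments :: "'a measure \<Rightarrow> nat \<Rightarrow> (int \<Rightarrow> 'a \<Rightarrow> complex) \<Rightarrow> bool" where
  "zero_mean_increments P n \<xi> \<longleftrightarrow> (\<forall>m \<mu>. (\<integral>\<omega>. increment n \<xi> m \<mu> \<omega> \<partial>P) = 0)"


section \<open>Spectral representation\<close>

definition spectral_function :: "(real \<Rightarrow> real) \<Rightarrow> bool" where
  "spectral_function F \<longleftrightarrow> F (-pi) = 0 \<and> mono_on {-pi..pi} F \<and> bounded (F ` {-pi..pi}) \<and>
     (\<forall>x\<in>{-pi<..pi}. continuous (at_left x) F)"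

text \<open>The Borel measure on the half-open interval generated by \<open>F\<close>. As \<open>F\<close> is left-continuous,
  its increment \<open>F b - F a\<close> is the mass of \<open>{a..<b}\<close>.\<close>

definition spectral_measure :: "(real \<Rightarrow> real) \<Rightarrow> real measure" where
  "spectral_measure F = (THE M. sets M = sets (restrict_space borel {-pi..<pi}) \<and>
     (\<forall>x\<in>{-pi..pi}. emeasure M {-pi..<x} = ennreal (F x)))"

text \<open>The density is normalized by \<open>dF(x) = f(x) dx / (2 \<pi>)\<close>; in particular \<open>F\<close> is absolutely
  continuous.\<close>

definition has_spectral_density :: "(real \<Rightarrow> real) \<Rightarrow> (real \<Rightarrow> real) \<Rightarrow> bool" where
  "has_spectral_density F f \<longleftrightarrow> set_integrable lborel {-pi..pi} f \<and>
     (\<forall>x\<in>{-pi..pi}. F x = 1 / (2 * pi) * (LINT l:{-pi..x}|lborel. f l))"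

definition orthogonal_stochastic_measure ::
    "'a measure \<Rightarrow> real measure \<Rightarrow> (real set \<Rightarrow> 'a \<Rightarrow> complex) \<Rightarrow> bool" where
  "orthogonal_stochastic_measure P M Z \<longleftrightarrow>
     (\<forall>A\<in>sets M. Z A \<in> L2 P) \<and>
     (\<forall>A\<in>sets M. \<forall>B\<in>sets M. A \<inter> B = {} \<longrightarrow> (AE \<omega> in P. Z (A \<union> B) \<omega> = Z A \<omega> + Z B \<omega>)) \<and>
     (\<forall>A\<in>sets M. \<forall>B\<in>sets M.
        (\<integral>\<omega>. Z A \<omega> * cnj (Z B \<omega>) \<partial>P) = complex_of_real (measure M (A \<inter> B)))"

text \<open>\<open>X\<close> is (a version of) the stochastic integral of \<open>g\<close> with respect to \<open>Z\<close>: the mean square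
  limit of the elementary integrals of simple functions converging to \<open>g\<close> in \<open>L2 M\<close>.\<close>

definition has_stochastic_integral ::
    "'a measure \<Rightarrow> real measure \<Rightarrow> (real set \<Rightarrow> 'a \<Rightarrow> complex) \<Rightarrow> (real \<Rightarrow> complex) \<Rightarrow>
     ('a \<Rightarrow> complex) \<Rightarrow> bool" where
  "has_stochastic_integral P M Z g X \<longleftrightarrow> g \<in> L2 M \<and> X \<in> L2 P \<and>
     (\<exists>(p :: nat \<Rightarrow> nat) (c :: nat \<Rightarrow> nat \<Rightarrow> complex) (A :: nat \<Rightarrow> nat \<Rightarrow> real set).
        (\<forall>k i. A k i \<in> sets M) \<and>
        (\<lambda>k. \<integral>x. (cmod (g x - (\<Sum>i<p k. c k i * indicator (A k i) x)))\<^sup>2 \<partial>M) \<longlonglongrightarrow> 0 \<and>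
        (\<lambda>k. \<integral>\<omega>. (cmod (X \<omega> - (\<Sum>i<p k. c k i * Z (A k i) \<omega>)))\<^sup>2 \<partial>P) \<longlonglongrightarrow> 0)"

text \<open>At \<open>0\<close> the kernel takes its limit value.\<close>

definition incr_kernel :: "nat \<Rightarrow> int \<Rightarrow> real \<Rightarrow> complex" where
  "incr_kernel n \<mu> l = (if l = 0 then of_int \<mu> ^ n
     else (1 - cis (- (of_int \<mu> * l))) ^ n / (\<i> * of_real l) ^ n)"

definition spectral_representation ::
    "'a measure \<Rightarrow> nat \<Rightarrow> (int \<Rightarrow> 'a \<Rightarrow> complex) \<Rightarrow> (real \<Rightarrow> real) \<Rightarrow>
     (real set \<Rightarrow> 'a \<Rightarrow> complex) \<Rightarrow> bool" where
  "spectral_representation P n \<xi> F Z \<longleftrightarrow>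
     spectral_function F \<and>
     orthogonal_stochastic_measure P (spectral_measure F) Z \<and>
     (\<forall>m. \<forall>\<mu>>0. has_stochastic_integral P (spectral_measure F) Z
        (\<lambda>l. cis (of_int m * l) * incr_kernel n \<mu> l) (increment n \<xi> m \<mu>))"


section \<open>Factorization and innovations\<close>

definition pseries :: "(nat \<Rightarrow> complex) \<Rightarrow> complex \<Rightarrow> complex" where
  "pseries c z = (\<Sum>k. c k * z ^ k)"

definition canonical_factorization :: "(real \<Rightarrow> real) \<Rightarrow> (nat \<Rightarrow> complex) \<Rightarrow> bool" where
  "canonical_factorization f \<phi> \<longleftrightarrow>
     conv_radius \<phi> > 1 \<and>
     (\<forall>z. cmod z \<le> 1 \<longrightarrow> pseries \<phi> z \<noteq> 0) \<and>
     (AE l in lborel. l \<in> {-pi..pi} \<longrightarrow> f l = (cmod (pseries \<phi> (cis (- l))))\<^sup>2)"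

text \<open>The outer function on the open unit disc; the integrand is set to \<open>0\<close> by the convention
  \<open>ln 0 = 0\<close> at the finitely many zeros of \<open>1 - cis (- l \<mu>)\<close>.\<close>

definition w_mu :: "nat \<Rightarrow> nat \<Rightarrow> complex \<Rightarrow> complex" where
  "w_mu n \<mu> z = exp (1 / (4 * of_real pi) * (LINT l:{-pi..pi}|lborel.
     (cis l + z) / (cis l - z) *
     of_real (ln (cmod (1 - cis (- (l * real \<mu>))) ^ (2 * n) / l ^ (2 * n)))))"

text \<open>The coefficients of \<open>\<Phi>\<^sub>\<mu> = w\<^sub>\<mu> \<Phi>\<close>.\<close>

definition phi_mu :: "nat \<Rightarrow> (nat \<Rightarrow> complex) \<Rightarrow> nat \<Rightarrow> nat \<Rightarrow> complex" where
  "phi_mu n \<phi> \<mu> k = fps_nth (fps_expansion (\<lambda>z. w_mu n \<mu> z * pseries \<phi> z) 0) k"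

definition innovation_sequence ::
    "'a measure \<Rightarrow> nat \<Rightarrow> (int \<Rightarrow> 'a \<Rightarrow> complex) \<Rightarrow> (int \<Rightarrow> 'a \<Rightarrow> complex) \<Rightarrow> bool" where
  "innovation_sequence P n \<xi> \<epsilon> \<longleftrightarrow>
     (\<forall>m. \<epsilon> m \<in> L2 P \<and> (\<integral>\<omega>. \<epsilon> m \<omega> \<partial>P) = 0) \<and>
     (\<forall>m m'. (\<integral>\<omega>. \<epsilon> m \<omega> * cnj (\<epsilon> m' \<omega>) \<partial>P) = (if m = m' then 1 else 0)) \<and>
     (\<forall>t. L2_span P {\<epsilon> m | m. m \<le> t} = L2_span P {increment n \<xi> m \<nu> | m \<nu>. m \<le> t \<and> \<nu> > 0})"

text \<open>\<open>X\<close> is the mean square sum of the series with terms \<open>c k * \<epsilon> (m - k)\<close>.\<close>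

definition moving_average ::
    "'a measure \<Rightarrow> (int \<Rightarrow> 'a \<Rightarrow> complex) \<Rightarrow> (nat \<Rightarrow> complex) \<Rightarrow> int \<Rightarrow> ('a \<Rightarrow> complex) \<Rightarrow> bool" where
  "moving_average P \<epsilon> c m X \<longleftrightarrow>
     (\<lambda>K. mse P X (\<lambda>\<omega>. \<Sum>k<K. c k * \<epsilon> (m - int k) \<omega>)) \<longlonglongrightarrow> 0"


section \<open>The functional and its linear estimates\<close>

definition d_coeff :: "nat \<Rightarrow> nat \<Rightarrow> nat \<Rightarrow> complex" where
  "d_coeff n \<mu> k = fps_nth ((Abs_fps (\<lambda>i. if \<mu> dvd i then 1 else 0)) ^ n) k"

text \<open>Rows are indexed by \<open>k\<close> and columns by \<open>j\<close>, so \<open>D_mat\<close> is upper triangular and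
  \<open>(D_mat *\<^sub>v a)\<^sub>k\<close> is the sum of \<open>a m * d (m - k)\<close> over \<open>k \<le> m \<le> N\<close>.\<close>

definition D_mat :: "nat \<Rightarrow> nat \<Rightarrow> nat \<Rightarrow> complex mat" where
  "D_mat n \<mu> N = Matrix.mat (N + 1) (N + 1) (\<lambda>(k, j). if k \<le> j then d_coeff n \<mu> (j - k) else 0)"

definition A_mat :: "nat \<Rightarrow> (nat \<Rightarrow> complex) \<Rightarrow> complex mat" where
  "A_mat N a = Matrix.mat (N + 1) (N + 1) (\<lambda>(k, j). if k + j \<le> N then a (k + j) else 0)"

definition b_vec :: "nat \<Rightarrow> nat \<Rightarrow> nat \<Rightarrow> (nat \<Rightarrow> complex) \<Rightarrow> complex Matrix.vec" where
  "b_vec n \<mu> N a = D_mat n \<mu> N *\<^sub>v Matrix.vec (N + 1) a"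

definition r_vec ::
    "nat \<Rightarrow> (nat \<Rightarrow> complex) \<Rightarrow> nat \<Rightarrow> nat \<Rightarrow> (nat \<Rightarrow> complex) \<Rightarrow> complex Matrix.vec" where
  "r_vec n \<phi> \<mu> N a = D_mat n \<mu> N *\<^sub>v (A_mat N a *\<^sub>v Matrix.vec (N + 1) (phi_mu n \<phi> \<mu>))"

definition vec_poly :: "complex Matrix.vec \<Rightarrow> complex \<Rightarrow> complex" where
  "vec_poly x z = (\<Sum>k<dim_vec x. vec_index x k * z ^ k)"

definition euclid_norm :: "complex Matrix.vec \<Rightarrow> real" where
  "euclid_norm x = sqrt (\<Sum>k<dim_vec x. (cmod (vec_index x k))\<^sup>2)"

definition v_coeff :: "nat \<Rightarrow> nat \<Rightarrow> nat \<Rightarrow> (nat \<Rightarrow> complex) \<Rightarrow> int \<Rightarrow> complex" where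
  "v_coeff n \<mu> N a k =
     (\<Sum>l\<in>{\<lceil>- real_of_int k / real \<mu>\<rceil>..min \<lfloor>(real N - real_of_int k) / real \<mu>\<rfloor> (int n)}.
        (-1) ^ nat l * of_nat (n choose nat l) * vec_index (b_vec n \<mu> N a) (nat (l * int \<mu> + k)))"

definition A_functional :: "nat \<Rightarrow> (nat \<Rightarrow> complex) \<Rightarrow> (int \<Rightarrow> 'a \<Rightarrow> complex) \<Rightarrow> 'a \<Rightarrow> complex" where
  "A_functional N a \<xi> \<omega> = (\<Sum>k\<le>N. a k * \<xi> (int k) \<omega>)"

definition V_functional ::
    "nat \<Rightarrow> nat \<Rightarrow> nat \<Rightarrow> (nat \<Rightarrow> complex) \<Rightarrow> (int \<Rightarrow> 'a \<Rightarrow> complex) \<Rightarrow> 'a \<Rightarrow> complex" where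
  "V_functional n \<mu> N a \<xi> \<omega> = (\<Sum>k\<in>{- int (\<mu> * n)..-1}. v_coeff n \<mu> N a k * \<xi> k \<omega>)"

text \<open>The space is taken in \<open>L\<^sub>2\<close> of \<open>dF\<close>, which for spectral density \<open>f\<close> is \<open>L\<^sub>2(f)\<close> up to the
  factor \<open>1 / (2 \<pi>)\<close> in the norm.\<close>

definition L2_minus :: "nat \<Rightarrow> nat \<Rightarrow> (real \<Rightarrow> real) \<Rightarrow> (real \<Rightarrow> complex) set" where
  "L2_minus n \<mu> F = L2_span (spectral_measure F)
     {(\<lambda>l. cis (of_int k * l) * incr_kernel n (int \<mu>) l) | k. k \<le> (-1 :: int)}"

text \<open>\<open>Y\<close> is the linear estimate with spectral characteristic \<open>h\<close>.\<close>

definition linear_estimate ::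
    "'a measure \<Rightarrow> nat \<Rightarrow> nat \<Rightarrow> nat \<Rightarrow> (nat \<Rightarrow> complex) \<Rightarrow> (int \<Rightarrow> 'a \<Rightarrow> complex) \<Rightarrow>
     (real \<Rightarrow> real) \<Rightarrow> (real set \<Rightarrow> 'a \<Rightarrow> complex) \<Rightarrow> (real \<Rightarrow> complex) \<Rightarrow> ('a \<Rightarrow> complex) \<Rightarrow> bool" where
  "linear_estimate P n \<mu> N a \<xi> F Z h Y \<longleftrightarrow>
     (\<lambda>l. h l * incr_kernel n (int \<mu>) l) \<in> L2_minus n \<mu> F \<and>
     (\<exists>X. has_stochastic_integral P (spectral_measure F) Z (\<lambda>l. h l * incr_kernel n (int \<mu>) l) X \<and>
        Y = (\<lambda>\<omega>. - V_functional n \<mu> N a \<xi> \<omega> + X \<omega>))"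

definition optimal_linear_estimate ::
    "'a measure \<Rightarrow> nat \<Rightarrow> nat \<Rightarrow> nat \<Rightarrow> (nat \<Rightarrow> complex) \<Rightarrow> (int \<Rightarrow> 'a \<Rightarrow> complex) \<Rightarrow>
     (real \<Rightarrow> real) \<Rightarrow> (real set \<Rightarrow> 'a \<Rightarrow> complex) \<Rightarrow> ('a \<Rightarrow> complex) \<Rightarrow> bool" where
  "optimal_linear_estimate P n \<mu> N a \<xi> F Z Y \<longleftrightarrow>
     (\<exists>h. linear_estimate P n \<mu> N a \<xi> F Z h Y) \<and>
     (\<forall>h' Y'. linear_estimate P n \<mu> N a \<xi> F Z h' Y' \<longrightarrow>
        mse P (A_functional N a \<xi>) Y \<le> mse P (A_functional N a \<xi>) Y')"

definition spectral_char ::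
    "nat \<Rightarrow> (nat \<Rightarrow> complex) \<Rightarrow> nat \<Rightarrow> nat \<Rightarrow> (nat \<Rightarrow> complex) \<Rightarrow> real \<Rightarrow> complex" where
  "spectral_char n \<phi> \<mu> N a l =
     vec_poly (b_vec n \<mu> N a) (cis l) -
     vec_poly (r_vec n \<phi> \<mu> N a) (cis l) * inverse (pseries (phi_mu n \<phi> \<mu>) (cis (- l)))"

end

theory Submission
  imports Defs
begin

text \<open>
  Write \<open>z\<close> for \<open>cis (-l)\<close>. All kernels share one phase: \<open>incr_kernel n \<nu> l\<close> is the value at \<open>z\<close> of
  the outer function \<open>w_mu n \<nu>\<close>, times a factor \<open>\<theta> l\<close> of modulus one that does not depend on \<open>\<nu>\<close>.
  Since the spectral measure has density \<open>(cmod (pseries \<phi> z))\<^sup>2\<close> up to \<open>2 * pi\<close>, the functions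
  \<open>e m l = cis (m * l) * \<theta> l / pseries \<phi> z\<close> are orthonormal in \<open>L\<^sub>2(dF)\<close>, and the kernel of
  the increment at \<open>m\<close> with step \<open>\<nu>\<close> is the sum of \<open>phi_mu n \<phi> \<nu> k * e (m - k)\<close> over \<open>k\<close>. The
  innovations are the stochastic integrals of the functions \<open>e m\<close>.

  By an algebraic identity (\<open>functional_eq_increments\<close>), the functional plus the observed part
  \<open>V_functional\<close> is a combination of the increments at \<open>0, ..., N\<close> with coefficients \<open>b_vec\<close>. In terms
  of the orthonormal functions its kernel splits as a sum over \<open>e 0, ..., e N\<close>, with coefficients
  \<open>r_vec\<close>, and a sum over \<open>e (-1), e (-2), ...\<close> (\<open>target_eq\<close>). The kernels of the admissible
  estimates are exactly the closed span of the functions \<open>e m\<close> with \<open>m \<le> -1\<close> (\<open>L2_minus_eq\<close>), since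
  \<open>phi_mu\<close> generates a function whose only zeros in the closed disc are roots of unity. So the second
  sum is the projection, equal almost everywhere to \<open>spectral_char\<close> times the kernel, the first is the
  error, and Pythagoras gives optimality, uniqueness and the error at once.

  What has to be proved about outer functions is that \<open>w_mu\<close>, defined in the open disc, has the right
  boundary values. The logarithm of \<open>cmod (1 - z ^ \<nu>) / \<bar>l\<bar>\<close> is that of
  \<open>cmod (1 - z ^ \<nu>) / cmod (1 - z)\<close>, whose Schwarz integral is the logarithm of a polynomial
  (\<open>schwarz_log_dist\<close>), plus that of \<open>cmod (1 - z) / \<bar>l\<bar>\<close>, which is smooth on
  \<open>{-pi..pi}\<close> and has Fourier coefficients of order \<open>1 / k\<^sup>2\<close> (\<open>outer_log_series\<close>). Hence the
  outer functions are polynomials times exponentials of absolutely convergent power series, and such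
  exponentials are absolutely convergent again (\<open>has_abs_pseries_exp\<close>). The innovations, the increments and
  the optimal estimate are therefore sums of mean square bounded sequences with absolutely summable
  coefficients, and such sums converge almost surely and in mean square (\<open>L2_abs_series\<close>).
\<close>

section \<open>Square-integrable functions\<close>

lemma cnj_borel_measurable [measurable]: "cnj \<in> borel_measurable borel"
  by (intro borel_measurable_continuous_onI continuous_intros)

lemma L2D: "g \<in> L2 M \<Longrightarrow> g \<in> borel_measurable M" "g \<in> L2 M \<Longrightarrow> integrable M (\<lambda>x. (cmod (g x))\<^sup>2)"
  by (auto simp: L2_def)

lemma L2I: "g \<in> borel_measurable M \<Longrightarrow> integrable M (\<lambda>x. (cmod (g x))\<^sup>2) \<Longrightarrow> g \<in> L2 M"
  by (auto simp: L2_def)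

lemma norm_add_sq: "(cmod (a + b))\<^sup>2 \<le> 2 * (cmod a)\<^sup>2 + 2 * (cmod b)\<^sup>2"
proof -
  have "(cmod (a + b))\<^sup>2 \<le> (cmod a + cmod b)\<^sup>2"
    by (intro power_mono norm_triangle_ineq) auto
  also have "\<dots> \<le> 2 * (cmod a)\<^sup>2 + 2 * (cmod b)\<^sup>2"
    using zero_le_power2[of "cmod a - cmod b"] by (simp add: power2_sum power2_diff)
  finally show ?thesis .
qed

lemma L2_zero: "(\<lambda>x. 0) \<in> L2 M"
  by (intro L2I) auto

lemma L2_add:
  assumes "g \<in> L2 M" "h \<in> L2 M"
  shows "(\<lambda>x. g x + h x) \<in> L2 M"
proof (rule L2I)
  note [measurable] = L2D(1)[OF assms(1)] L2D(1)[OF assms(2)]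
  show "(\<lambda>x. g x + h x) \<in> borel_measurable M" by measurable
  show "integrable M (\<lambda>x. (cmod (g x + h x))\<^sup>2)"
  proof (rule Bochner_Integration.integrable_bound)
    show "integrable M (\<lambda>x. 2 * (cmod (g x))\<^sup>2 + 2 * (cmod (h x))\<^sup>2)"
      using L2D(2)[OF assms(1)] L2D(2)[OF assms(2)] by simp
    show "AE x in M. norm ((cmod (g x + h x))\<^sup>2) \<le> norm (2 * (cmod (g x))\<^sup>2 + 2 * (cmod (h x))\<^sup>2)"
      by (intro AE_I2) (simp add: norm_add_sq)
  qed measurable
qed

lemma L2_scale: "g \<in> L2 M \<Longrightarrow> (\<lambda>x. c * g x) \<in> L2 M"
  by (intro L2I) (auto dest: L2D simp: norm_mult power_mult_distrib)

lemma L2_diff: "g \<in> L2 M \<Longrightarrow> h \<in> L2 M \<Longrightarrow> (\<lambda>x. g x - h x) \<in> L2 M"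
  using L2_add[OF _ L2_scale[of h M "-1"]] by simp

lemma L2_sum: "(\<And>i. i \<in> A \<Longrightarrow> g i \<in> L2 M) \<Longrightarrow> (\<lambda>x. \<Sum>i\<in>A. g i x) \<in> L2 M"
  by (induction A rule: infinite_finite_induct) (auto intro: L2_add L2_zero)

lemma L2_mult_cnj_integrable:
  assumes "u \<in> L2 M" "v \<in> L2 M"
  shows "integrable M (\<lambda>x. u x * cnj (v x))"
proof (rule Bochner_Integration.integrable_bound)
  show "integrable M (\<lambda>x. (cmod (u x))\<^sup>2 + (cmod (v x))\<^sup>2)"
    using assms by (auto dest: L2D)
  show "(\<lambda>x. u x * cnj (v x)) \<in> borel_measurable M"
    using L2D(1)[OF assms(1)] L2D(1)[OF assms(2)] by measurable
  have "cmod (u x) * cmod (v x) \<le> (cmod (u x))\<^sup>2 + (cmod (v x))\<^sup>2" for x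
    using sum_squares_bound[of "cmod (u x)" "cmod (v x)"] mult_nonneg_nonneg[OF norm_ge_zero[of "u x"] norm_ge_zero[of "v x"]]
    unfolding mult.assoc by linarith
  then show "AE x in M. norm (u x * cnj (v x)) \<le> norm ((cmod (u x))\<^sup>2 + (cmod (v x))\<^sup>2)"
    by (auto simp: norm_mult)
qed

lemma mse_nonneg: "mse M g h \<ge> 0"
  by (simp add: mse_def)

lemma mse_commute: "mse M g h = mse M h g"
  by (simp add: mse_def norm_minus_commute)

lemma mse_same [simp]: "mse M g g = 0"
  by (simp add: mse_def)

lemma mse_add:
  assumes "f \<in> L2 M" "g \<in> L2 M" "f' \<in> L2 M" "g' \<in> L2 M"
  shows "mse M (\<lambda>x. f x + g x) (\<lambda>x. f' x + g' x) \<le> 2 * mse M f f' + 2 * mse M g g'"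
proof -
  have "mse M (\<lambda>x. f x + g x) (\<lambda>x. f' x + g' x) \<le> (\<integral>x. 2 * (cmod (f x - f' x))\<^sup>2 + 2 * (cmod (g x - g' x))\<^sup>2 \<partial>M)"
    unfolding mse_def
  proof (intro integral_mono)
    show "integrable M (\<lambda>x. (cmod (f x + g x - (f' x + g' x)))\<^sup>2)"
      using L2D(2)[OF L2_diff[OF L2_add[OF assms(1,2)] L2_add[OF assms(3,4)]]] .
    show "(cmod (f x + g x - (f' x + g' x)))\<^sup>2 \<le> 2 * (cmod (f x - f' x))\<^sup>2 + 2 * (cmod (g x - g' x))\<^sup>2" for x
      using norm_add_sq[of "f x - f' x" "g x - g' x"] by (simp add: algebra_simps)
  qed (use L2D(2)[OF L2_diff[OF assms(1,3)]] L2D(2)[OF L2_diff[OF assms(2,4)]] in auto)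
  then show ?thesis
    using L2D(2)[OF L2_diff[OF assms(1,3)]] L2D(2)[OF L2_diff[OF assms(2,4)]]
    by (simp add: mse_def)
qed

lemma mse_scale: "mse M (\<lambda>x. c * f x) (\<lambda>x. c * g x) = (cmod c)\<^sup>2 * mse M f g"
  by (simp add: mse_def norm_mult power_mult_distrib flip: right_diff_distrib)

lemma mse_triangle:
  assumes "f \<in> L2 M" "g \<in> L2 M" "h \<in> L2 M"
  shows "mse M f h \<le> 2 * mse M f g + 2 * mse M g h"
proof -
  have "mse M f h = mse M (\<lambda>x. f x + (-1) * g x + g x) (\<lambda>x. g x + (-1) * g x + h x)"
    by (simp add: mse_def)
  also have "\<dots> \<le> 2 * mse M (\<lambda>x. f x + (-1) * g x) (\<lambda>x. g x + (-1) * g x) + 2 * mse M g h"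
    by (intro mse_add L2_add L2_scale assms)
  also have "mse M (\<lambda>x. f x + (-1) * g x) (\<lambda>x. g x + (-1) * g x) = mse M f g"
    by (simp add: mse_def)
  finally show ?thesis .
qed

lemma mse_AE_cong:
  assumes "f \<in> borel_measurable M" "g \<in> borel_measurable M" "f' \<in> borel_measurable M" "AE x in M. f x = f' x"
  shows "mse M f g = mse M f' g"
  unfolding mse_def using assms by (intro integral_cong_AE) auto

lemma mse_eq_0_AE:
  assumes "f \<in> L2 M" "g \<in> L2 M" "mse M f g = 0"
  shows "AE x in M. f x = g x"
  using assms integral_nonneg_eq_0_iff_AE[of M "\<lambda>x. (cmod (f x - g x))\<^sup>2"] L2D(2)[OF L2_diff[of f M g]]
  by (auto simp: mse_def)

lemma Cauchy_Schwarz_L2: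
  assumes "u \<in> L2 M" "v \<in> L2 M"
  shows "(cmod (\<integral>x. u x * cnj (v x) \<partial>M))\<^sup>2 \<le> (\<integral>x. (cmod (u x))\<^sup>2 \<partial>M) * (\<integral>x. (cmod (v x))\<^sup>2 \<partial>M)"
proof -
  note [measurable] = L2D(1)[OF assms(1)] L2D(1)[OF assms(2)]
  note i = L2_mult_cnj_integrable[OF assms]
  have i': "integrable M (\<lambda>x. cmod (u x) * cmod (v x))"
    using integrable_norm[OF i] by (simp add: norm_mult)
  let ?a = "\<integral>x. (cmod (u x))\<^sup>2 \<partial>M" and ?b = "\<integral>x. (cmod (v x))\<^sup>2 \<partial>M" and ?c = "\<integral>x. cmod (u x) * cmod (v x) \<partial>M"
  have "(\<integral>\<^sup>+x. ennreal (cmod (u x)) * ennreal (cmod (v x)) \<partial>M)\<^sup>2 \<le>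
      (\<integral>\<^sup>+x. (ennreal (cmod (u x)))\<^sup>2 \<partial>M) * (\<integral>\<^sup>+x. (ennreal (cmod (v x)))\<^sup>2 \<partial>M)"
    by (intro Cauchy_Schwarz_nn_integral) measurable
  also have "(\<integral>\<^sup>+x. (ennreal (cmod (u x)))\<^sup>2 \<partial>M) = ennreal ?a"
    using L2D(2)[OF assms(1)] by (simp add: ennreal_power nn_integral_eq_integral)
  also have "(\<integral>\<^sup>+x. (ennreal (cmod (v x)))\<^sup>2 \<partial>M) = ennreal ?b"
    using L2D(2)[OF assms(2)] by (simp add: ennreal_power nn_integral_eq_integral)
  also have "(\<integral>\<^sup>+x. ennreal (cmod (u x)) * ennreal (cmod (v x)) \<partial>M) = ennreal ?c"
    using i' by (simp add: nn_integral_eq_integral flip: ennreal_mult)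
  finally have "?c\<^sup>2 \<le> ?a * ?b"
    by (simp add: ennreal_power flip: ennreal_mult)
  moreover have "cmod (\<integral>x. u x * cnj (v x) \<partial>M) \<le> ?c"
    using integral_norm_bound[of M "\<lambda>x. u x * cnj (v x)"] by (simp add: norm_mult)
  ultimately show ?thesis
    by (meson norm_ge_zero order_trans power_mono)
qed

text \<open>Continuity of the inner product is what carries isometry and orthogonality from
  elementary functions to their mean square limits.\<close>
lemma tendsto_inner_L2:
  assumes "u \<in> L2 M" "v \<in> L2 M" "\<And>k. U k \<in> L2 M" "\<And>k. V k \<in> L2 M"
    and "(\<lambda>k. mse M u (U k)) \<longlonglongrightarrow> 0" "(\<lambda>k. mse M v (V k)) \<longlonglongrightarrow> 0"
  shows "(\<lambda>k. \<integral>x. U k x * cnj (V k x) \<partial>M) \<longlonglongrightarrow> (\<integral>x. u x * cnj (v x) \<partial>M)"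
proof -
  let ?n = "\<lambda>w :: 'a \<Rightarrow> complex. \<integral>x. (cmod (w x))\<^sup>2 \<partial>M"
  let ?i = "\<lambda>w w' :: 'a \<Rightarrow> complex. \<integral>x. w x * cnj (w' x) \<partial>M"
  let ?d = "\<lambda>k x. u x - U k x" and ?e = "\<lambda>k x. v x - V k x"
  have d: "?d k \<in> L2 M" and e: "?e k \<in> L2 M" for k
    by (intro L2_diff assms)+
  have bnd: "cmod (?i w w') \<le> sqrt (?n w * ?n w')" if "w \<in> L2 M" "w' \<in> L2 M" for w w'
    using Cauchy_Schwarz_L2[OF that] by (simp add: real_le_rsqrt)
  have 1: "(\<lambda>k. ?i (?d k) v) \<longlonglongrightarrow> 0"
    by (rule Lim_null_comparison[OF always_eventually[OF allI[OF bnd]]])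
       (use assms(5) in \<open>auto intro!: d assms tendsto_eq_intros simp: mse_def\<close>)
  have 2: "(\<lambda>k. ?i u (?e k)) \<longlonglongrightarrow> 0"
    by (rule Lim_null_comparison[OF always_eventually[OF allI[OF bnd]]])
       (use assms(6) in \<open>auto intro!: e assms tendsto_eq_intros simp: mse_def\<close>)
  have 3: "(\<lambda>k. ?i (?d k) (?e k)) \<longlonglongrightarrow> 0"
    by (rule Lim_null_comparison[OF always_eventually[OF allI[OF bnd]]])
       (use assms(5,6) in \<open>auto intro!: d e assms tendsto_eq_intros simp: mse_def\<close>)
  have "?i (U k) (V k) = ?i u v - ?i (?d k) v - ?i u (?e k) + ?i (?d k) (?e k)" for k
  proof -
    have "?i (U k) (V k) = (\<integral>x. u x * cnj (v x) - ?d k x * cnj (v x) - u x * cnj (?e k x) + ?d k x * cnj (?e k x) \<partial>M)"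
      by (intro Bochner_Integration.integral_cong) (auto simp: algebra_simps)
    also have "\<dots> = ?i u v - ?i (?d k) v - ?i u (?e k) + ?i (?d k) (?e k)"
      using L2_mult_cnj_integrable[OF assms(1,2)] L2_mult_cnj_integrable[OF d assms(2), of k]
        L2_mult_cnj_integrable[OF assms(1) e, of k] L2_mult_cnj_integrable[OF d e, of k k]
      by (simp del: complex_cnj_diff)
    finally show ?thesis .
  qed
  then show ?thesis
    using tendsto_add[OF tendsto_diff[OF tendsto_diff[OF tendsto_const[of "?i u v"] 1] 2] 3] by simp
qed

text \<open>Cauchy-Schwarz with the weights \<open>cmod (c k)\<close>: summable coefficients control the
  square of a sum by the squares of its terms.\<close>
lemma norm_sum_sq_le:
  assumes "finite A"
  shows "(cmod (\<Sum>k\<in>A. c k * X k))\<^sup>2 \<le> (\<Sum>k\<in>A. cmod (c k)) * (\<Sum>k\<in>A. cmod (c k) * (cmod (X k))\<^sup>2)"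
proof -
  have "(cmod (\<Sum>k\<in>A. c k * X k))\<^sup>2 \<le> (\<Sum>k\<in>A. cmod (c k) * cmod (X k))\<^sup>2"
    by (intro power_mono order_trans[OF norm_sum]) (auto simp: norm_mult)
  also have "\<dots> = (\<Sum>k\<in>A. sqrt (cmod (c k)) * (sqrt (cmod (c k)) * cmod (X k)))\<^sup>2"
    by (simp flip: mult.assoc)
  also have "\<dots> \<le> (\<Sum>k\<in>A. (sqrt (cmod (c k)))\<^sup>2) * (\<Sum>k\<in>A. (sqrt (cmod (c k)) * cmod (X k))\<^sup>2)"
    by (rule Cauchy_Schwarz_ineq_sum)
  finally show ?thesis
    by (simp add: power_mult_distrib)
qed

text \<open>The sum converges absolutely almost everywhere, so its pointwise value is the mean
  square limit. The innovations and the optimal estimate are sums of this kind.\<close>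
lemma L2_abs_series:
  fixes c :: "nat \<Rightarrow> complex" and X :: "nat \<Rightarrow> 'a \<Rightarrow> complex"
  assumes X: "\<And>k. X k \<in> L2 M" and B: "\<And>k. (\<integral>x. (cmod (X k x))\<^sup>2 \<partial>M) \<le> B"
    and c: "summable (\<lambda>k. cmod (c k))"
  shows "(\<lambda>x. \<Sum>k. c k * X k x) \<in> L2 M"
    and "(\<lambda>K. mse M (\<lambda>x. \<Sum>k. c k * X k x) (\<lambda>x. \<Sum>k<K. c k * X k x)) \<longlonglongrightarrow> 0"
proof -
  note [measurable] = L2D(1)[OF X]
  let ?Y = "\<lambda>x. \<Sum>k. c k * X k x" and ?S = "\<lambda>K x. \<Sum>k<K. c k * X k x"
  have B0: "B \<ge> 0"
    by (rule order_trans[OF _ B[of 0]]) simp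
  define t where "t = (\<lambda>K. \<Sum>k. cmod (c (k + K)))"
  have ts: "summable (\<lambda>k. cmod (c (k + K)))" for K
    by (rule summable_ignore_initial_segment[OF c])
  have t0: "t K \<ge> 0" for K
    unfolding t_def by (intro suminf_nonneg ts) auto
  have t_lim: "t \<longlonglongrightarrow> 0"
    using suminf_exist_split2[OF c] by (simp add: t_def)
  have part: "(\<Sum>k\<in>{K..<J}. cmod (c k)) \<le> t K" for K J
  proof -
    have "(\<Sum>k\<in>{K..<J}. cmod (c k)) = (\<Sum>k<J-K. cmod (c (k + K)))"
      by (intro sum.reindex_bij_witness[of _ "\<lambda>k. k + K" "\<lambda>k. k - K"]) auto
    also have "\<dots> \<le> t K"
      unfolding t_def by (intro sum_le_suminf ts) auto
    finally show ?thesis .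
  qed
  have nn: "(\<integral>\<^sup>+x. ennreal ((cmod (X k x))\<^sup>2) \<partial>M) \<le> ennreal B" for k
    using L2D(2)[OF X[of k]] B[of k] by (simp add: nn_integral_eq_integral ennreal_leI)
  \<comment> \<open>Since \<open>t \<le> 1 + t\<^sup>2\<close>, it is enough that \<open>\<Sum>k. cmod (c k) * (cmod (X k x))\<^sup>2\<close> is finite
    almost everywhere, and its integral is at most \<open>B * (\<Sum>k. cmod (c k))\<close>.\<close>
  have "AE x in M. summable (\<lambda>k. c k * X k x)"
  proof -
    have "(\<integral>\<^sup>+x. (\<Sum>k. ennreal (cmod (c k)) * ennreal ((cmod (X k x))\<^sup>2)) \<partial>M) =
        (\<Sum>k. ennreal (cmod (c k)) * (\<integral>\<^sup>+x. ennreal ((cmod (X k x))\<^sup>2) \<partial>M))"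
      by (simp add: nn_integral_suminf nn_integral_cmult)
    also have "\<dots> \<le> (\<Sum>k. ennreal (cmod (c k)) * ennreal B)"
      by (intro suminf_le mult_left_mono nn) auto
    also have "\<dots> = (\<Sum>k. ennreal (cmod (c k) * B))"
      by (simp add: ennreal_mult B0)
    also have "\<dots> < \<infinity>"
      by (subst suminf_ennreal2) (auto intro!: summable_mult2 c B0 mult_nonneg_nonneg)
    finally have "AE x in M. (\<Sum>k. ennreal (cmod (c k)) * ennreal ((cmod (X k x))\<^sup>2)) \<noteq> \<infinity>"
      by (intro nn_integral_PInf_AE) auto
    then show ?thesis
    proof eventually_elim
      case (elim x)
      have "summable (\<lambda>k. cmod (c k) * (cmod (X k x))\<^sup>2)"
        by (rule summable_suminf_not_top) (use elim in \<open>auto simp: ennreal_mult\<close>)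
      from summable_add[OF c this] have "summable (\<lambda>k. cmod (c k) + cmod (c k) * (cmod (X k x))\<^sup>2)" .
      then show ?case
      proof (rule summable_comparison_test')
        fix k
        have "cmod (X k x) \<le> 1 + (cmod (X k x))\<^sup>2"
          using sum_squares_bound[of 1 "cmod (X k x)"] norm_ge_zero[of "X k x"] by (simp, linarith)
        from mult_left_mono[OF this norm_ge_zero[of "c k"]]
        show "norm (c k * X k x) \<le> cmod (c k) + cmod (c k) * (cmod (X k x))\<^sup>2"
          by (simp add: norm_mult distrib_left)
      qed
    qed
  qed
  then have conv: "AE x in M. (\<lambda>J. ?S J x) \<longlonglongrightarrow> ?Y x"
    by eventually_elim (rule summable_LIMSEQ)
  \<comment> \<open>Fatou transfers the bound for finite blocks to the whole tail.\<close>
  have tail: "(\<integral>\<^sup>+x. ennreal ((cmod (?Y x - ?S K x))\<^sup>2) \<partial>M) \<le> ennreal ((t K)\<^sup>2 * B)" for K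
  proof -
    have fin: "(\<integral>\<^sup>+x. ennreal ((cmod (?S J x - ?S K x))\<^sup>2) \<partial>M) \<le> ennreal ((t K)\<^sup>2 * B)" if "J \<ge> K" for J
    proof -
      have d: "?S J x - ?S K x = (\<Sum>k\<in>{K..<J}. c k * X k x)" for x
        using that by (metis (lifting) ivl_disj_un_one(2) lessThan_atLeast0 sum_diff_nat_ivl le0)
      have "(\<integral>\<^sup>+x. ennreal ((cmod (?S J x - ?S K x))\<^sup>2) \<partial>M) \<le>
          (\<integral>\<^sup>+x. ennreal (t K) * (\<Sum>k\<in>{K..<J}. ennreal (cmod (c k)) * ennreal ((cmod (X k x))\<^sup>2)) \<partial>M)"
      proof (intro nn_integral_mono)
        fix x
        have "(cmod (?S J x - ?S K x))\<^sup>2 \<le> t K * (\<Sum>k\<in>{K..<J}. cmod (c k) * (cmod (X k x))\<^sup>2)"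
          unfolding d by (intro order_trans[OF norm_sum_sq_le] mult_right_mono part sum_nonneg) auto
        then show "ennreal ((cmod (?S J x - ?S K x))\<^sup>2) \<le>
            ennreal (t K) * (\<Sum>k\<in>{K..<J}. ennreal (cmod (c k)) * ennreal ((cmod (X k x))\<^sup>2))"
          using t0 by (simp add: sum_nonneg ennreal_leI flip: ennreal_mult)
      qed
      also have "\<dots> = ennreal (t K) * (\<Sum>k\<in>{K..<J}. ennreal (cmod (c k)) * (\<integral>\<^sup>+x. ennreal ((cmod (X k x))\<^sup>2) \<partial>M))"
        by (simp add: nn_integral_cmult nn_integral_sum)
      also have "\<dots> \<le> ennreal (t K) * (\<Sum>k\<in>{K..<J}. ennreal (cmod (c k)) * ennreal B)"
        by (intro mult_left_mono sum_mono nn) auto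
      also have "\<dots> = ennreal (t K * ((\<Sum>k\<in>{K..<J}. cmod (c k)) * B))"
        using t0 B0 by (simp add: sum_nonneg sum_distrib_right flip: ennreal_mult)
      also have "\<dots> \<le> ennreal ((t K)\<^sup>2 * B)"
        using part t0 B0 by (intro ennreal_leI) (simp add: power2_eq_square mult.assoc mult_left_mono mult_right_mono)
      finally show ?thesis .
    qed
    have "(\<integral>\<^sup>+x. ennreal ((cmod (?Y x - ?S K x))\<^sup>2) \<partial>M) =
        (\<integral>\<^sup>+x. liminf (\<lambda>J. ennreal ((cmod (?S J x - ?S K x))\<^sup>2)) \<partial>M)"
    proof (intro nn_integral_cong_AE, use conv in eventually_elim)
      case (elim x)
      then have "(\<lambda>J. ennreal ((cmod (?S J x - ?S K x))\<^sup>2)) \<longlonglongrightarrow> ennreal ((cmod (?Y x - ?S K x))\<^sup>2)"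
        by (intro tendsto_intros)
      then show ?case
        by (rule lim_imp_Liminf[OF sequentially_bot, symmetric])
    qed
    also have "\<dots> \<le> liminf (\<lambda>J. \<integral>\<^sup>+x. ennreal ((cmod (?S J x - ?S K x))\<^sup>2) \<partial>M)"
      by (intro nn_integral_liminf) measurable
    also have "\<dots> \<le> ennreal ((t K)\<^sup>2 * B)"
      by (intro Liminf_le) (auto intro!: eventually_sequentiallyI[of K] fin)
    finally show ?thesis .
  qed
  have dL2: "(\<lambda>x. ?Y x - ?S K x) \<in> L2 M" for K
  proof (intro L2I integrableI_bounded)
    show "(\<integral>\<^sup>+x. ennreal (norm ((cmod (?Y x - ?S K x))\<^sup>2)) \<partial>M) < \<infinity>"
      using tail[of K] by (simp add: le_less_trans)
  qed measurable
  from dL2[of 0] show "?Y \<in> L2 M" by simp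
  have le: "mse M ?Y (?S K) \<le> (t K)\<^sup>2 * B" for K
    using tail[of K] L2D(2)[OF dL2[of K]] B0 by (simp add: mse_def nn_integral_eq_integral)
  show "(\<lambda>K. mse M ?Y (?S K)) \<longlonglongrightarrow> 0"
  proof (rule tendsto_sandwich[OF _ _ tendsto_const])
    show "(\<lambda>K. (t K)\<^sup>2 * B) \<longlonglongrightarrow> 0"
      by (auto intro!: tendsto_eq_intros t_lim)
  qed (use le in \<open>auto simp: mse_nonneg\<close>)
qed

section \<open>Closed linear spans\<close>

lemma L2_spanD: "g \<in> L2_span M S \<Longrightarrow> g \<in> L2 M"
  by (simp add: L2_span_def)

lemma L2_span_approx:
  assumes "g \<in> L2_span M S" "e > 0"
  obtains T c where "finite T" "T \<subseteq> S" "mse M g (\<lambda>x. \<Sum>t\<in>T. c t * t x) < e"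
  using assms unfolding L2_span_def mse_def by blast

lemma L2_spanI:
  assumes "g \<in> L2 M" "\<And>e. e > 0 \<Longrightarrow> \<exists>T c. finite T \<and> T \<subseteq> S \<and> mse M g (\<lambda>x. \<Sum>t\<in>T. c t * t x) < e"
  shows "g \<in> L2_span M S"
  using assms unfolding L2_span_def mse_def by blast

lemma L2_span_base:
  assumes "S \<subseteq> L2 M" "s \<in> S"
  shows "s \<in> L2_span M S"
proof (rule L2_spanI)
  fix e :: real assume "e > 0"
  then show "\<exists>T c. finite T \<and> T \<subseteq> S \<and> mse M s (\<lambda>x. \<Sum>t\<in>T. c t * t x) < e"
    using assms by (intro exI[of _ "{s}"] exI[of _ "\<lambda>_. 1"]) auto
qed (use assms in auto)

lemma L2_span_zero: "(\<lambda>x. 0) \<in> L2_span M S"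
  by (rule L2_spanI[OF L2_zero]) (auto intro!: exI[of _ "{}"])

lemma L2_span_scale:
  assumes "g \<in> L2_span M S"
  shows "(\<lambda>x. a * g x) \<in> L2_span M S"
proof (cases "a = 0")
  case True
  then show ?thesis by (simp add: L2_span_zero)
next
  case False
  show ?thesis
  proof (rule L2_spanI)
    fix e :: real assume e: "e > 0"
    have "e / (cmod a)\<^sup>2 > 0" using e False by simp
    with assms obtain T c where T: "finite T" "T \<subseteq> S" "mse M g (\<lambda>x. \<Sum>t\<in>T. c t * t x) < e / (cmod a)\<^sup>2"
      by (rule L2_span_approx)
    have "mse M (\<lambda>x. a * g x) (\<lambda>x. \<Sum>t\<in>T. (a * c t) * t x) = (cmod a)\<^sup>2 * mse M g (\<lambda>x. \<Sum>t\<in>T. c t * t x)"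
      by (subst mse_scale[symmetric]) (simp add: sum_distrib_left mult.assoc)
    also have "\<dots> < e"
      using T(3) False by (simp add: pos_less_divide_eq mult.commute)
    finally show "\<exists>T c. finite T \<and> T \<subseteq> S \<and> mse M (\<lambda>x. a * g x) (\<lambda>x. \<Sum>t\<in>T. c t * t x) < e"
      using T(1,2) by (intro exI[of _ T] exI[of _ "\<lambda>t. a * c t"] conjI)
  qed (intro L2_scale L2_spanD[OF assms])
qed

lemma L2_span_add:
  assumes "S \<subseteq> L2 M" "g \<in> L2_span M S" "h \<in> L2_span M S"
  shows "(\<lambda>x. g x + h x) \<in> L2_span M S"
proof (rule L2_spanI)
  fix e :: real assume e: "e > 0"
  obtain T c where T: "finite T" "T \<subseteq> S" "mse M g (\<lambda>x. \<Sum>t\<in>T. c t * t x) < e / 4"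
    by (rule L2_span_approx[OF assms(2), of "e/4"]) (use e in simp)
  obtain U d where U: "finite U" "U \<subseteq> S" "mse M h (\<lambda>x. \<Sum>t\<in>U. d t * t x) < e / 4"
    by (rule L2_span_approx[OF assms(3), of "e/4"]) (use e in simp)
  define b where "b = (\<lambda>t. (if t \<in> T then c t else 0) + (if t \<in> U then d t else 0))"
  have *: "(\<Sum>t\<in>T \<union> U. b t * t x) = (\<Sum>t\<in>T. c t * t x) + (\<Sum>t\<in>U. d t * t x)" for x
  proof -
    have "(\<Sum>t\<in>T \<union> U. b t * t x) = (\<Sum>t\<in>T \<union> U. if t \<in> T then c t * t x else 0) + (\<Sum>t\<in>T \<union> U. if t \<in> U then d t * t x else 0)"
      by (subst sum.distrib[symmetric], intro sum.cong) (auto simp: b_def distrib_right)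
    also have "\<dots> = (\<Sum>t\<in>T. c t * t x) + (\<Sum>t\<in>U. d t * t x)"
      using T(1) U(1) by (simp add: sum.If_cases Int_absorb1)
    finally show ?thesis .
  qed
  have "mse M (\<lambda>x. g x + h x) (\<lambda>x. \<Sum>t\<in>T \<union> U. b t * t x) \<le>
      2 * mse M g (\<lambda>x. \<Sum>t\<in>T. c t * t x) + 2 * mse M h (\<lambda>x. \<Sum>t\<in>U. d t * t x)"
    unfolding * using T(2) U(2) assms(1)
    by (intro mse_add L2_sum L2_scale L2_spanD[OF assms(2)] L2_spanD[OF assms(3)]) (rule subsetD, assumption, erule (1) subsetD)+
  also have "\<dots> < e" using T(3) U(3) by simp
  finally show "\<exists>T c. finite T \<and> T \<subseteq> S \<and> mse M (\<lambda>x. g x + h x) (\<lambda>x. \<Sum>t\<in>T. c t * t x) < e"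
    using T(1,2) U(1,2) by (intro exI[of _ "T \<union> U"] exI[of _ b] conjI finite_UnI Un_least)
qed (intro L2_add L2_spanD[OF assms(2)] L2_spanD[OF assms(3)])

lemma L2_span_sum:
  assumes "S \<subseteq> L2 M" "\<And>i. i \<in> A \<Longrightarrow> g i \<in> L2_span M S"
  shows "(\<lambda>x. \<Sum>i\<in>A. c i * g i x) \<in> L2_span M S"
  using assms(2)
  by (induction A rule: infinite_finite_induct) (auto intro!: L2_span_add L2_span_zero assms(1) L2_span_scale)

lemma L2_span_limit:
  assumes S: "S \<subseteq> L2 M" and g: "g \<in> L2 M" and lim: "\<And>e. e > 0 \<Longrightarrow> \<exists>h\<in>L2_span M S. mse M g h < e"
  shows "g \<in> L2_span M S"
proof (rule L2_spanI[OF g])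
  fix e :: real assume e: "e > 0"
  then obtain h where h: "h \<in> L2_span M S" "mse M g h < e / 4"
    using lim[of "e/4"] by auto
  obtain T c where T: "finite T" "T \<subseteq> S" "mse M h (\<lambda>x. \<Sum>t\<in>T. c t * t x) < e / 4"
    by (rule L2_span_approx[OF h(1), of "e/4"]) (use e in simp)
  have "mse M g (\<lambda>x. \<Sum>t\<in>T. c t * t x) \<le> 2 * mse M g h + 2 * mse M h (\<lambda>x. \<Sum>t\<in>T. c t * t x)"
    using T S by (intro mse_triangle g L2_spanD[OF h(1)] L2_sum L2_scale) auto
  also have "\<dots> < e" using h(2) T(3) by simp
  finally show "\<exists>T c. finite T \<and> T \<subseteq> S \<and> mse M g (\<lambda>x. \<Sum>t\<in>T. c t * t x) < e"
    using T(1,2) by (intro exI[of _ T] exI[of _ c] conjI)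
qed

lemma L2_span_limit_seq:
  assumes S: "S \<subseteq> L2 M" and g: "g \<in> L2 M" and h: "\<And>k. h k \<in> L2_span M S"
    and lim: "(\<lambda>k. mse M g (h k)) \<longlonglongrightarrow> 0"
  shows "g \<in> L2_span M S"
proof (rule L2_span_limit[OF S g])
  fix e :: real assume "e > 0"
  with lim have "\<forall>\<^sub>F k in sequentially. mse M g (h k) < e"
    by (simp add: order_tendstoD)
  then show "\<exists>h\<in>L2_span M S. mse M g h < e"
    using h by (auto simp: eventually_sequentially)
qed

text \<open>A closed span is already closed, so two spans are compared by comparing their
  generators.\<close>
lemma L2_span_subset:
  assumes "S' \<subseteq> L2 M" "S \<subseteq> L2_span M S'"
  shows "L2_span M S \<subseteq> L2_span M S'"
proof
  fix g assume g: "g \<in> L2_span M S"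
  show "g \<in> L2_span M S'"
  proof (rule L2_span_limit[OF assms(1) L2_spanD[OF g]])
    fix e :: real assume "e > 0"
    with g obtain T c where T: "finite T" "T \<subseteq> S" "mse M g (\<lambda>x. \<Sum>t\<in>T. c t * t x) < e"
      by (rule L2_span_approx)
    then show "\<exists>h\<in>L2_span M S'. mse M g h < e"
      using assms by (intro bexI[of _ "\<lambda>x. \<Sum>t\<in>T. c t * t x"] L2_span_sum) auto
  qed
qed

lemma inner_L2_span_eq_0:
  assumes S: "S \<subseteq> L2 M" and u: "u \<in> L2 M" and 0: "\<And>s. s \<in> S \<Longrightarrow> (\<integral>x. u x * cnj (s x) \<partial>M) = 0"
    and g: "g \<in> L2_span M S"
  shows "(\<integral>x. u x * cnj (g x) \<partial>M) = 0"
proof -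
  have "\<exists>h. h \<in> L2 M \<and> (\<integral>x. u x * cnj (h x) \<partial>M) = 0 \<and> mse M g h < 1 / real (Suc k)" for k
  proof -
    obtain T c where T: "finite T" "T \<subseteq> S" and lt: "mse M g (\<lambda>x. \<Sum>t\<in>T. c t * t x) < 1 / real (Suc k)"
      by (rule L2_span_approx[OF g, of "1 / real (Suc k)"]) simp
    have "(\<integral>x. u x * cnj (\<Sum>t\<in>T. c t * t x) \<partial>M) = (\<integral>x. (\<Sum>t\<in>T. cnj (c t) * (u x * cnj (t x))) \<partial>M)"
      by (simp add: sum_distrib_left mult_ac)
    also have "\<dots> = (\<Sum>t\<in>T. cnj (c t) * (\<integral>x. u x * cnj (t x) \<partial>M))"
      by (subst Bochner_Integration.integral_sum)
         (simp_all add: L2_mult_cnj_integrable[OF u subsetD[OF S subsetD[OF T(2)]]])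
    also have "\<dots> = 0"
      by (intro sum.neutral ballI) (simp add: 0[OF subsetD[OF T(2)]])
    finally have "(\<integral>x. u x * cnj (\<Sum>t\<in>T. c t * t x) \<partial>M) = 0" .
    moreover have "(\<lambda>x. \<Sum>t\<in>T. c t * t x) \<in> L2 M"
      by (intro L2_sum L2_scale subsetD[OF S] subsetD[OF T(2)])
    ultimately show ?thesis
      using lt by (intro exI[of _ "\<lambda>x. \<Sum>t\<in>T. c t * t x"] conjI)
  qed
  then obtain h where h: "\<And>k. h k \<in> L2 M" "\<And>k. (\<integral>x. u x * cnj (h k x) \<partial>M) = 0"
    and lt: "\<And>k. mse M g (h k) < 1 / real (Suc k)"
    by metis
  have lim: "(\<lambda>k. mse M g (h k)) \<longlonglongrightarrow> 0"
  proof (rule Lim_null_comparison[OF always_eventually[OF allI]])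
    show "norm (mse M g (h k)) \<le> 1 / real (Suc k)" for k
      by (simp add: mse_nonneg less_imp_le[OF lt] del: of_nat_Suc)
    show "(\<lambda>k. 1 / real (Suc k)) \<longlonglongrightarrow> 0"
      by (rule LIMSEQ_Suc[OF lim_1_over_n])
  qed
  from tendsto_inner_L2[OF u L2_spanD[OF g] u h(1) _ lim] show ?thesis
    by (simp add: LIMSEQ_const_iff h(2))
qed

lemma L2_Pythagoras:
  assumes "u \<in> L2 M" "v \<in> L2 M" "(\<integral>x. u x * cnj (v x) \<partial>M) = 0"
  shows "(\<integral>x. (cmod (u x + v x))\<^sup>2 \<partial>M) = (\<integral>x. (cmod (u x))\<^sup>2 \<partial>M) + (\<integral>x. (cmod (v x))\<^sup>2 \<partial>M)"
proof -
  have e: "(cmod (u x + v x))\<^sup>2 = (cmod (u x))\<^sup>2 + (cmod (v x))\<^sup>2 + 2 * Re (u x * cnj (v x))" for x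
    unfolding cmod_power2 by (simp add: power2_eq_square algebra_simps)
  show ?thesis
    unfolding e using L2D(2)[OF assms(1)] L2D(2)[OF assms(2)] L2_mult_cnj_integrable[OF assms(1,2)] assms(3)
    by (simp del: times_complex.sel complex_cnj)
qed

lemma L2_cong_AE:
  assumes "g \<in> L2 M" "h \<in> borel_measurable M" "AE x in M. g x = h x"
  shows "h \<in> L2 M"
proof (intro L2I assms(2))
  note [measurable] = assms(2)
  have "AE x in M. (cmod (g x))\<^sup>2 = (cmod (h x))\<^sup>2"
    using assms(3) by eventually_elim simp
  then show "integrable M (\<lambda>x. (cmod (h x))\<^sup>2)"
    by (intro integrable_cong_AE_imp[OF L2D(2)[OF assms(1)]]) (auto simp: eq_commute)
qed

lemma L2_span_cong_AE:
  assumes S: "S \<subseteq> L2 M" and g: "g \<in> L2_span M S" and "h \<in> borel_measurable M" "AE x in M. g x = h x"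
  shows "h \<in> L2_span M S"
proof -
  have h: "h \<in> L2 M" by (rule L2_cong_AE[OF L2_spanD[OF g] assms(3,4)])
  have "mse M h g = 0"
    using mse_AE_cong[OF L2D(1)[OF L2_spanD[OF g]] L2D(1)[OF L2_spanD[OF g]] L2D(1)[OF h] assms(4)] by (simp add: mse_commute)
  show ?thesis
  proof (rule L2_span_limit[OF S h])
    fix e :: real assume "e > 0"
    then show "\<exists>h'\<in>L2_span M S. mse M h h' < e"
      using g by (intro bexI[of _ g]) (simp_all add: \<open>mse M h g = 0\<close>)
  qed
qed

section \<open>The stochastic integral\<close>

text \<open>One formula for both sides of the isometry: \<open>W\<close> is \<open>indicator\<close> for simple functions
  and the stochastic measure for their integrals.\<close>
definition elementary :: "(real set \<Rightarrow> 'b \<Rightarrow> complex) \<Rightarrow> nat \<Rightarrow> (nat \<Rightarrow> complex) \<Rightarrow> (nat \<Rightarrow> real set) \<Rightarrow> 'b \<Rightarrow> complex"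
  where "elementary W p c A x = (\<Sum>i<p. c i * W (A i) x)"

lemma has_stochastic_integralD:
  assumes "has_stochastic_integral P M Z g X"
  shows "g \<in> L2 M" "X \<in> L2 P"
  using assms by (auto simp: has_stochastic_integral_def)

text \<open>Approximation to every accuracy instead of along a sequence; this form is stable
  under sums and limits.\<close>
lemma has_stochastic_integral_iff:
  "has_stochastic_integral P M Z g X \<longleftrightarrow> g \<in> L2 M \<and> X \<in> L2 P \<and>
     (\<forall>e>0. \<exists>p c A. (\<forall>i. A i \<in> sets M) \<and> mse M g (elementary indicator p c A) < e \<and>
        mse P X (elementary Z p c A) < e)" (is "?L \<longleftrightarrow> ?R")
proof
  assume L: ?L
  then obtain p c A where A: "\<And>k i. A k i \<in> sets M"
    and l1: "(\<lambda>k. mse M g (elementary indicator (p k) (c k) (A k))) \<longlonglongrightarrow> 0"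
    and l2: "(\<lambda>k. mse P X (elementary Z (p k) (c k) (A k))) \<longlonglongrightarrow> 0"
    unfolding has_stochastic_integral_def mse_def elementary_def by blast
  have "\<exists>p c A. (\<forall>i. A i \<in> sets M) \<and> mse M g (elementary indicator p c A) < e \<and>
        mse P X (elementary Z p c A) < e" if "e > 0" for e
  proof -
    have "\<forall>\<^sub>F k in sequentially. mse M g (elementary indicator (p k) (c k) (A k)) < e \<and>
        mse P X (elementary Z (p k) (c k) (A k)) < e"
      using order_tendstoD(2)[OF l1 that] order_tendstoD(2)[OF l2 that] by eventually_elim auto
    then obtain k where "mse M g (elementary indicator (p k) (c k) (A k)) < e"
        "mse P X (elementary Z (p k) (c k) (A k)) < e"
      by (auto simp: eventually_sequentially)
    with A show ?thesis
      by (intro exI[of _ "p k"] exI[of _ "c k"] exI[of _ "A k"] conjI allI)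
  qed
  then show ?R
    using has_stochastic_integralD[OF L] by blast
next
  assume R: ?R
  then have "\<forall>k. \<exists>p c A. (\<forall>i. A i \<in> sets M) \<and> mse M g (elementary indicator p c A) < 1 / real (Suc k) \<and>
        mse P X (elementary Z p c A) < 1 / real (Suc k)"
    by simp
  then obtain p c A where A: "\<And>k i. A k i \<in> sets M"
    and l: "\<And>k. mse M g (elementary indicator (p k) (c k) (A k)) < 1 / real (Suc k)"
      "\<And>k. mse P X (elementary Z (p k) (c k) (A k)) < 1 / real (Suc k)"
    by metis
  have "(\<lambda>k. mse M g (elementary indicator (p k) (c k) (A k))) \<longlonglongrightarrow> 0"
    by (rule tendsto_sandwich[OF _ _ tendsto_const LIMSEQ_Suc[OF lim_1_over_n]])
       (use l(1) in \<open>auto simp: mse_nonneg less_imp_le simp del: of_nat_Suc\<close>)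
  moreover have "(\<lambda>k. mse P X (elementary Z (p k) (c k) (A k))) \<longlonglongrightarrow> 0"
    by (rule tendsto_sandwich[OF _ _ tendsto_const LIMSEQ_Suc[OF lim_1_over_n]])
       (use l(2) in \<open>auto simp: mse_nonneg less_imp_le simp del: of_nat_Suc\<close>)
  ultimately show ?L
    using R A unfolding has_stochastic_integral_def mse_def elementary_def by blast
qed

lemma elementary_add:
  "elementary W (p + q) (\<lambda>i. if i < p then c i else d (i - p)) (\<lambda>i. if i < p then A i else B (i - p)) =
   (\<lambda>x. elementary W p c A x + elementary W q d B x)"
proof
  fix x
  have s: "(\<Sum>i<p + q. f i) = (\<Sum>i<p. f i) + (\<Sum>i<q. f (p + i))" for f :: "nat \<Rightarrow> complex"
    by (induction q) (auto simp: add.assoc)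
  show "elementary W (p + q) (\<lambda>i. if i < p then c i else d (i - p)) (\<lambda>i. if i < p then A i else B (i - p)) x =
     elementary W p c A x + elementary W q d B x"
    unfolding elementary_def s by simp
qed

lemma elementary_scale: "elementary W p (\<lambda>i. a * c i) A = (\<lambda>x. a * elementary W p c A x)"
  by (auto simp: elementary_def sum_distrib_left mult.assoc)

locale orth_measure =
  fixes P :: "'a measure" and M :: "real measure" and Z :: "real set \<Rightarrow> 'a \<Rightarrow> complex"
  assumes fin: "finite_measure M" and osm: "orthogonal_stochastic_measure P M Z"
begin

abbreviation stint :: "(real \<Rightarrow> complex) \<Rightarrow> ('a \<Rightarrow> complex) \<Rightarrow> bool" where
  "stint \<equiv> has_stochastic_integral P M Z"

sublocale finite_measure M by (rule fin)

lemma Z_L2: "A \<in> sets M \<Longrightarrow> Z A \<in> L2 P"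
  using osm by (auto simp: orthogonal_stochastic_measure_def)

lemma indicator_L2: "A \<in> sets M \<Longrightarrow> (indicator A :: real \<Rightarrow> complex) \<in> L2 M"
  by (intro L2I integrable_const_bound[where B=1]) (auto simp: indicator_def)

lemma elementary_L2:
  assumes "\<And>i. A i \<in> sets M"
  shows "elementary indicator p c A \<in> L2 M" "elementary Z p c A \<in> L2 P"
  unfolding elementary_def[abs_def]
  by (intro L2_sum L2_scale indicator_L2 assms, intro L2_sum L2_scale Z_L2 assms)

text \<open>Both sides are determined by the covariances of the generators, and \<open>Z A\<close>, \<open>Z B\<close>
  have the covariance of the indicators of \<open>A\<close> and \<open>B\<close>.\<close>
lemma inner_elementary:
  assumes A: "\<And>i. A i \<in> sets M" and B: "\<And>i. B i \<in> sets M"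
  shows "(\<integral>\<omega>. elementary Z p c A \<omega> * cnj (elementary Z q d B \<omega>) \<partial>P) =
         (\<integral>x. elementary indicator p c A x * cnj (elementary indicator q d B x) \<partial>M)"
proof -
  have gen: "(\<integral>x. elementary W p c A x * cnj (elementary W q d B x) \<partial>R) =
      (\<Sum>i<p. \<Sum>j<q. c i * cnj (d j) * (\<integral>x. W (A i) x * cnj (W (B j) x) \<partial>R))"
    if "\<And>A. A \<in> sets M \<Longrightarrow> W A \<in> L2 R" for W and R :: "'c measure"
  proof -
    have "(\<integral>x. elementary W p c A x * cnj (elementary W q d B x) \<partial>R) =
        (\<integral>x. (\<Sum>i<p. \<Sum>j<q. c i * cnj (d j) * (W (A i) x * cnj (W (B j) x))) \<partial>R)"
      by (simp add: elementary_def sum_product mult_ac)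
    also have "\<dots> = (\<Sum>i<p. \<Sum>j<q. c i * cnj (d j) * (\<integral>x. W (A i) x * cnj (W (B j) x) \<partial>R))"
      using that A B by (simp add: Bochner_Integration.integral_sum L2_mult_cnj_integrable)
    finally show ?thesis .
  qed
  have "(\<integral>x. indicator (A i) x * cnj (indicator (B j) x) \<partial>M) = complex_of_real (measure M (A i \<inter> B j))" for i j
  proof -
    have "(\<integral>x. indicator (A i) x * cnj (indicator (B j) x) \<partial>M) = (\<integral>x. complex_of_real (indicator (A i \<inter> B j) x) \<partial>M)"
      by (intro Bochner_Integration.integral_cong) (auto simp: indicator_def)
    also have "\<dots> = complex_of_real (measure M (A i \<inter> B j))"
      using A B sets.Int[of "A i" M "B j"] sets.sets_into_space[of "A i" M] A[of i]
      by (simp add: Int_absorb2 Int_absorb1 le_infI1 inf.absorb1)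
    finally show ?thesis .
  qed
  moreover have "(\<integral>x. Z (A i) x * cnj (Z (B j) x) \<partial>P) = complex_of_real (measure M (A i \<inter> B j))" for i j
    using osm A B by (auto simp: orthogonal_stochastic_measure_def)
  ultimately show ?thesis
    using gen[OF Z_L2] gen[OF indicator_L2] by simp
qed

lemma stint_inner:
  assumes "stint g X" "stint h Y"
  shows "(\<integral>\<omega>. X \<omega> * cnj (Y \<omega>) \<partial>P) = (\<integral>x. g x * cnj (h x) \<partial>M)"
proof -
  obtain p c A where A: "\<And>k i. A k i \<in> sets M"
    and a: "(\<lambda>k. mse M g (elementary indicator (p k) (c k) (A k))) \<longlonglongrightarrow> 0"
      "(\<lambda>k. mse P X (elementary Z (p k) (c k) (A k))) \<longlonglongrightarrow> 0"
    using assms(1) unfolding has_stochastic_integral_def mse_def elementary_def by blast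
  obtain q d B where B: "\<And>k i. B k i \<in> sets M"
    and b: "(\<lambda>k. mse M h (elementary indicator (q k) (d k) (B k))) \<longlonglongrightarrow> 0"
      "(\<lambda>k. mse P Y (elementary Z (q k) (d k) (B k))) \<longlonglongrightarrow> 0"
    using assms(2) unfolding has_stochastic_integral_def mse_def elementary_def by blast
  note D = has_stochastic_integralD[OF assms(1)] has_stochastic_integralD[OF assms(2)]
  have "(\<lambda>k. \<integral>x. elementary indicator (p k) (c k) (A k) x * cnj (elementary indicator (q k) (d k) (B k) x) \<partial>M)
      \<longlonglongrightarrow> (\<integral>x. g x * cnj (h x) \<partial>M)"
    by (intro tendsto_inner_L2 D elementary_L2 A B a b)
  moreover have "(\<lambda>k. \<integral>x. elementary Z (p k) (c k) (A k) x * cnj (elementary Z (q k) (d k) (B k) x) \<partial>P)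
      \<longlonglongrightarrow> (\<integral>x. X x * cnj (Y x) \<partial>P)"
    by (intro tendsto_inner_L2 D elementary_L2 A B a b)
  ultimately show ?thesis
    unfolding inner_elementary[OF A B] using LIMSEQ_unique by blast
qed

lemma stint_norm:
  assumes "stint g X"
  shows "(\<integral>\<omega>. (cmod (X \<omega>))\<^sup>2 \<partial>P) = (\<integral>x. (cmod (g x))\<^sup>2 \<partial>M)"
proof -
  have *: "complex_of_real (\<integral>x. (cmod (w x))\<^sup>2 \<partial>R) = (\<integral>x. w x * cnj (w x) \<partial>R)" for w and R :: "'c measure"
    by (subst integral_complex_of_real[symmetric]) (simp add: complex_norm_square[symmetric])
  from stint_inner[OF assms assms] show ?thesis
    unfolding *[symmetric] by (simp only: of_real_eq_iff)
qed

text \<open>The stochastic integral is a closed relation, so integrals of series can be found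
  term by term.\<close>
lemma stint_limit:
  assumes "g \<in> L2 M" "X \<in> L2 P"
    and lim: "\<And>e. e > 0 \<Longrightarrow> \<exists>h Y. stint h Y \<and> mse M g h < e \<and> mse P X Y < e"
  shows "stint g X"
  unfolding has_stochastic_integral_iff
proof (intro conjI assms(1,2) allI impI)
  fix e :: real assume "e > 0"
  then have e4: "e / 4 > 0" by simp
  from lim[OF e4] obtain h Y where h: "stint h Y" "mse M g h < e / 4" "mse P X Y < e / 4"
    by auto
  then obtain p c A where A: "\<And>i. A i \<in> sets M"
    and l: "mse M h (elementary indicator p c A) < e / 4" "mse P Y (elementary Z p c A) < e / 4"
    using e4 unfolding has_stochastic_integral_iff by blast
  note D = has_stochastic_integralD[OF h(1)]
  have "mse M g (elementary indicator p c A) < e"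
    using mse_triangle[OF assms(1) D(1) elementary_L2(1)[of A p c, OF A]] h l by linarith
  moreover have "mse P X (elementary Z p c A) < e"
    using mse_triangle[OF assms(2) D(2) elementary_L2(2)[of A p c, OF A]] h l by linarith
  ultimately show "\<exists>p c A. (\<forall>i. A i \<in> sets M) \<and> mse M g (elementary indicator p c A) < e \<and> mse P X (elementary Z p c A) < e"
    using A by blast
qed

lemma stint_limit_seq:
  assumes "g \<in> L2 M" "X \<in> L2 P" "\<And>k. stint (h k) (Y k)"
    and "(\<lambda>k. mse M g (h k)) \<longlonglongrightarrow> 0" "(\<lambda>k. mse P X (Y k)) \<longlonglongrightarrow> 0"
  shows "stint g X"
proof (rule stint_limit[OF assms(1,2)])
  fix e :: real assume "e > 0"
  then have "\<forall>\<^sub>F k in sequentially. mse M g (h k) < e \<and> mse P X (Y k) < e"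
    using order_tendstoD(2)[OF assms(4)] order_tendstoD(2)[OF assms(5)] by (auto intro: eventually_conj)
  then show "\<exists>h Y. stint h Y \<and> mse M g h < e \<and> mse P X Y < e"
    using assms(3) by (auto simp: eventually_sequentially)
qed

lemma stint_add:
  assumes "stint g X" "stint h Y"
  shows "stint (\<lambda>x. g x + h x) (\<lambda>\<omega>. X \<omega> + Y \<omega>)"
  unfolding has_stochastic_integral_iff
proof (intro conjI L2_add allI impI)
  note D = has_stochastic_integralD[OF assms(1)] has_stochastic_integralD[OF assms(2)]
  fix e :: real assume "e > 0"
  then have e4: "e / 4 > 0" by simp
  obtain p c A where A: "\<And>i. A i \<in> sets M"
    and a: "mse M g (elementary indicator p c A) < e / 4" "mse P X (elementary Z p c A) < e / 4"
    using assms(1) e4 unfolding has_stochastic_integral_iff by blast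
  obtain q d B where B: "\<And>i. B i \<in> sets M"
    and b: "mse M h (elementary indicator q d B) < e / 4" "mse P Y (elementary Z q d B) < e / 4"
    using assms(2) e4 unfolding has_stochastic_integral_iff by blast
  let ?c = "\<lambda>i. if i < p then c i else d (i - p)" and ?A = "\<lambda>i. if i < p then A i else B (i - p)"
  have "mse M (\<lambda>x. g x + h x) (elementary indicator (p + q) ?c ?A) < e"
    unfolding elementary_add
    using mse_add[OF D(1,3) elementary_L2(1)[of A p c, OF A] elementary_L2(1)[of B q d, OF B]] a b by linarith
  moreover have "mse P (\<lambda>x. X x + Y x) (elementary Z (p + q) ?c ?A) < e"
    unfolding elementary_add
    using mse_add[OF D(2,4) elementary_L2(2)[of A p c, OF A] elementary_L2(2)[of B q d, OF B]] a b by linarith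
  ultimately show "\<exists>p c A. (\<forall>i. A i \<in> sets M) \<and> mse M (\<lambda>x. g x + h x) (elementary indicator p c A) < e \<and>
      mse P (\<lambda>x. X x + Y x) (elementary Z p c A) < e"
    using A B by (intro exI[of _ "p + q"] exI[of _ ?c] exI[of _ ?A]) auto
qed (use has_stochastic_integralD[OF assms(1)] has_stochastic_integralD[OF assms(2)] in auto)

lemma stint_zero: "stint (\<lambda>x. 0) (\<lambda>\<omega>. 0)"
  unfolding has_stochastic_integral_iff
  by (intro conjI L2_zero allI impI exI[of _ 0] exI[of _ "\<lambda>_. 0"] exI[of _ "\<lambda>_. {}"])
     (simp_all add: elementary_def[abs_def])

lemma stint_scale:
  assumes "stint g X"
  shows "stint (\<lambda>x. a * g x) (\<lambda>\<omega>. a * X \<omega>)"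
proof (cases "a = 0")
  case True
  then show ?thesis by (simp add: stint_zero)
next
  case False
  show ?thesis
    unfolding has_stochastic_integral_iff
  proof (intro conjI L2_scale has_stochastic_integralD[OF assms] allI impI)
    fix e :: real assume "e > 0"
    then have "e / (cmod a)\<^sup>2 > 0" using False by simp
    then obtain p c A where A: "\<And>i. A i \<in> sets M"
      and a: "mse M g (elementary indicator p c A) < e / (cmod a)\<^sup>2" "mse P X (elementary Z p c A) < e / (cmod a)\<^sup>2"
      using assms unfolding has_stochastic_integral_iff by blast
    have "(cmod a)\<^sup>2 > 0" using False by simp
    then have "mse M (\<lambda>x. a * g x) (elementary indicator p (\<lambda>i. a * c i) A) < e"
      "mse P (\<lambda>x. a * X x) (elementary Z p (\<lambda>i. a * c i) A) < e"
      using a unfolding elementary_scale mse_scale by (simp_all add: pos_less_divide_eq mult.commute)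
    then show "\<exists>p c A. (\<forall>i. A i \<in> sets M) \<and> mse M (\<lambda>x. a * g x) (elementary indicator p c A) < e \<and>
        mse P (\<lambda>x. a * X x) (elementary Z p c A) < e"
      using A by blast
  qed
qed

lemma stint_diff:
  assumes "stint g X" "stint h Y"
  shows "stint (\<lambda>x. g x - h x) (\<lambda>\<omega>. X \<omega> - Y \<omega>)"
  using stint_add[OF assms(1) stint_scale[OF assms(2), of "-1"]]
  unfolding mult_minus1 add_uminus_conv_diff .

lemma stint_sum:
  assumes "\<And>i. i \<in> A \<Longrightarrow> stint (g i) (X i)"
  shows "stint (\<lambda>x. \<Sum>i\<in>A. c i * g i x) (\<lambda>\<omega>. \<Sum>i\<in>A. c i * X i \<omega>)"
  using assms
proof (induction A rule: infinite_finite_induct)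
  case (insert i A)
  have 1: "stint (g i) (X i)" by (rule insert.prems[OF insertI1])
  have 2: "stint (\<lambda>x. \<Sum>i\<in>A. c i * g i x) (\<lambda>\<omega>. \<Sum>i\<in>A. c i * X i \<omega>)"
    by (rule insert.IH[OF insert.prems[OF insertI2]])
  have "stint (\<lambda>x. c i * g i x + (\<Sum>i\<in>A. c i * g i x)) (\<lambda>\<omega>. c i * X i \<omega> + (\<Sum>i\<in>A. c i * X i \<omega>))"
    by (rule stint_add[OF stint_scale[OF 1] 2])
  then show ?case by (simp only: sum.insert[OF insert.hyps])
next
  case (infinite A) then show ?case by (simp add: stint_zero)
next
  case empty show ?case by (simp add: stint_zero)
qed

lemma stint_mse:
  assumes "stint g X" "stint h Y"
  shows "mse P X Y = mse M g h"
  unfolding mse_def by (rule stint_norm[OF stint_diff[OF assms]])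

lemma stint_cong_AE:
  assumes "stint g X" "h \<in> borel_measurable M" "AE x in M. g x = h x"
  shows "stint h X"
proof -
  have g: "g \<in> L2 M" "X \<in> L2 P" using has_stochastic_integralD[OF assms(1)] .
  have h: "h \<in> L2 M" by (rule L2_cong_AE[OF g(1) assms(2,3)])
  have "mse M h g = 0"
    using mse_AE_cong[OF L2D(1)[OF g(1)] L2D(1)[OF g(1)] L2D(1)[OF h] assms(3)] by (simp add: mse_commute)
  show ?thesis
  proof (rule stint_limit[OF h g(2)])
    fix e :: real assume "e > 0"
    with assms(1) \<open>mse M h g = 0\<close> have "stint g X \<and> mse M h g < e \<and> mse P X X < e" by simp
    then show "\<exists>h' Y. stint h' Y \<and> mse M h h' < e \<and> mse P X Y < e" by blast
  qed
qed

end

section \<open>Absolutely convergent power series\<close>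

lemma summable_norm_pseries_term:
  assumes "summable (\<lambda>k. cmod (c k))" "cmod z \<le> 1"
  shows "summable (\<lambda>k. cmod (c k * z ^ k))"
proof (rule summable_comparison_test'[OF assms(1)])
  show "norm (cmod (c k * z ^ k)) \<le> cmod (c k)" for k
    using assms(2) by (simp add: norm_mult norm_power mult_left_le power_le_one)
qed

lemma pseries_sums:
  assumes "summable (\<lambda>k. cmod (c k))" "cmod z \<le> 1"
  shows "(\<lambda>k. c k * z ^ k) sums pseries c z"
  unfolding pseries_def
  by (rule summable_sums[OF summable_norm_cancel[OF summable_norm_pseries_term[OF assms]]])

lemma pseries_uniform_limit:
  assumes "summable (\<lambda>k. cmod (c k))"
  shows "uniform_limit (cball 0 1) (\<lambda>K z. \<Sum>k<K. c k * z ^ k) (pseries c) sequentially"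
  unfolding pseries_def
  by (rule Weierstrass_m_test[OF _ assms])
     (simp add: norm_mult norm_power mult_left_le power_le_one)

lemma continuous_on_pseries:
  assumes "summable (\<lambda>k. cmod (c k))"
  shows "continuous_on (cball 0 1) (pseries c)"
  by (rule uniform_limit_theorem[OF _ pseries_uniform_limit[OF assms]])
     (auto intro!: always_eventually continuous_intros)

lemma pseries_cnj:
  assumes "summable (\<lambda>k. cmod (a k))" "cmod z \<le> 1"
  shows "pseries (\<lambda>k. cnj (a k)) z = cnj (pseries a (cnj z))"
proof -
  have "(\<lambda>k. a k * cnj z ^ k) sums pseries a (cnj z)"
    by (rule pseries_sums) (use assms in simp_all)
  then have "(\<lambda>k. cnj (a k * cnj z ^ k)) sums cnj (pseries a (cnj z))"
    by (simp only: sums_cnj)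
  then have "(\<lambda>k. cnj (a k) * z ^ k) sums cnj (pseries a (cnj z))"
    by simp
  from sums_unique[OF this] show ?thesis
    unfolding pseries_def[of "\<lambda>k. cnj (a k)"] by (rule sym)
qed

lemma conv_radius_ge_1:
  assumes "summable (\<lambda>k. cmod (c k))"
  shows "conv_radius c \<ge> 1"
proof -
  have "summable (\<lambda>k. c k * 1 ^ k)"
    using summable_norm_cancel[OF assms] by simp
  from conv_radius_geI[OF this] show ?thesis by (simp add: one_ereal_def)
qed

lemma pseries_eq_eval_fps: "pseries c z = eval_fps (Abs_fps c) z"
  by (simp add: pseries_def eval_fps_def)

lemma has_fps_expansion_pseries:
  assumes "summable (\<lambda>k. cmod (c k))"
  shows "pseries c has_fps_expansion Abs_fps c"
proof -
  have "fps_conv_radius (Abs_fps c) \<ge> 1"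
    using conv_radius_ge_1[OF assms] by (simp add: fps_conv_radius_def)
  then have "fps_conv_radius (Abs_fps c) > 0"
    by (rule less_le_trans[rotated]) simp
  then show ?thesis
    unfolding has_fps_expansion_def by (simp add: pseries_eq_eval_fps)
qed

lemma holomorphic_pseries:
  assumes "ereal r \<le> conv_radius c"
  shows "pseries c holomorphic_on ball 0 r"
proof -
  have "eval_fps (Abs_fps c) holomorphic_on ball 0 r"
  proof (intro holomorphic_on_eval_fps subsetI)
    fix z :: complex assume "z \<in> ball 0 r"
    then have "ereal (cmod z) < ereal r" by simp
    from less_le_trans[OF this assms] show "z \<in> eball 0 (fps_conv_radius (Abs_fps c))"
      by (simp add: fps_conv_radius_def)
  qed
  then show ?thesis
    by (rule holomorphic_transform) (simp add: pseries_eq_eval_fps)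
qed

text \<open>The Wiener algebra of the disc: \<open>f\<close> is given on the closed disc, boundary included,
  by a power series with absolutely summable coefficients.\<close>
definition has_abs_pseries :: "(nat \<Rightarrow> complex) \<Rightarrow> (complex \<Rightarrow> complex) \<Rightarrow> bool" where
  "has_abs_pseries c f \<longleftrightarrow> summable (\<lambda>k. cmod (c k)) \<and> (\<forall>z. cmod z \<le> 1 \<longrightarrow> f z = pseries c z)"

lemma has_abs_pseries_mult:
  assumes "has_abs_pseries c f" "has_abs_pseries d g"
  shows "has_abs_pseries (\<lambda>n. \<Sum>i\<le>n. c i * d (n - i)) (\<lambda>z. f z * g z)"
proof -
  have c: "summable (\<lambda>k. cmod (c k))" and d: "summable (\<lambda>k. cmod (d k))"
    using assms by (auto simp: has_abs_pseries_def)
  have "summable (\<lambda>n. \<Sum>i\<le>n. cmod (c i) * cmod (d (n - i)))"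
    using summable_Cauchy_product[of "\<lambda>k. cmod (c k)" "\<lambda>k. cmod (d k)"] c d by simp
  then have s: "summable (\<lambda>n. cmod (\<Sum>i\<le>n. c i * d (n - i)))"
    by (rule summable_comparison_test'[where N=0])
       (auto intro!: order_trans[OF norm_sum] simp: norm_mult)
  moreover have "f z * g z = pseries (\<lambda>n. \<Sum>i\<le>n. c i * d (n - i)) z" if z: "cmod z \<le> 1" for z
  proof -
    have "(\<Sum>k. c k * z ^ k) * (\<Sum>k. d k * z ^ k) = (\<Sum>k. \<Sum>i\<le>k. (c i * z ^ i) * (d (k - i) * z ^ (k - i)))"
      by (rule Cauchy_product) (intro summable_norm_pseries_term c d z)+
    also have "\<dots> = (\<Sum>k. (\<Sum>i\<le>k. c i * d (k - i)) * z ^ k)"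
    proof (intro suminf_cong)
      fix k
      have "(c i * z ^ i) * (d (k - i) * z ^ (k - i)) = c i * d (k - i) * z ^ k" if "i \<le> k" for i
      proof -
        have "z ^ k = z ^ i * z ^ (k - i)" using that by (simp flip: power_add)
        then show ?thesis by simp
      qed
      then show "(\<Sum>i\<le>k. (c i * z ^ i) * (d (k - i) * z ^ (k - i))) = (\<Sum>i\<le>k. c i * d (k - i)) * z ^ k"
        unfolding sum_distrib_right by (intro sum.cong refl) (simp only: atMost_iff)
    qed
    finally show ?thesis
      using assms z by (simp add: has_abs_pseries_def pseries_def)
  qed
  ultimately show ?thesis by (simp add: has_abs_pseries_def)
qed

lemma has_abs_pseries_finite:
  "has_abs_pseries (\<lambda>k. if k < n then c k else 0) (\<lambda>z. \<Sum>k<n. c k * z ^ k)"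
proof -
  have "(\<lambda>k. (if k < n then c k else 0) * z ^ k) sums (\<Sum>k<n. (if k < n then c k else 0) * z ^ k)" for z
    by (rule sums_finite) auto
  then have "pseries (\<lambda>k. if k < n then c k else 0) z = (\<Sum>k<n. c k * z ^ k)" for z
    by (simp add: pseries_def sums_iff)
  moreover have "summable (\<lambda>k. cmod (if k < n then c k else 0))"
    by (rule summable_finite[of "{..<n}"]) auto
  ultimately show ?thesis by (simp add: has_abs_pseries_def)
qed

lemma has_abs_pseries_power:
  assumes "has_abs_pseries c f"
  shows "\<exists>d. has_abs_pseries d (\<lambda>z. f z ^ n)"
proof (induction n)
  case 0
  have "has_abs_pseries (\<lambda>k. if k < 1 then 1 else 0) (\<lambda>z. \<Sum>k<1. 1 * z ^ k)"
    by (rule has_abs_pseries_finite)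
  then show ?case by auto
next
  case (Suc n)
  then show ?case using has_abs_pseries_mult[OF assms] by auto
qed

text \<open>The coefficients are determined by the function on the open disc, where \<open>phi_mu\<close>
  reads them off.\<close>
lemma has_abs_pseries_fps_expansion:
  assumes "has_abs_pseries c f" "\<And>z. cmod z < 1 \<Longrightarrow> g z = f z"
  shows "fps_expansion g 0 = Abs_fps c"
proof -
  have "eventually (\<lambda>z. cmod z < 1) (nhds (0::complex))"
    using eventually_nhds_in_open[of "ball 0 1" "0::complex"] by (simp add: dist_norm)
  then have "eventually (\<lambda>z. g z = pseries c z) (nhds 0)"
    by eventually_elim (use assms in \<open>simp add: has_abs_pseries_def\<close>)
  then have "fps_expansion g 0 = fps_expansion (pseries c) 0"
    by (rule fps_expansion_cong)
  also have "\<dots> = Abs_fps c"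
    by (rule fps_expansion_eqI[OF has_fps_expansion_pseries]) (use assms(1) in \<open>simp add: has_abs_pseries_def\<close>)
  finally show ?thesis .
qed

text \<open>The recursion is the differential equation \<open>E' = a' E\<close> of the exponential, read off
  coefficientwise.\<close>
lemma fps_expansion_exp_pseries:
  assumes a: "summable (\<lambda>k. cmod (a k))"
  defines "E \<equiv> fps_expansion (\<lambda>z. exp (pseries a z)) 0"
  shows "fps_nth E 0 = exp (a 0)"
    and "of_nat (Suc k) * fps_nth E (Suc k) = (\<Sum>i\<le>k. of_nat (Suc i) * a (Suc i) * fps_nth E (k - i))"
    and "cmod z < 1 \<Longrightarrow> (\<lambda>k. fps_nth E k * z ^ k) sums exp (pseries a z)"
proof -
  have hol: "pseries a holomorphic_on ball 0 1"
    using conv_radius_ge_1[OF a] by (intro holomorphic_pseries) (simp add: one_ereal_def)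
  then have hole: "(\<lambda>z. exp (pseries a z)) holomorphic_on eball 0 1"
    by (auto intro!: holomorphic_intros simp: one_ereal_def)
  have E: "(\<lambda>z. exp (pseries a z)) has_fps_expansion E"
    unfolding E_def by (rule has_fps_expansion_fps_expansion[of "ball 0 1"])
      (use hole in \<open>auto simp: one_ereal_def\<close>)
  show sums: "(\<lambda>k. fps_nth E k * z ^ k) sums exp (pseries a z)" if "cmod z < 1" for z
  proof -
    have r: "fps_conv_radius E \<ge> 1"
      unfolding E_def by (rule conv_radius_fps_expansion[OF hole])
    have z: "ereal (cmod z) < 1" using that by (simp add: one_ereal_def)
    have "(\<lambda>k. fps_nth E k * z ^ k) sums eval_fps E z"
      by (rule sums_eval_fps[OF less_le_trans[OF z r]])
    also have "eval_fps E z = exp (pseries a z)"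
      unfolding E_def using eval_fps_expansion'[OF hole z] by simp
    finally show ?thesis .
  qed
  have p0: "pseries a 0 = a 0"
    by (simp add: pseries_eq_eval_fps eval_fps_at_0)
  show "fps_nth E 0 = exp (a 0)"
    using fps_nth_fps_expansion[OF E, of 0] p0 by simp
  have 1: "deriv (\<lambda>z. exp (pseries a z)) has_fps_expansion fps_deriv E"
    by (rule has_fps_expansion_deriv[OF E])
  have 2: "(\<lambda>z. deriv (pseries a) z * exp (pseries a z)) has_fps_expansion (fps_deriv (Abs_fps a) * E)"
    by (intro has_fps_expansion_mult has_fps_expansion_deriv has_fps_expansion_pseries a E)
  have 3: "eventually (\<lambda>z. deriv (\<lambda>z. exp (pseries a z)) z = deriv (pseries a) z * exp (pseries a z)) (nhds 0)"
  proof -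
    have "eventually (\<lambda>z. z \<in> ball 0 1) (nhds (0::complex))"
      by (intro eventually_nhds_in_open) auto
    then show ?thesis
    proof eventually_elim
      case (elim z)
      have "(pseries a has_field_derivative deriv (pseries a) z) (at z)"
        by (rule holomorphic_derivI[OF hol open_ball elim])
      then have "((\<lambda>z. exp (pseries a z)) has_field_derivative exp (pseries a z) * deriv (pseries a) z) (at z)"
        by (rule DERIV_chain2[OF DERIV_exp])
      then show ?case by (simp add: DERIV_imp_deriv mult.commute)
    qed
  qed
  have "fps_deriv E = fps_deriv (Abs_fps a) * E"
    by (rule fps_expansion_unique_complex[OF 1 iffD2[OF has_fps_expansion_cong[OF 3 refl] 2]])
  then have "fps_nth (fps_deriv E) k = fps_nth (fps_deriv (Abs_fps a) * E) k"
    by simp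
  then show "of_nat (Suc k) * fps_nth E (Suc k) = (\<Sum>i\<le>k. of_nat (Suc i) * a (Suc i) * fps_nth E (k - i))"
    by (simp only: fps_mult_nth fps_deriv_nth fps_nth_Abs_fps Suc_eq_plus1 atLeast0AtMost)
qed

text \<open>The exponential does not leave the algebra: its coefficients are majorized by those
  for the series with coefficients \<open>cmod (a k)\<close>, which are nonnegative and have bounded
  sums.\<close>
lemma has_abs_pseries_exp:
  assumes "has_abs_pseries a g"
  shows "\<exists>e. has_abs_pseries e (\<lambda>z. exp (g z))"
proof -
  have a: "summable (\<lambda>k. cmod (a k))" and g: "\<And>z. cmod z \<le> 1 \<Longrightarrow> g z = pseries a z"
    using assms by (auto simp: has_abs_pseries_def)
  define A where "A = (\<lambda>k. complex_of_real (cmod (a k)))"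
  have A: "summable (\<lambda>k. cmod (A k))" using a by (simp add: A_def)
  define E where "E = fps_nth (fps_expansion (\<lambda>z. exp (pseries a z)) 0)"
  define F where "F = fps_nth (fps_expansion (\<lambda>z. exp (pseries A z)) 0)"
  note Er = fps_expansion_exp_pseries[OF a, folded E_def]
  note Fr = fps_expansion_exp_pseries[OF A, folded F_def]
  \<comment> \<open>The recursion for the coefficients of an exponential has only positive signs, so \<open>E\<close>
    is majorized by \<open>F\<close>.\<close>
  have maj: "F k = of_real (cmod (F k)) \<and> cmod (E k) \<le> cmod (F k)" for k
  proof (induction k rule: less_induct)
    case (less k)
    show ?case
    proof (cases k)
      case 0
      have "F 0 = of_real (exp (cmod (a 0)))" by (simp add: Fr(1) A_def exp_of_real)
      moreover have "cmod (E 0) \<le> exp (cmod (a 0))"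
        by (simp add: Er(1) complex_Re_le_cmod)
      ultimately show ?thesis using 0 by simp
    next
      case (Suc j)
      have ih: "F (j - i) = of_real (cmod (F (j - i)))" "cmod (E (j - i)) \<le> cmod (F (j - i))" for i
        using less[of "j - i"] Suc by auto
      define s where "s = (\<Sum>i\<le>j. real (Suc i) * cmod (a (Suc i)) * cmod (F (j - i)))"
      have s0: "s \<ge> 0" unfolding s_def by (intro sum_nonneg) auto
      have "of_nat (Suc j) * F (Suc j) = (\<Sum>i\<le>j. of_nat (Suc i) * A (Suc i) * of_real (cmod (F (j - i))))"
        unfolding Fr(2) using ih(1) by (intro sum.cong) auto
      also have "\<dots> = of_real s"
        by (simp add: s_def A_def)
      finally have F: "F (Suc j) = of_real (s / real (Suc j))"
        by (simp add: field_simps del: of_nat_Suc)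
      have "real (Suc j) * cmod (E (Suc j)) = cmod (of_nat (Suc j) * E (Suc j))"
        by (simp only: norm_mult norm_of_nat)
      also have "\<dots> \<le> (\<Sum>i\<le>j. cmod (of_nat (Suc i) * a (Suc i) * E (j - i)))"
        unfolding Er(2) by (rule norm_sum)
      also have "\<dots> \<le> s"
        unfolding s_def by (intro sum_mono) (simp only: norm_mult norm_of_nat, intro mult_left_mono ih(2), simp)
      finally have "cmod (E (Suc j)) \<le> s / real (Suc j)"
        by (simp add: field_simps del: of_nat_Suc)
      then show ?thesis
        using s0 by (simp only: Suc F norm_of_real) (simp del: of_nat_Suc)
    qed
  qed
  define C where "C = (\<Sum>k. cmod (a k))"
  \<comment> \<open>The coefficients of \<open>F\<close> are nonnegative, so a partial sum at \<open>r < 1\<close> is at most the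
    value there, which stays below \<open>exp C\<close> as \<open>r\<close> tends to \<open>1\<close>.\<close>
  have part_r: "(\<Sum>k<K. cmod (F k) * r ^ k) \<le> exp C" if r: "0 \<le> r" "r < 1" for K r
  proof -
    have "(\<lambda>k. F k * of_real r ^ k) sums exp (pseries A (of_real r))"
      by (rule Fr(3)) (use r in simp)
    then have "(\<lambda>k. Re (F k * of_real r ^ k)) sums Re (exp (pseries A (of_real r)))"
      by (rule sums_Re)
    moreover have "(\<lambda>k. Re (F k * of_real r ^ k)) = (\<lambda>k. cmod (F k) * r ^ k)"
      by (subst conjunct1[OF maj]) (simp flip: of_real_power of_real_mult)
    ultimately have s: "(\<lambda>k. cmod (F k) * r ^ k) sums Re (exp (pseries A (of_real r)))"
      by (simp only:)
    then have "(\<Sum>k<K. cmod (F k) * r ^ k) \<le> Re (exp (pseries A (of_real r)))"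
      using r by (intro sum_le_suminf[of "\<lambda>k. cmod (F k) * r ^ k", unfolded sums_unique[OF s, symmetric]])
        (auto simp: sums_iff)
    also have "\<dots> \<le> exp (Re (pseries A (of_real r)))"
      using complex_Re_le_cmod[of "exp (pseries A (of_real r))"] by simp
    also have "Re (pseries A (of_real r)) \<le> C"
    proof -
      have r1: "cmod (of_real r) \<le> 1" using r by simp
      have "Re (pseries A (of_real r)) \<le> cmod (pseries A (of_real r))" by (rule complex_Re_le_cmod)
      also have "\<dots> \<le> (\<Sum>k. cmod (A k * of_real r ^ k))"
        unfolding pseries_def by (rule summable_norm[OF summable_norm_pseries_term[OF A r1]])
      also have "\<dots> \<le> C" unfolding C_def
        by (rule suminf_le[OF _ summable_norm_pseries_term[OF A r1] a])
           (use r in \<open>simp add: norm_mult A_def norm_power mult_left_le power_le_one\<close>)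
      finally show ?thesis .
    qed
    finally show ?thesis by simp
  qed
  have part: "(\<Sum>k<K. cmod (F k)) \<le> exp C" for K
  proof (rule tendsto_upperbound)
    have "((\<lambda>r. \<Sum>k<K. cmod (F k) * r ^ k) \<longlongrightarrow> (\<Sum>k<K. cmod (F k) * 1 ^ k)) (at_left (1::real))"
      by (intro tendsto_intros)
    then show "((\<lambda>r. \<Sum>k<K. cmod (F k) * r ^ k) \<longlongrightarrow> (\<Sum>k<K. cmod (F k))) (at_left (1::real))"
      by simp
    show "eventually (\<lambda>r. (\<Sum>k<K. cmod (F k) * r ^ k) \<le> exp C) (at_left (1::real))"
      using eventually_at_left_real[of 0 "1::real"] by (auto elim!: eventually_mono intro!: part_r)
  qed simp
  have "summable (\<lambda>k. cmod (F k))"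
    by (rule bounded_imp_summable[of _ "exp C"]) (use part[of "Suc _"] in \<open>auto simp: lessThan_Suc_atMost\<close>)
  then have E: "summable (\<lambda>k. cmod (E k))"
    by (rule summable_comparison_test'[where N=0]) (use maj in auto)
  \<comment> \<open>Both sides are continuous on the closed disc and agree on the open one.\<close>
  have eq: "exp (pseries a z) - pseries E z = 0" if z: "z \<in> cball 0 1" for z
  proof (rule continuous_constant_on_closure[where S = "ball 0 1" and f = "\<lambda>z. exp (pseries a z) - pseries E z"])
    show "continuous_on (closure (ball 0 1)) (\<lambda>z. exp (pseries a z) - pseries E z)"
      using continuous_on_pseries[OF a] continuous_on_pseries[OF E] by (auto intro!: continuous_intros)
    show "exp (pseries a x) - pseries E x = 0" if "x \<in> ball 0 1" for x
      using Er(3)[of x] that by (simp add: pseries_def sums_iff)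
  qed (use z in simp)
  then have "has_abs_pseries E (\<lambda>z. exp (g z))"
    using E g by (simp add: has_abs_pseries_def)
  then show ?thesis by (rule exI[of _ E])
qed

lemma abs_coeffs_conv_radius_gt_1:
  assumes "conv_radius c > 1"
  shows "summable (\<lambda>k. cmod (c k))"
  using abs_summable_in_conv_radius[of 1 c] assms by (simp add: one_ereal_def)

text \<open>A function without zeros on the compact disc has none in a slightly larger one, so
  its inverse has radius of convergence above \<open>1\<close>.\<close>
lemma has_abs_pseries_inverse:
  assumes r: "conv_radius c > 1" and nz: "\<And>z. cmod z \<le> 1 \<Longrightarrow> pseries c z \<noteq> 0"
  shows "\<exists>d. has_abs_pseries d (\<lambda>z. inverse (pseries c z))"
proof -
  obtain R where R: "1 < R" "ereal R < conv_radius c"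
    using ereal_dense2[OF r] by (auto simp: one_ereal_def)
  have hol: "pseries c holomorphic_on ball 0 R"
    using R by (intro holomorphic_pseries) simp
  have "open (ball 0 R \<inter> pseries c -` (- {0}))"
    by (intro continuous_open_preimage holomorphic_on_imp_continuous_on[OF hol]) auto
  also have "ball 0 R \<inter> pseries c -` (- {0}) = {z \<in> ball 0 R. pseries c z \<in> - {0}}"
    by blast
  finally have "open {z \<in> ball 0 R. pseries c z \<in> - {0}}" .
  moreover have "cball 0 1 \<subseteq> {z \<in> ball 0 R. pseries c z \<in> - {0}}"
    using R nz by auto
  ultimately obtain e where e: "e > 0" "(\<Union>x\<in>cball 0 1. ball x e) \<subseteq> {z \<in> ball 0 R. pseries c z \<in> - {0}}"
    by (rule compact_subset_open_imp_ball_epsilon_subset[OF compact_cball])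
  have sub: "ball 0 (1 + e) \<subseteq> {z \<in> ball 0 R. pseries c z \<in> - {0}}"
  proof
    fix z :: complex assume z: "z \<in> ball 0 (1 + e)"
    have "z \<in> (\<Union>x\<in>cball 0 1. ball x e)"
    proof (cases "cmod z \<le> 1")
      case True
      then show ?thesis using e(1) by (auto intro!: bexI[of _ z])
    next
      case False
      have "dist (z / of_real (cmod z)) z = cmod z - 1"
      proof -
        have "z / of_real (cmod z) - z = (z / of_real (cmod z)) * of_real (1 - cmod z)"
          using False by (cases "z = 0") (simp_all add: right_diff_distrib)
        then have "dist (z / of_real (cmod z)) z = cmod (z / of_real (cmod z)) * \<bar>1 - cmod z\<bar>"
          by (simp only: dist_norm norm_mult norm_of_real)
        also have "cmod (z / of_real (cmod z)) = 1" using False by (auto simp: norm_divide)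
        finally show ?thesis using False by simp
      qed
      then show ?thesis using False z
        by (intro UN_I[of "z / of_real (cmod z)"]) (auto simp: norm_divide)
    qed
    then show "z \<in> {z \<in> ball 0 R. pseries c z \<in> - {0}}" using e(2) by blast
  qed
  define d where "d = fps_nth (fps_expansion (\<lambda>z. inverse (pseries c z)) 0)"
  have holi: "(\<lambda>z. inverse (pseries c z)) holomorphic_on eball 0 (ereal (1 + e))"
    unfolding eball_ereal
  proof (rule holomorphic_on_inverse)
    show "pseries c holomorphic_on ball 0 (1 + e)"
      by (rule holomorphic_on_subset[OF hol]) (use sub in blast)
    show "pseries c z \<noteq> 0" if "z \<in> ball 0 (1 + e)" for z
      using subsetD[OF sub that] by simp
  qed
  have "conv_radius d \<ge> ereal (1 + e)"
    unfolding d_def using conv_radius_fps_expansion[OF holi] by (simp add: fps_conv_radius_def)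
  then have "conv_radius d > 1"
    by (rule less_le_trans[rotated]) (use e(1) in \<open>simp add: one_ereal_def\<close>)
  then have "summable (\<lambda>k. cmod (d k))" by (rule abs_coeffs_conv_radius_gt_1)
  moreover have "inverse (pseries c z) = pseries d z" if "cmod z \<le> 1" for z
  proof -
    have "ereal (cmod z) < ereal (1 + e)" using that e(1) by simp
    from eval_fps_expansion'[OF holi this] show ?thesis
      by (simp add: d_def pseries_def eval_fps_def)
  qed
  ultimately show ?thesis by (intro exI[of _ d]) (simp add: has_abs_pseries_def)
qed

lemma has_abs_pseries_exp_uminus:
  assumes "has_abs_pseries a g"
  shows "\<exists>e. has_abs_pseries e (\<lambda>z. exp (- g z))"
proof -
  have "has_abs_pseries (\<lambda>k. - a k) (\<lambda>z. - g z)"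
    unfolding has_abs_pseries_def
  proof (intro conjI allI impI)
    have a: "summable (\<lambda>k. cmod (a k))" using assms by (simp add: has_abs_pseries_def)
    then show "summable (\<lambda>k. cmod (- a k))" by simp
    fix z :: complex assume z: "cmod z \<le> 1"
    have "- g z = - pseries a z" using assms z by (simp add: has_abs_pseries_def)
    also have "\<dots> = pseries (\<lambda>k. - a k) z"
      using sums_unique[OF sums_minus[OF pseries_sums[OF a z]]] by (simp add: pseries_def)
    finally show "- g z = pseries (\<lambda>k. - a k) z" .
  qed
  then show ?thesis by (rule has_abs_pseries_exp)
qed

lemma geometric_inverse_has_abs_pseries:
  assumes s: "0 \<le> s" "s < 1" and \<mu>: "\<mu> > 0"
  shows "\<exists>c. has_abs_pseries c (\<lambda>z. inverse (1 - of_real s * z ^ \<mu>))"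
proof -
  define d :: "nat \<Rightarrow> complex" where "d = (\<lambda>k. if k < Suc \<mu> then (if k = 0 then 1 else if k = \<mu> then - of_real s else 0) else 0)"
  have "has_abs_pseries d (\<lambda>z. \<Sum>k<Suc \<mu>. (if k = 0 then 1 else if k = \<mu> then - of_real s else 0) * z ^ k)"
    unfolding d_def by (rule has_abs_pseries_finite)
  moreover have "(\<Sum>k<Suc \<mu>. (if k = 0 then 1 else if k = \<mu> then - of_real s else 0) * z ^ k) = 1 - of_real s * z ^ \<mu>" for z :: complex
  proof -
    have "(\<Sum>k<Suc \<mu>. (if k = 0 then 1 else if k = \<mu> then - of_real s else 0) * z ^ k) =
        (\<Sum>k\<in>{0, \<mu>}. (if k = 0 then 1 else if k = \<mu> then - of_real s else 0) * z ^ k)"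
      by (rule sum.mono_neutral_right) auto
    then show ?thesis using \<mu> by simp
  qed
  ultimately have d: "pseries d z = 1 - of_real s * z ^ \<mu>" if "cmod z \<le> 1" for z
    using that by (simp only: has_abs_pseries_def)
  have "summable (\<lambda>k. d k * 2 ^ k)"
    by (rule summable_finite[of "{..\<mu>}"]) (auto simp: d_def)
  then have "conv_radius d \<ge> norm (2 :: complex)"
    by (rule conv_radius_geI)
  then have r: "conv_radius d > 1"
    by (rule less_le_trans[rotated]) (simp add: one_ereal_def)
  have "pseries d z \<noteq> 0" if "cmod z \<le> 1" for z
  proof
    assume "pseries d z = 0"
    then have "cmod (of_real s * z ^ \<mu>) = 1" using d[OF that] by (metis norm_one right_minus_eq)
    moreover have "cmod (of_real s * z ^ \<mu>) \<le> s * 1"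
      unfolding norm_mult norm_power norm_of_real using s that by (intro mult_mono power_le_one) auto
    ultimately show False using s by simp
  qed
  from has_abs_pseries_inverse[OF r this] obtain c where "has_abs_pseries c (\<lambda>z. inverse (pseries d z))" by blast
  then have "has_abs_pseries c (\<lambda>z. inverse (1 - of_real s * z ^ \<mu>))"
    using d by (simp add: has_abs_pseries_def)
  then show ?thesis by (rule exI[of _ c])
qed

section \<open>Fourier coefficients and Schwarz integrals\<close>

text \<open>The half-open interval is the space of the spectral measure.\<close>
definition circle :: "real measure" where
  "circle = restrict_space lborel {-pi..<pi}"

lemma space_circle [simp]: "space circle = {-pi..<pi}"
  by (simp add: circle_def)

lemma sets_circle: "sets circle = sets (restrict_space borel {-pi..<pi})"
  unfolding circle_def by (rule sets_restrict_space_cong) simp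

lemma emeasure_circle: "A \<subseteq> {-pi..<pi} \<Longrightarrow> emeasure circle A = emeasure lborel A"
  by (simp add: circle_def emeasure_restrict_space)

lemma emeasure_space_circle: "emeasure circle {-pi..<pi} = ennreal (2 * pi)"
  by (simp add: emeasure_circle)

lemma finite_measure_circle: "finite_measure circle"
  by (rule finite_measureI) (simp add: emeasure_space_circle)

interpretation circle: finite_measure circle by (rule finite_measure_circle)

lemma measure_circle: "measure circle {-pi..<pi} = 2 * pi"
  by (simp add: measure_def emeasure_space_circle)

lemma measurable_circle: "f \<in> borel_measurable borel \<Longrightarrow> f \<in> borel_measurable circle"
  unfolding circle_def by (rule measurable_restrict_space1) simp

lemma integral_circle:
  fixes f :: "real \<Rightarrow> 'b::{banach, second_countable_topology}"
  shows "integral\<^sup>L circle f = (LINT l:{-pi..pi}|lborel. f l)"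
proof -
  have "integral\<^sup>L circle f = integral\<^sup>L lborel (\<lambda>l. indicator {-pi..<pi} l *\<^sub>R f l)"
    by (simp add: circle_def integral_restrict_space)
  also have "\<dots> = integral\<^sup>L lborel (\<lambda>l. indicator {-pi..pi} l *\<^sub>R f l)"
    by (rule integral_discrete_difference[of "{pi}"]) (auto simp: indicator_def)
  finally show ?thesis by (simp add: set_lebesgue_integral_def)
qed

lemma integrable_circle:
  fixes f :: "real \<Rightarrow> 'b::{banach, second_countable_topology}"
  shows "integrable circle f \<longleftrightarrow> set_integrable lborel {-pi..pi} f"
proof -
  have "integrable circle f \<longleftrightarrow> integrable lborel (\<lambda>l. indicator {-pi..<pi} l *\<^sub>R f l)"
    by (simp add: circle_def integrable_restrict_space)
  also have "\<dots> \<longleftrightarrow> integrable lborel (\<lambda>l. indicator {-pi..pi} l *\<^sub>R f l)"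
    by (rule integrable_discrete_difference[of "{pi}"]) (auto simp: indicator_def)
  finally show ?thesis by (simp add: set_integrable_def)
qed

lemma integrable_circle_bounded:
  fixes f :: "real \<Rightarrow> 'b::{banach, second_countable_topology}"
  assumes "f \<in> borel_measurable circle" "\<And>l. l \<in> {-pi..<pi} \<Longrightarrow> norm (f l) \<le> B"
  shows "integrable circle f"
  by (rule circle.integrable_const_bound[where B=B]) (use assms in auto)

lemma integral_circle_FTC:
  fixes f :: "real \<Rightarrow> 'b::euclidean_space"
  assumes "\<And>x. -pi \<le> x \<Longrightarrow> x \<le> pi \<Longrightarrow> (F has_vector_derivative f x) (at x within {-pi..pi})"
    "continuous_on {-pi..pi} f"
  shows "integral\<^sup>L circle f = F pi - F (-pi)"
  using integral_FTC_Icc[OF _ assms] by (simp add: integral_circle set_lebesgue_integral_def)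

lemma AE_circle_countable:
  assumes "countable X"
  shows "AE l in circle. l \<notin> X"
proof -
  have "AE l in lborel. l \<notin> X"
    by (intro AE_not_in countable_imp_null_set_lborel assms)
  then have "AE l in lborel. l \<in> {-pi..<pi} \<longrightarrow> l \<notin> X"
    by eventually_elim simp
  then show ?thesis
    unfolding circle_def by (subst AE_restrict_space_iff) simp_all
qed

lemma cis_borel_measurable [measurable]: "cis \<in> borel_measurable borel"
  by (intro borel_measurable_continuous_onI continuous_intros)

lemma integral_circle_cis:
  fixes k :: int
  shows "(\<integral>l. cis (of_int k * l) \<partial>circle) = (if k = 0 then 2 * of_real pi else 0)"
proof (cases "k = 0")
  case True
  then show ?thesis by (simp add: measure_circle scaleR_conv_of_real)
next
  case False
  have "(\<integral>l. cis (of_int k * l) \<partial>circle) =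
      cis (of_int k * pi) / (\<i> * of_int k) - cis (of_int k * (-pi)) / (\<i> * of_int k)"
  proof (rule integral_circle_FTC)
    fix x
    have "((\<lambda>x. exp (\<i> * of_int k * of_real x) / (\<i> * of_int k)) has_vector_derivative
        exp (\<i> * of_int k * of_real x)) (at x within {-pi..pi})"
      using False by (auto intro!: derivative_eq_intros has_vector_derivative_real_field[of "\<lambda>z. exp (\<i> * of_int k * z) / (\<i> * of_int k)" _ x, unfolded o_def])
    then show "((\<lambda>x. cis (of_int k * x) / (\<i> * of_int k)) has_vector_derivative cis (of_int k * x)) (at x within {-pi..pi})"
      by (simp add: cis_conv_exp mult.assoc)
  qed (intro continuous_intros)
  also have "\<dots> = 0"
  proof -
    have "cis (of_int k * pi) = cis (of_int k * (-pi))"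
      by (simp add: complex_eq_iff mult.commute[of _ pi])
    then show ?thesis by simp
  qed
  finally show ?thesis using False by simp
qed

lemma integral_circle_cis_mult_cnj:
  fixes j k :: int
  shows "(\<integral>l. cis (of_int j * l) * cnj (cis (of_int k * l)) \<partial>circle) = (if j = k then 2 * of_real pi else 0)"
proof -
  have "(\<integral>l. cis (of_int j * l) * cnj (cis (of_int k * l)) \<partial>circle) = (\<integral>l. cis (of_int (j - k) * l) \<partial>circle)"
    by (simp add: cis_cnj cis_mult ring_distribs)
  then show ?thesis by (simp only: integral_circle_cis) simp
qed

text \<open>The Schwarz integral: the holomorphic function in the disc whose real part has
  boundary values \<open>u / 2\<close>.\<close>
definition schwarz :: "(real \<Rightarrow> real) \<Rightarrow> complex \<Rightarrow> complex" where
  "schwarz u z = 1 / (4 * of_real pi) * (\<integral>l. (cis l + z) / (cis l - z) * of_real (u l) \<partial>circle)"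

definition fourier :: "(real \<Rightarrow> real) \<Rightarrow> nat \<Rightarrow> complex" where
  "fourier u k = 1 / (2 * of_real pi) * (\<integral>l. of_real (u l) * cis (- (real k * l)) \<partial>circle)"

lemma schwarz_kernel_measurable [measurable]:
  "(\<lambda>l. (cis l + z) / (cis l - z)) \<in> borel_measurable borel"
  by measurable

lemma schwarz_kernel_bound:
  assumes "cmod z < 1"
  shows "cmod ((cis l + z) / (cis l - z)) \<le> 2 / (1 - cmod z)"
proof -
  have "cmod (cis l + z) \<le> 2"
    using norm_triangle_ineq[of "cis l" z] assms by simp
  moreover have "1 - cmod z \<le> cmod (cis l - z)"
    using norm_triangle_ineq2[of "cis l" z] by simp
  ultimately show ?thesis
    unfolding norm_divide using assms by (intro frac_le) auto
qed

lemma schwarz_integrable: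
  assumes "integrable circle u" "cmod z < 1"
  shows "integrable circle (\<lambda>l. (cis l + z) / (cis l - z) * complex_of_real (u l))"
proof (rule Bochner_Integration.integrable_bound)
  show "integrable circle (\<lambda>l. 2 / (1 - cmod z) * u l)" using assms by simp
  have [measurable]: "u \<in> borel_measurable circle" using assms by simp
  have [measurable]: "(\<lambda>l. (cis l + z) / (cis l - z)) \<in> borel_measurable circle"
    by (rule measurable_circle) measurable
  show "(\<lambda>l. (cis l + z) / (cis l - z) * complex_of_real (u l)) \<in> borel_measurable circle"
    by measurable
  show "AE l in circle. norm ((cis l + z) / (cis l - z) * complex_of_real (u l)) \<le> norm (2 / (1 - cmod z) * u l)"
  proof (rule AE_I2)
    fix l
    have "norm ((cis l + z) / (cis l - z) * complex_of_real (u l)) \<le> 2 / (1 - cmod z) * \<bar>u l\<bar>"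
      unfolding norm_mult norm_of_real by (intro mult_right_mono schwarz_kernel_bound assms) simp
    then show "norm ((cis l + z) / (cis l - z) * complex_of_real (u l)) \<le> norm (2 / (1 - cmod z) * u l)"
      using assms(2) by (simp add: abs_mult)
  qed
qed

lemma schwarz_add:
  assumes "integrable circle u" "integrable circle v" "cmod z < 1"
  shows "schwarz (\<lambda>l. u l + v l) z = schwarz u z + schwarz v z"
  unfolding schwarz_def of_real_add distrib_left
  by (simp only: Bochner_Integration.integral_add[OF schwarz_integrable[OF assms(1,3)] schwarz_integrable[OF assms(2,3)]] distrib_left)

lemma schwarz_cmult: "schwarz (\<lambda>l. c * u l) z = of_real c * schwarz u z"
proof -
  have "(cis l + z) / (cis l - z) * of_real (c * u l) = of_real c * ((cis l + z) / (cis l - z) * of_real (u l))" for l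
    by simp
  then show ?thesis
    unfolding schwarz_def by (simp only: integral_mult_right_zero) simp
qed

text \<open>A real part of a power series is a Fourier series, and absolute convergence allows
  integration term by term.\<close>
lemma fourier_pseries:
  assumes a: "summable (\<lambda>k. cmod (a k))"
  shows "fourier (\<lambda>l. 2 * Re (pseries a (cis (-l)))) k = (if k = 0 then of_real (2 * Re (a 0)) else cnj (a k))"
proof -
  let ?s = "\<lambda>K l. \<Sum>j<K. (a j * cis (- (real j * l)) + cnj (a j) * cis (real j * l)) * cis (- (real k * l))"
  define w where "w = (\<lambda>j. (if j + k = 0 then a j else 0) + (if j = k then cnj (a j) else 0))"
  have sums: "(\<lambda>j. a j * cis (-l) ^ j) sums pseries a (cis (-l))" for l
    by (rule pseries_sums[OF a]) simp
  have lim: "(\<lambda>K. ?s K l) \<longlonglongrightarrow> of_real (2 * Re (pseries a (cis (-l)))) * cis (- (real k * l))" for l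
  proof -
    have "(\<lambda>j. (a j * cis (-l) ^ j + cnj (a j * cis (-l) ^ j)) * cis (- (real k * l))) sums
        ((pseries a (cis (-l)) + cnj (pseries a (cis (-l)))) * cis (- (real k * l)))"
      by (intro sums_mult2 sums_add sums sums_cnj[THEN iffD2])
    then show ?thesis
      by (simp add: sums_def Complex.DeMoivre cis_cnj complex_add_cnj)
  qed
  have "(\<lambda>K. \<integral>l. ?s K l \<partial>circle) \<longlonglongrightarrow> (\<integral>l. of_real (2 * Re (pseries a (cis (-l)))) * cis (- (real k * l)) \<partial>circle)"
  proof (rule integral_dominated_convergence[where w = "\<lambda>_. 2 * (\<Sum>j. cmod (a j))"])
    show m: "?s K \<in> borel_measurable circle" for K
      by (rule measurable_circle) measurable
    show "(\<lambda>l. of_real (2 * Re (pseries a (cis (-l)))) * cis (- (real k * l))) \<in> borel_measurable circle"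
      by (rule borel_measurable_LIMSEQ_metric[OF m lim])
    show "AE l in circle. norm (?s K l) \<le> 2 * (\<Sum>j. cmod (a j))" for K
    proof (rule AE_I2)
      fix l
      have "norm (?s K l) \<le> (\<Sum>j<K. norm ((a j * cis (- (real j * l)) + cnj (a j) * cis (real j * l)) * cis (- (real k * l))))"
        by (rule norm_sum)
      also have "\<dots> \<le> (\<Sum>j<K. 2 * cmod (a j))"
        by (intro sum_mono) (simp add: norm_mult, rule order_trans[OF norm_triangle_ineq], simp add: norm_mult)
      also have "\<dots> \<le> 2 * (\<Sum>j. cmod (a j))"
        unfolding sum_distrib_left[symmetric] by (intro mult_left_mono sum_le_suminf a) auto
      finally show "norm (?s K l) \<le> 2 * (\<Sum>j. cmod (a j))" .
    qed
  qed (use lim in auto)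
  moreover have "(\<integral>l. ?s K l \<partial>circle) = (\<Sum>j<K. 2 * of_real pi * w j)" for K
  proof -
    have ib: "integrable circle (\<lambda>l. cis (real_of_int m * l))" for m
      by (rule integrable_circle_bounded[where B=1]) (auto intro!: measurable_circle)
    have "(a j * cis (- (real j * l)) + cnj (a j) * cis (real j * l)) * cis (- (real k * l)) =
        a j * cis (real_of_int (- int j - int k) * l) + cnj (a j) * cis (real_of_int (int j - int k) * l)" for j l
      by (simp add: distrib_right cis_mult mult.assoc algebra_simps)
    then have "(\<integral>l. ?s K l \<partial>circle) = (\<integral>l. (\<Sum>j<K. a j * cis (real_of_int (- int j - int k) * l) + cnj (a j) * cis (real_of_int (int j - int k) * l)) \<partial>circle)"
      by simp
    also have "\<dots> = (\<Sum>j<K. a j * (\<integral>l. cis (real_of_int (- int j - int k) * l) \<partial>circle) + cnj (a j) * (\<integral>l. cis (real_of_int (int j - int k) * l) \<partial>circle))"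
      by (subst Bochner_Integration.integral_sum)
         (intro Bochner_Integration.integrable_add integrable_mult_right ib, simp only: Bochner_Integration.integral_add[OF integrable_mult_right[OF ib] integrable_mult_right[OF ib]] integral_mult_right_zero)
    also have "\<dots> = (\<Sum>j<K. 2 * of_real pi * w j)"
      unfolding integral_circle_cis w_def by (intro sum.cong) (auto simp: algebra_simps split: if_splits)
    finally show ?thesis .
  qed
  ultimately have "(\<lambda>j. 2 * of_real pi * w j) sums (\<integral>l. of_real (2 * Re (pseries a (cis (-l)))) * cis (- (real k * l)) \<partial>circle)"
    by (simp add: sums_def)
  moreover have "(\<lambda>j. 2 * of_real pi * w j) sums (\<Sum>j\<in>{k}. 2 * of_real pi * w j)"
    by (rule sums_finite) (auto simp: w_def)
  ultimately have "(\<integral>l. of_real (2 * Re (pseries a (cis (-l)))) * cis (- (real k * l)) \<partial>circle) = 2 * of_real pi * w k"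
    using sums_unique2 by fastforce
  then show ?thesis
    unfolding fourier_def by (simp add: w_def complex_add_cnj)
qed

text \<open>The Schwarz kernel is \<open>1 + 2 * (\<Sum>k\<ge>1. (z * cis (-l)) ^ k)\<close>.\<close>
lemma schwarz_sums:
  assumes u: "integrable circle u" and z: "cmod z < 1"
  shows "(\<lambda>k. (if k = 0 then 1/2 else 1) * fourier u k * z ^ k) sums schwarz u z"
proof -
  let ?c = "\<lambda>k. if k = 0 then 1 else 2 :: complex"
  let ?s = "\<lambda>K l. (\<Sum>k<K. ?c k * (z * cis (-l)) ^ k) * of_real (u l)"
  have [measurable]: "u \<in> borel_measurable circle" using u by simp
  have q: "cmod (z * cis (-l)) < 1" for l using z by (simp add: norm_mult)
  have ker: "(\<lambda>k. ?c k * (z * cis (-l)) ^ k) sums ((cis l + z) / (cis l - z))" for l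
  proof -
    let ?q = "z * cis (-l)"
    have "(\<lambda>k. 2 * ?q ^ k - (if k = 0 then 1 else 0)) sums (2 * (1 / (1 - ?q)) - 1)"
      by (intro sums_diff sums_mult geometric_sums q) (use sums_If_finite_set[of "{0::nat}" "\<lambda>_. 1 :: complex"] in simp)
    moreover have "2 * (1 / (1 - ?q)) - 1 = (cis l + z) / (cis l - z)"
    proof -
      have c: "cis l * cis (-l) = 1" by (simp add: cis_mult)
      have "1 - ?q \<noteq> 0"
      proof
        assume "1 - ?q = 0"
        then have "cmod ?q = cmod 1" by (simp only: right_minus_eq)
        with q[of l] show False by (simp only: norm_one less_irrefl)
      qed
      moreover have "cis l - z = cis l * (1 - ?q)" using c by (simp add: algebra_simps)
      moreover have "cis l + z = cis l * (1 + ?q)" using c by (simp add: algebra_simps)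
      ultimately have "(cis l + z) / (cis l - z) = (1 + ?q) / (1 - ?q)"
        by (simp only: mult_divide_mult_cancel_left[OF cis_neq_zero])
      also have "\<dots> = (2 - (1 - ?q)) / (1 - ?q)" by simp
      also have "\<dots> = 2 * (1 / (1 - ?q)) - 1"
        by (simp only: diff_divide_distrib[of 2 "1 - ?q"] divide_self[OF \<open>1 - ?q \<noteq> 0\<close>] mult_1_right times_divide_eq_right)
      finally show ?thesis by (rule sym)
    qed
    moreover have "(\<lambda>k. 2 * ?q ^ k - (if k = 0 then 1 else 0)) = (\<lambda>k. ?c k * ?q ^ k)"
      by (intro ext) simp
    ultimately show ?thesis by (simp only:)
  qed
  have "(\<lambda>K. \<integral>l. ?s K l \<partial>circle) \<longlonglongrightarrow> (\<integral>l. (cis l + z) / (cis l - z) * of_real (u l) \<partial>circle)"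
  proof (rule integral_dominated_convergence[where w = "\<lambda>l. (2 / (1 - cmod z)) * \<bar>u l\<bar>"])
    have [measurable]: "(\<lambda>l. (cis l + z) / (cis l - z)) \<in> borel_measurable circle"
      by (rule measurable_circle) measurable
    show "(\<lambda>l. (cis l + z) / (cis l - z) * complex_of_real (u l)) \<in> borel_measurable circle"
      by measurable
    show "?s K \<in> borel_measurable circle" for K
    proof (rule borel_measurable_times)
      show "(\<lambda>l. \<Sum>k<K. ?c k * (z * cis (-l)) ^ k) \<in> borel_measurable circle"
        by (intro measurable_circle borel_measurable_continuous_onI continuous_intros)
    qed measurable
    show "integrable circle (\<lambda>l. 2 / (1 - cmod z) * \<bar>u l\<bar>)" using u by simp
    show "AE l in circle. (\<lambda>K. ?s K l) \<longlonglongrightarrow> (cis l + z) / (cis l - z) * complex_of_real (u l)"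
      by (intro AE_I2 tendsto_mult tendsto_const ker[unfolded sums_def])
    show "AE l in circle. norm (?s K l) \<le> 2 / (1 - cmod z) * \<bar>u l\<bar>" for K
    proof (rule AE_I2)
      fix l
      have "cmod (\<Sum>k<K. ?c k * (z * cis (-l)) ^ k) \<le> (\<Sum>k<K. 2 * cmod z ^ k)"
        by (rule order_trans[OF norm_sum sum_mono]) (auto simp: norm_mult norm_power)
      also have "\<dots> \<le> (\<Sum>k. 2 * cmod z ^ k)"
        using z by (intro sum_le_suminf summable_mult summable_geometric) auto
      also have "\<dots> = 2 / (1 - cmod z)"
        using z by (subst suminf_mult[OF summable_geometric]) (simp_all add: suminf_geometric)
      finally show "norm (?s K l) \<le> 2 / (1 - cmod z) * \<bar>u l\<bar>"
        unfolding norm_mult norm_of_real by (intro mult_right_mono) simp_all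
    qed
  qed
  moreover have "(\<integral>l. ?s K l \<partial>circle) = (\<Sum>k<K. 2 * of_real pi * (?c k * fourier u k * z ^ k))" for K
  proof -
    have ib: "integrable circle (\<lambda>l. of_real (u l) * cis (- (real k * l)))" for k
    proof (rule Bochner_Integration.integrable_bound[OF u])
      have [measurable]: "(\<lambda>l. cis (- (real k * l))) \<in> borel_measurable circle"
        by (rule measurable_circle) measurable
      show "(\<lambda>l. of_real (u l) * cis (- (real k * l))) \<in> borel_measurable circle" by measurable
    qed (simp add: norm_mult)
    have "?s K l = (\<Sum>k<K. (?c k * z ^ k) * (of_real (u l) * cis (- (real k * l))))" for l
      unfolding sum_distrib_right by (intro sum.cong) (simp_all add: power_mult_distrib Complex.DeMoivre)
    then have "(\<integral>l. ?s K l \<partial>circle) = (\<integral>l. (\<Sum>k<K. (?c k * z ^ k) * (of_real (u l) * cis (- (real k * l)))) \<partial>circle)"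
      by (simp only:)
    also have "\<dots> = (\<Sum>k<K. (?c k * z ^ k) * (\<integral>l. of_real (u l) * cis (- (real k * l)) \<partial>circle))"
      by (subst Bochner_Integration.integral_sum) (intro integrable_mult_right ib, simp only: integral_mult_right_zero)
    also have "\<dots> = (\<Sum>k<K. 2 * of_real pi * (?c k * fourier u k * z ^ k))"
      by (intro sum.cong) (simp_all add: fourier_def)
    finally show ?thesis .
  qed
  ultimately have "(\<lambda>k. 2 * of_real pi * (?c k * fourier u k * z ^ k)) sums (\<integral>l. (cis l + z) / (cis l - z) * of_real (u l) \<partial>circle)"
    by (simp only: sums_def)
  from sums_mult[OF this, of "1 / (4 * of_real pi)"]
  have "(\<lambda>k. 1 / (4 * of_real pi) * (2 * of_real pi * (?c k * fourier u k * z ^ k))) sums schwarz u z"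
    by (simp only: schwarz_def)
  also have "(\<lambda>k. 1 / (4 * complex_of_real pi) * (2 * of_real pi * (?c k * fourier u k * z ^ k))) =
      (\<lambda>k. (if k = 0 then 1/2 else 1) * fourier u k * z ^ k)"
    by (intro ext) simp
  finally show ?thesis .
qed

text \<open>The Schwarz integral recovers a power series from its real part on the circle. The
  coefficients are conjugated because the boundary is parametrized by \<open>cis (-l)\<close>.\<close>
lemma schwarz_pseries:
  assumes a: "summable (\<lambda>k. cmod (a k))" and a0: "Im (a 0) = 0" and z: "cmod z < 1"
  shows "schwarz (\<lambda>l. 2 * Re (pseries a (cis (-l)))) z = pseries (\<lambda>k. cnj (a k)) z"
    and "integrable circle (\<lambda>l. 2 * Re (pseries a (cis (-l))))"
proof -
  have m: "(\<lambda>l. 2 * Re (pseries a (cis (-l)))) \<in> borel_measurable circle"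
    unfolding pseries_def by (rule measurable_circle) measurable
  have "\<bar>2 * Re (pseries a (cis (-l)))\<bar> \<le> 2 * (\<Sum>k. cmod (a k))" for l
  proof -
    have "\<bar>Re (pseries a (cis (-l)))\<bar> \<le> cmod (pseries a (cis (-l)))" by (rule abs_Re_le_cmod)
    also have "\<dots> \<le> (\<Sum>k. cmod (a k * cis (-l) ^ k))"
      unfolding pseries_def by (rule summable_norm[OF summable_norm_pseries_term[OF a]]) simp
    finally show ?thesis by (simp add: norm_mult norm_power)
  qed
  then show int: "integrable circle (\<lambda>l. 2 * Re (pseries a (cis (-l))))"
    by (intro integrable_circle_bounded[OF m]) simp
  have "(\<lambda>k. cnj (a k) * z ^ k) sums schwarz (\<lambda>l. 2 * Re (pseries a (cis (-l)))) z"
  proof -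
    have "(if k = 0 then 1/2 else 1) * fourier (\<lambda>l. 2 * Re (pseries a (cis (-l)))) k = cnj (a k)" for k
    proof (cases "k = 0")
      case True
      have "cnj (a 0) = of_real (Re (a 0))" using a0 by (simp add: complex_eq_iff)
      with True show ?thesis by (simp only: fourier_pseries[OF a]) simp
    qed (simp only: fourier_pseries[OF a], simp)
    with schwarz_sums[OF int z] show ?thesis by (simp only:)
  qed
  from sums_unique[OF this] show "schwarz (\<lambda>l. 2 * Re (pseries a (cis (-l)))) z = pseries (\<lambda>k. cnj (a k)) z"
    unfolding pseries_def[of "\<lambda>k. cnj (a k)"] .
qed

section \<open>The Schwarz integral of a logarithmic distance\<close>

text \<open>The logarithm is \<open>0\<close> at the finitely many points of the circle where the distance
  vanishes.\<close>
definition log_dist :: "nat \<Rightarrow> real \<Rightarrow> real" where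
  "log_dist \<mu> l = ln ((cmod (1 - cis (- (real \<mu> * l))))\<^sup>2)"

lemma countable_cis_eq_1:
  assumes "\<mu> > 0"
  shows "countable {l. cis (- (real \<mu> * l)) = 1}"
proof -
  have "{l. cis (- (real \<mu> * l)) = 1} \<subseteq> range (\<lambda>j::int. of_int j * 2 * pi / real \<mu>)"
  proof
    fix l assume "l \<in> {l. cis (- (real \<mu> * l)) = 1}"
    then have "Re (cis (- (real \<mu> * l))) = Re 1" by (simp only: mem_Collect_eq)
    then have "cos (real \<mu> * l) = 1" by simp
    then obtain j :: int where "real \<mu> * l = of_int j * 2 * pi"
      using cos_one_2pi_int by blast
    then have "l = of_int j * 2 * pi / real \<mu>"
      using assms by (simp add: nonzero_eq_divide_eq mult.commute)
    then show "l \<in> range (\<lambda>j::int. of_int j * 2 * pi / real \<mu>)" by blast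
  qed
  then show ?thesis by (rule countable_subset) simp
qed

lemma AE_circle_cis_neq_1:
  assumes "\<mu> > 0"
  shows "AE l in circle. cis (- (real \<mu> * l)) \<noteq> 1"
  using AE_circle_countable[OF countable_cis_eq_1[OF assms]] by simp

text \<open>Moving the singularities off the circle by the factor \<open>s\<close> turns the logarithm into
  the real part of a holomorphic function.\<close>
lemma schwarz_log_dist_smoothed:
  fixes s :: real
  assumes \<mu>: "\<mu> > 0" and s: "0 < s" "s < 1"
  defines "p \<equiv> \<lambda>l. ln ((cmod (1 - of_real (s ^ \<mu>) * cis (- (real \<mu> * l))))\<^sup>2)"
  shows "integrable circle p" "(\<integral>l. p l \<partial>circle) = 0"
    "cmod z < 1 \<Longrightarrow> exp (schwarz p z) = 1 - (of_real s * z) ^ \<mu>"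
proof -
  \<comment> \<open>\<open>F\<close> is holomorphic in the disc of radius \<open>1 / s > 1\<close>, so its coefficients are
    absolutely summable.\<close>
  define F where "F = (\<lambda>w. Ln (1 - (of_real s * w) ^ \<mu>))"
  have small: "cmod ((of_real s * w) ^ \<mu>) < 1" if "cmod w < 1 / s" for w
  proof -
    have "s * cmod w < 1" using that s by (simp add: pos_less_divide_eq mult.commute)
    then have "(s * cmod w) ^ \<mu> < 1"
      using s \<mu> by (intro power_less_one_iff[THEN iffD2]) auto
    then show ?thesis using s by (simp add: norm_mult norm_power)
  qed
  have pos: "Re (1 - (of_real s * w) ^ \<mu>) > 0" if "cmod w < 1 / s" for w
    using small[OF that] abs_Re_le_cmod[of "(of_real s * w) ^ \<mu>"] by simp
  then have nz: "1 - (of_real s * w) ^ \<mu> \<noteq> 0" if "cmod w < 1 / s" for w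
    using that by fastforce
  have notin: "1 - (of_real s * w) ^ \<mu> \<notin> \<real>\<^sub>\<le>\<^sub>0" if "cmod w < 1 / s" for w
    using pos[OF that] by (auto simp: complex_nonpos_Reals_iff simp del: power_mult_distrib)
  have hol: "F holomorphic_on eball 0 (ereal (1 / s))"
    unfolding F_def eball_ereal using notin by (intro holomorphic_intros) auto
  define a where "a = fps_nth (fps_expansion F 0)"
  have "conv_radius a \<ge> ereal (1 / s)"
    unfolding a_def using conv_radius_fps_expansion[OF hol] by (simp add: fps_conv_radius_def)
  then have "conv_radius a > 1"
    by (rule less_le_trans[rotated]) (use s in \<open>simp add: one_ereal_def\<close>)
  then have a: "summable (\<lambda>k. cmod (a k))" by (rule abs_coeffs_conv_radius_gt_1)
  have F: "pseries a w = F w" if "cmod w \<le> 1" for w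
  proof -
    have "1 < 1 / s" using s by simp
    with that have "ereal (cmod w) < ereal (1 / s)" by simp
    from eval_fps_expansion'[OF hol this] show ?thesis
      by (simp add: a_def pseries_def eval_fps_def)
  qed
  have lt: "cmod w < 1 / s" if "cmod w \<le> 1" for w
    using that s by (intro le_less_trans[OF that]) simp
  have "a 0 = pseries a 0" by (simp add: pseries_eq_eval_fps eval_fps_at_0)
  also have "\<dots> = 0" using \<mu> by (simp add: F F_def zero_power)
  finally have a0: "a 0 = 0" .
  have p: "p l = 2 * Re (pseries a (cis (-l)))" for l
  proof -
    have c: "(of_real s * cis (-l)) ^ \<mu> = of_real (s ^ \<mu>) * cis (- (real \<mu> * l))"
      by (simp add: power_mult_distrib Complex.DeMoivre)
    have n: "1 - (of_real s * cis (-l)) ^ \<mu> \<noteq> 0" by (intro nz lt) simp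
    have "2 * Re (pseries a (cis (-l))) = 2 * ln (cmod (1 - (of_real s * cis (-l)) ^ \<mu>))"
      by (simp add: F F_def Re_Ln[OF n])
    also have "\<dots> = p l"
      unfolding p_def c[symmetric] using n by (subst ln_realpow) simp_all
    finally show ?thesis by (rule sym)
  qed
  then have p': "p = (\<lambda>l. 2 * Re (pseries a (cis (-l))))" by (rule ext)
  show "integrable circle p"
    unfolding p' by (rule schwarz_pseries(2)[OF a, of 0]) (simp_all add: a0)
  have "fourier p 0 = 0"
    unfolding p' using fourier_pseries[OF a, of 0] a0 by (simp only:) simp
  then have "(\<integral>l. complex_of_real (p l) \<partial>circle) = 0"
    by (simp add: fourier_def)
  then show "(\<integral>l. p l \<partial>circle) = 0" by simp
  show "exp (schwarz p z) = 1 - (of_real s * z) ^ \<mu>" if z: "cmod z < 1"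
  proof -
    have "schwarz p z = pseries (\<lambda>k. cnj (a k)) z"
      unfolding p' by (rule schwarz_pseries(1)[OF a _ z]) (simp add: a0)
    also have "\<dots> = cnj (F (cnj z))"
      using z by (subst pseries_cnj[OF a]) (simp_all add: F)
    also have "exp (cnj (F (cnj z))) = cnj (exp (F (cnj z)))" by (rule exp_cnj[symmetric])
    also have "exp (F (cnj z)) = 1 - (of_real s * cnj z) ^ \<mu>"
      unfolding F_def by (intro exp_Ln nz lt) (use z in simp)
    finally show ?thesis by simp
  qed
qed

lemma Abel_sequence:
  obtains s :: "nat \<Rightarrow> real" where "\<And>i. 0 < s i" "\<And>i. s i < 1" "s \<longlonglongrightarrow> 1"
proof
  show "0 < 1 - 1 / real (i + 2)" "1 - 1 / real (i + 2) < 1" for i by (auto simp: field_simps)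
  have "(\<lambda>i. 1 / real (i + 2)) \<longlonglongrightarrow> 0"
    using LIMSEQ_ignore_initial_segment[OF lim_1_over_n, of 2] .
  from tendsto_diff[OF tendsto_const[of 1] this] show "(\<lambda>i. 1 - 1 / real (i + 2)) \<longlonglongrightarrow> 1"
    by (simp only: diff_zero)
qed

text \<open>Letting \<open>s\<close> tend to \<open>1\<close>: integrability follows from Fatou because all the smoothed
  functions have mean zero, and the value from dominated convergence.\<close>
lemma schwarz_log_dist:
  assumes \<mu>: "\<mu> > 0"
  shows "integrable circle (log_dist \<mu>)"
    "cmod z < 1 \<Longrightarrow> exp (schwarz (log_dist \<mu>) z) = 1 - z ^ \<mu>"
proof -
  obtain s :: "nat \<Rightarrow> real" where s: "\<And>i. 0 < s i" "\<And>i. s i < 1" and s_lim: "s \<longlonglongrightarrow> 1"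
    using Abel_sequence by blast
  define p where "p = (\<lambda>i l. ln ((cmod (1 - of_real (s i ^ \<mu>) * cis (- (real \<mu> * l))))\<^sup>2))"
  have P: "integrable circle (p i)" "(\<integral>l. p i l \<partial>circle) = 0"
    "cmod z < 1 \<Longrightarrow> exp (schwarz (p i) z) = 1 - (of_real (s i) * z) ^ \<mu>" for i z
    unfolding p_def by (rule schwarz_log_dist_smoothed[OF \<mu> s]; assumption)+
  have meas: "log_dist \<mu> \<in> borel_measurable circle"
    unfolding log_dist_def[abs_def] by (rule measurable_circle) measurable
  have p_lim: "(\<lambda>i. p i l) \<longlonglongrightarrow> log_dist \<mu> l" if "cis (- (real \<mu> * l)) \<noteq> 1" for l
  proof -
    have "(\<lambda>i. (cmod (1 - of_real (s i ^ \<mu>) * cis (- (real \<mu> * l))))\<^sup>2) \<longlonglongrightarrow>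
        (cmod (1 - of_real (1 ^ \<mu>) * cis (- (real \<mu> * l))))\<^sup>2"
      by (intro tendsto_intros s_lim)
    then have "(\<lambda>i. (cmod (1 - of_real (s i ^ \<mu>) * cis (- (real \<mu> * l))))\<^sup>2) \<longlonglongrightarrow>
        (cmod (1 - cis (- (real \<mu> * l))))\<^sup>2" by simp
    then show ?thesis
      unfolding p_def log_dist_def by (rule tendsto_ln) (use that in simp)
  qed
  have ne: "cmod (1 - of_real (s i ^ \<mu>) * cis (- (real \<mu> * l))) > 0" for i l
  proof -
    have "1 - s i ^ \<mu> > 0" using s[of i] \<mu> by (simp add: power_less_one_iff)
    also have "1 - s i ^ \<mu> \<le> cmod (1 - of_real (s i ^ \<mu>) * cis (- (real \<mu> * l)))"
      using norm_triangle_ineq2[of 1 "of_real (s i ^ \<mu>) * cis (- (real \<mu> * l))"] s[of i]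
      by (simp add: norm_mult norm_power)
    finally show ?thesis .
  qed
  have upper: "p i l \<le> ln 4" for i l
  proof -
    have "s i ^ \<mu> \<le> 1" using s[of i] by (simp add: power_le_one)
    then have "cmod (1 - of_real (s i ^ \<mu>) * cis (- (real \<mu> * l))) \<le> 2"
      using norm_triangle_ineq4[of 1 "of_real (s i ^ \<mu>) * cis (- (real \<mu> * l))"] s[of i]
      by (simp add: norm_mult norm_power)
    then have "(cmod (1 - of_real (s i ^ \<mu>) * cis (- (real \<mu> * l))))\<^sup>2 \<le> 2\<^sup>2"
      by (rule power_mono) simp
    then show ?thesis
      unfolding p_def using ne[of i l] by (subst ln_le_cancel_iff) simp_all
  qed
  \<comment> \<open>\<open>ln 4 - p i\<close> is nonnegative and has the same integral for every \<open>i\<close>, because \<open>p i\<close>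
    has mean zero.\<close>
  have fin: "(\<integral>\<^sup>+l. ennreal (ln 4 - log_dist \<mu> l) \<partial>circle) \<le> ennreal (2 * pi * ln 4)"
  proof -
    have "(\<integral>\<^sup>+l. ennreal (ln 4 - log_dist \<mu> l) \<partial>circle) = (\<integral>\<^sup>+l. liminf (\<lambda>i. ennreal (ln 4 - p i l)) \<partial>circle)"
    proof (rule nn_integral_cong_AE, use AE_circle_cis_neq_1[OF \<mu>] in eventually_elim)
      case (elim l)
      have "(\<lambda>i. ennreal (ln 4 - p i l)) \<longlonglongrightarrow> ennreal (ln 4 - log_dist \<mu> l)"
        by (intro tendsto_intros p_lim elim)
      then show ?case by (rule lim_imp_Liminf[OF sequentially_bot, symmetric])
    qed
    also have "\<dots> \<le> liminf (\<lambda>i. \<integral>\<^sup>+l. ennreal (ln 4 - p i l) \<partial>circle)"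
    proof (rule nn_integral_liminf)
      fix i
      have "p i \<in> borel_measurable circle" using P(1)[of i] by simp
      then show "(\<lambda>l. ennreal (ln 4 - p i l)) \<in> borel_measurable circle" by simp
    qed
    also have "(\<lambda>i. \<integral>\<^sup>+l. ennreal (ln 4 - p i l) \<partial>circle) = (\<lambda>i. ennreal (2 * pi * ln 4))"
    proof
      fix i
      have "(\<integral>\<^sup>+l. ennreal (ln 4 - p i l) \<partial>circle) = ennreal (\<integral>l. ln 4 - p i l \<partial>circle)"
        using P(1)[of i] upper by (intro nn_integral_eq_integral AE_I2) auto
      also have "(\<integral>l. ln 4 - p i l \<partial>circle) = 2 * pi * ln 4"
        using P(1)[of i] P(2)[of i] by (subst Bochner_Integration.integral_diff) (simp_all add: measure_circle)
      finally show "(\<integral>\<^sup>+l. ennreal (ln 4 - p i l) \<partial>circle) = ennreal (2 * pi * ln 4)" .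
    qed
    finally show ?thesis by (simp add: Liminf_const)
  qed
  have upper': "AE l in circle. log_dist \<mu> l \<le> ln 4"
    using AE_circle_cis_neq_1[OF \<mu>]
  proof eventually_elim
    case (elim l)
    show ?case by (rule tendsto_upperbound[OF p_lim[OF elim]]) (simp_all add: upper)
  qed
  have "integrable circle (\<lambda>l. ln 4 - log_dist \<mu> l)"
  proof (rule integrableI_nonneg)
    show "(\<lambda>l. ln 4 - log_dist \<mu> l) \<in> borel_measurable circle" using meas by simp
    show "AE l in circle. 0 \<le> ln 4 - log_dist \<mu> l" using upper' by eventually_elim simp
    show "(\<integral>\<^sup>+l. ennreal (ln 4 - log_dist \<mu> l) \<partial>circle) < \<infinity>" using fin by (simp add: le_less_trans)
  qed
  from Bochner_Integration.integrable_diff[OF circle.integrable_const[of "ln 4"] this]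
  show int: "integrable circle (log_dist \<mu>)" by simp
  show "exp (schwarz (log_dist \<mu>) z) = 1 - z ^ \<mu>" if z: "cmod z < 1"
  proof -
    have "(\<lambda>i. schwarz (p i) z) \<longlonglongrightarrow> schwarz (log_dist \<mu>) z"
      unfolding schwarz_def
    proof (intro tendsto_mult tendsto_const)
      show "(\<lambda>i. \<integral>l. (cis l + z) / (cis l - z) * of_real (p i l) \<partial>circle) \<longlonglongrightarrow>
          (\<integral>l. (cis l + z) / (cis l - z) * of_real (log_dist \<mu> l) \<partial>circle)"
      proof (rule integral_dominated_convergence[where w = "\<lambda>l. 2 / (1 - cmod z) * (ln 4 + \<bar>log_dist \<mu> l\<bar>)"])
        show "(\<lambda>l. (cis l + z) / (cis l - z) * of_real (log_dist \<mu> l)) \<in> borel_measurable circle"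
          by (rule borel_measurable_integrable[OF schwarz_integrable[OF int z]])
        show "(\<lambda>l. (cis l + z) / (cis l - z) * of_real (p i l)) \<in> borel_measurable circle" for i
          by (rule borel_measurable_integrable[OF schwarz_integrable[OF P(1) z]])
        show "integrable circle (\<lambda>l. 2 / (1 - cmod z) * (ln 4 + \<bar>log_dist \<mu> l\<bar>))"
          using int by simp
        show "AE l in circle. (\<lambda>i. (cis l + z) / (cis l - z) * of_real (p i l)) \<longlonglongrightarrow>
            (cis l + z) / (cis l - z) * of_real (log_dist \<mu> l)"
          using AE_circle_cis_neq_1[OF \<mu>]
          by eventually_elim (intro tendsto_mult tendsto_const tendsto_of_real p_lim)
        show "AE l in circle. norm ((cis l + z) / (cis l - z) * complex_of_real (p i l)) \<le>
            2 / (1 - cmod z) * (ln 4 + \<bar>log_dist \<mu> l\<bar>)" for i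
          using AE_circle_cis_neq_1[OF \<mu>]
        proof eventually_elim
          case (elim l)
          let ?\<zeta> = "cis (- (real \<mu> * l))"
          have r: "0 \<le> s i ^ \<mu>" "s i ^ \<mu> \<le> 1" using s[of i] by (auto simp: power_le_one)
          \<comment> \<open>The distance from \<open>1\<close> to \<open>?\<zeta>\<close> is at most twice the distance from \<open>1\<close> to the
            point \<open>s i ^ \<mu> * ?\<zeta>\<close> on the same radius, which bounds \<open>p i\<close> from below by
            \<open>log_dist \<mu> - ln 4\<close>.\<close>
          have "cmod (1 - ?\<zeta>) \<le> cmod (1 - of_real (s i ^ \<mu>) * ?\<zeta>) + cmod (of_real (s i ^ \<mu>) * ?\<zeta> - ?\<zeta>)"
            using norm_triangle_ineq[of "1 - of_real (s i ^ \<mu>) * ?\<zeta>" "of_real (s i ^ \<mu>) * ?\<zeta> - ?\<zeta>"] by simp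
          also have "of_real (s i ^ \<mu>) * ?\<zeta> - ?\<zeta> = of_real (s i ^ \<mu> - 1) * ?\<zeta>"
            by (simp add: left_diff_distrib)
          also have "cmod (of_real (s i ^ \<mu> - 1) * ?\<zeta>) = 1 - s i ^ \<mu>"
            unfolding norm_mult norm_of_real norm_cis using r by simp
          also have "1 - s i ^ \<mu> \<le> cmod (1 - of_real (s i ^ \<mu>) * ?\<zeta>)"
          proof -
            have "cmod (of_real (s i ^ \<mu>) * ?\<zeta>) = s i ^ \<mu>"
              unfolding norm_mult norm_of_real norm_cis using r by simp
            then show ?thesis
              using norm_triangle_ineq2[of 1 "of_real (s i ^ \<mu>) * ?\<zeta>"] by simp
          qed
          finally have "cmod (1 - ?\<zeta>) \<le> 2 * cmod (1 - of_real (s i ^ \<mu>) * ?\<zeta>)" by simp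
          then have "(cmod (1 - ?\<zeta>))\<^sup>2 \<le> (2 * cmod (1 - of_real (s i ^ \<mu>) * ?\<zeta>))\<^sup>2"
            by (rule power_mono) simp
          then have "ln ((cmod (1 - ?\<zeta>))\<^sup>2) \<le> ln (4 * (cmod (1 - of_real (s i ^ \<mu>) * ?\<zeta>))\<^sup>2)"
          proof (subst ln_le_cancel_iff)
            show "0 < (cmod (1 - ?\<zeta>))\<^sup>2" using elim by simp
            show "0 < 4 * (cmod (1 - of_real (s i ^ \<mu>) * ?\<zeta>))\<^sup>2" using ne[of i l] by (intro mult_pos_pos zero_less_power) simp_all
          qed (simp only: power_mult_distrib, simp)
          also have "\<dots> = ln 4 + ln ((cmod (1 - of_real (s i ^ \<mu>) * ?\<zeta>))\<^sup>2)"
            using ne[of i l] by (intro ln_mult_pos) simp_all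
          finally have "log_dist \<mu> l \<le> ln 4 + p i l" by (simp only: log_dist_def p_def)
          then have "\<bar>p i l\<bar> \<le> ln 4 + \<bar>log_dist \<mu> l\<bar>" using upper[of i l] by linarith
          then show ?case
            unfolding norm_mult norm_of_real using z
            by (intro mult_mono schwarz_kernel_bound) simp_all
        qed
      qed
    qed
    then have "(\<lambda>i. exp (schwarz (p i) z)) \<longlonglongrightarrow> exp (schwarz (log_dist \<mu>) z)"
      by (rule tendsto_exp)
    moreover have "(\<lambda>i. exp (schwarz (p i) z)) \<longlonglongrightarrow> 1 - (of_real 1 * z) ^ \<mu>"
      unfolding P(3)[OF z] by (intro tendsto_intros s_lim)
    ultimately show ?thesis
      using LIMSEQ_unique by fastforce
  qed
qed

section \<open>Smooth even functions on the circle\<close>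

text \<open>The kernel \<open>incr_kernel 1 1\<close> as an entire function; it has no zeros in the disc of
  radius \<open>2 * pi\<close>, hence a holomorphic logarithm there.\<close>
definition diff_quot :: "complex \<Rightarrow> complex" where
  "diff_quot w = (if w = 0 then 1 else (1 - exp (- (\<i> * w))) / (\<i> * w))"

lemma diff_quot_holomorphic: "diff_quot holomorphic_on UNIV"
proof -
  define f where "f = (\<lambda>w. - exp (- (\<i> * w)) / \<i>)"
  have d: "(f has_field_derivative exp (- (\<i> * w))) (at w)" for w
    unfolding f_def by (rule derivative_eq_intros refl | simp add: mult.assoc)+
  have "(\<lambda>z. if z = 0 then deriv f 0 else (f z - f 0) / (z - 0)) holomorphic_on UNIV"
    by (rule pole_lemma) (use d in \<open>auto simp: holomorphic_on_open\<close>)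
  also have "(\<lambda>z. if z = 0 then deriv f 0 else (f z - f 0) / (z - 0)) = diff_quot"
  proof
    fix z
    have "deriv f 0 = 1" using DERIV_imp_deriv[OF d[of 0]] by simp
    then show "(if z = 0 then deriv f 0 else (f z - f 0) / (z - 0)) = diff_quot z"
      by (simp add: diff_quot_def f_def field_simps)
  qed
  finally show ?thesis .
qed

lemma diff_quot_nonzero:
  assumes "cmod w < 2 * pi"
  shows "diff_quot w \<noteq> 0"
proof
  assume eq: "diff_quot w = 0"
  then have w: "w \<noteq> 0" by (auto simp: diff_quot_def)
  with eq have "exp (- (\<i> * w)) = 1" by (simp add: diff_quot_def)
  then obtain j :: int where j: "Re (- (\<i> * w)) = 0" "Im (- (\<i> * w)) = of_int (2 * j) * pi"
    using exp_eq_1 by blast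
  then have wj: "w = of_real (- (of_int (2 * j) * pi))" by (simp add: complex_eq_iff)
  then have "cmod w = \<bar>of_int (2 * j)\<bar> * pi" by (simp only: norm_of_real) (simp add: abs_mult)
  with assms have "\<bar>of_int j :: real\<bar> < 1" by (simp add: abs_mult)
  then have "j = 0" by linarith
  with wj w show False by simp
qed

lemma diff_quot_of_real: "diff_quot (of_real l) = incr_kernel 1 1 l"
  by (simp add: diff_quot_def incr_kernel_def cis_conv_exp)

lemma incr_kernel_1_cnj: "incr_kernel 1 1 (- l) = cnj (incr_kernel 1 1 l)"
  by (simp add: incr_kernel_def cis_cnj)

text \<open>By Weierstrass approximation in \<open>cos l\<close>, such a \<open>D\<close> is orthogonal to itself.\<close>
lemma Fourier_coeffs_determine_even:
  fixes D :: "real \<Rightarrow> real"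
  assumes cont: "continuous_on {-pi..pi} D" and even: "\<And>l. l \<in> {-pi..pi} \<Longrightarrow> D (- l) = D l"
    and zero: "\<And>k::nat. (\<integral>l. D l * cos (real k * l) \<partial>circle) = 0"
    and l: "l \<in> {-pi..pi}"
  shows "D l = 0"
proof -
  have int: "integrable circle (\<lambda>l. D l * g l)" if "continuous_on {-pi..pi} g" for g
    unfolding integrable_circle
    by (intro borel_integrable_atLeastAtMost' continuous_intros cont that)
  \<comment> \<open>Powers of \<open>cos l\<close> are combinations of the functions \<open>cos (k * l)\<close>.\<close>
  have pow: "(\<integral>l. D l * (cos l ^ j * cos (real k * l)) \<partial>circle) = 0" for j k :: nat
  proof (induction j arbitrary: k)
    case 0
    then show ?case using zero[of k] by simp
  next
    case (Suc j)
    define k' where "k' = (if k = 0 then 1 else k - 1)"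
    have "cos l * cos (real k * l) = (cos (real (Suc k) * l) + cos (real k' * l)) / 2" for l
    proof (cases "k = 0")
      case False
      then have "real k * l - l = real k' * l" by (simp add: k'_def of_nat_diff left_diff_distrib)
      then show ?thesis
        using cos_add[of "real k * l" l] cos_diff[of "real k * l" l] by (simp add: distrib_right add.commute)
    qed (simp add: k'_def)
    then have prod: "cos l * cos (real k * l) = (cos (real (Suc k) * l) + cos (real k' * l)) / 2" for l .
    have "D l * (cos l ^ Suc j * cos (real k * l)) =
        (D l * (cos l ^ j * cos (real (Suc k) * l)) + D l * (cos l ^ j * cos (real k' * l))) / 2" for l
    proof -
      have "D l * (cos l ^ Suc j * cos (real k * l)) = D l * cos l ^ j * (cos l * cos (real k * l))" by simp
      then show ?thesis unfolding prod by (simp add: distrib_left)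
    qed
    then have "(\<integral>l. D l * (cos l ^ Suc j * cos (real k * l)) \<partial>circle) =
        (\<integral>l. (D l * (cos l ^ j * cos (real (Suc k) * l)) + D l * (cos l ^ j * cos (real k' * l))) / 2 \<partial>circle)"
      by (simp only:)
    also have "\<dots> = ((\<integral>l. D l * (cos l ^ j * cos (real (Suc k) * l)) \<partial>circle) + (\<integral>l. D l * (cos l ^ j * cos (real k' * l)) \<partial>circle)) / 2"
      by (subst integral_divide_zero, subst Bochner_Integration.integral_add) (intro int continuous_intros refl)+
    also have "\<dots> = 0" by (simp only: Suc.IH) simp
    finally show ?case .
  qed
  have poly: "(\<integral>l. D l * (\<Sum>i\<le>n. a i * cos l ^ i) \<partial>circle) = 0" for n and a :: "nat \<Rightarrow> real"
  proof -
    have "(\<integral>l. D l * (\<Sum>i\<le>n. a i * cos l ^ i) \<partial>circle) = (\<integral>l. (\<Sum>i\<le>n. a i * (D l * (cos l ^ i * cos (real 0 * l)))) \<partial>circle)"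
      by (simp add: sum_distrib_left mult_ac)
    also have "\<dots> = (\<Sum>i\<le>n. a i * (\<integral>l. D l * (cos l ^ i * cos (real 0 * l)) \<partial>circle))"
      by (subst Bochner_Integration.integral_sum) (intro integrable_mult_right int continuous_intros, simp only: integral_mult_right_zero)
    also have "\<dots> = 0" by (simp only: pow mult_zero_right sum.neutral_const)
    finally show ?thesis .
  qed
  \<comment> \<open>An even function on the circle is a function of \<open>cos l\<close>, to which the approximation
    theorem on \<open>{-1..1}\<close> applies.\<close>
  define d where "d = (\<lambda>x. D (arccos x))"
  have d: "continuous_on {-1..1} d"
    unfolding d_def
  proof (rule continuous_on_compose2[OF cont])
    show "continuous_on {-1..1} arccos"
      by (intro continuous_on_arccos continuous_on_id) simp
    show "arccos ` {-1..1} \<subseteq> {-pi..pi}"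
    proof (rule image_subsetI)
      fix x :: real assume "x \<in> {-1..1}"
      then show "arccos x \<in> {-pi..pi}"
        using arccos_lbound[of x] arccos_ubound[of x] pi_gt_zero unfolding atLeastAtMost_iff by linarith
    qed
  qed
  have Dd: "D l = d (cos l)" if "l \<in> {-pi..pi}" for l
  proof (cases "l \<ge> 0")
    case True
    then show ?thesis using that by (simp add: d_def arccos_cos)
  next
    case False
    then have "arccos (cos (- l)) = - l" using that by (intro arccos_cos) auto
    then show ?thesis using even[OF that] by (simp add: d_def)
  qed
  have absD: "continuous_on {-pi..pi} (\<lambda>l. \<bar>D l\<bar>)" by (intro continuous_intros cont)
  have iabs: "integrable circle (\<lambda>l. \<bar>D l\<bar>)"
    unfolding integrable_circle by (rule borel_integrable_atLeastAtMost'[OF absD])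
  have small: "(\<integral>l. D l * D l \<partial>circle) \<le> e * (\<integral>l. \<bar>D l\<bar> \<partial>circle)" if "e > 0" for e
  proof -
    obtain g where g: "real_polynomial_function g" "\<And>x. x \<in> {-1..1} \<Longrightarrow> \<bar>d x - g x\<bar> < e"
      using Stone_Weierstrass_real_polynomial_function[OF compact_Icc d \<open>e > 0\<close>] by blast
    obtain a n where gs: "g = (\<lambda>x. \<Sum>i\<le>n. a i * x ^ i)"
      using g(1) unfolding real_polynomial_function_iff_sum by blast
    have cg: "continuous_on {-pi..pi} (\<lambda>l. g (cos l))" unfolding gs by (intro continuous_intros)
    have "(\<integral>l. D l * D l \<partial>circle) = (\<integral>l. D l * D l \<partial>circle) - (\<integral>l. D l * g (cos l) \<partial>circle)"
      unfolding gs poly by simp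
    also have "\<dots> = (\<integral>l. D l * D l - D l * g (cos l) \<partial>circle)"
      by (rule Bochner_Integration.integral_diff[symmetric]) (intro int cont cg)+
    also have "\<dots> \<le> (\<integral>l. e * \<bar>D l\<bar> \<partial>circle)"
    proof (rule integral_mono)
      show "integrable circle (\<lambda>l. D l * D l - D l * g (cos l))"
        by (intro Bochner_Integration.integrable_diff int cont cg)
      show "integrable circle (\<lambda>l. e * \<bar>D l\<bar>)" by (intro integrable_mult_right iabs)
      fix l assume "l \<in> space circle"
      then have "\<bar>D l - g (cos l)\<bar> < e"
        using g(2)[of "cos l"] Dd[of l] by simp
      then have "\<bar>D l - g (cos l)\<bar> * \<bar>D l\<bar> \<le> e * \<bar>D l\<bar>" by (intro mult_right_mono) auto
      then show "D l * D l - D l * g (cos l) \<le> e * \<bar>D l\<bar>"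
        using abs_ge_self[of "(D l - g (cos l)) * D l"] unfolding abs_mult
        by (simp only: left_diff_distrib) (simp only: mult.commute[of "g (cos l)"])
    qed
    finally show ?thesis by simp
  qed
  have "(\<integral>l. D l * D l \<partial>circle) = 0"
  proof (rule antisym)
    have "((\<lambda>e. e * (\<integral>l. \<bar>D l\<bar> \<partial>circle)) \<longlongrightarrow> 0 * (\<integral>l. \<bar>D l\<bar> \<partial>circle)) (at_right 0)"
      by (intro tendsto_intros)
    then have lim: "((\<lambda>e. e * (\<integral>l. \<bar>D l\<bar> \<partial>circle)) \<longlongrightarrow> 0) (at_right 0)" by simp
    show "(\<integral>l. D l * D l \<partial>circle) \<le> 0"
      by (rule tendsto_lowerbound[OF lim]) (auto intro: eventually_mono[OF eventually_at_right_less] small)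
  qed (intro integral_nonneg_AE AE_I2, simp)
  moreover have si: "set_integrable lborel {-pi..pi} (\<lambda>l. D l * D l)"
    by (intro borel_integrable_atLeastAtMost' continuous_intros cont)
  ultimately have "integral {-pi..pi} (\<lambda>l. D l * D l) = 0"
    using set_borel_integral_eq_integral(2)[OF si] by (simp add: integral_circle)
  then have "((\<lambda>l. D l * D l) has_integral 0) (cbox (-pi) pi)"
    using set_borel_integral_eq_integral(1)[OF si] by (simp add: has_integral_integrable_integral)
  then have "D l * D l = 0"
    by (rule has_integral_0_cbox_imp_0[rotated 2])
       (use l pi_gt_zero in \<open>auto intro!: continuous_intros cont simp del: pi_gt_zero\<close>)
  then show ?thesis by simp
qed

lemma smooth_cosine_coeffs_bound:
  fixes u u1 u2 :: "real \<Rightarrow> real"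
  assumes u: "\<And>l. l \<in> {-pi..pi} \<Longrightarrow> (u has_real_derivative u1 l) (at l)"
    and u1: "\<And>l. l \<in> {-pi..pi} \<Longrightarrow> (u1 has_real_derivative u2 l) (at l)"
    and u2: "continuous_on {-pi..pi} u2"
  shows "\<exists>C. \<forall>k\<ge>1. \<bar>\<integral>l. u l * cos (real k * l) \<partial>circle\<bar> \<le> C / (real k)\<^sup>2"
proof -
  have cu: "continuous_on {-pi..pi} u"
    by (intro continuous_at_imp_continuous_on ballI DERIV_isCont[OF u])
  obtain B where B: "\<And>l. l \<in> {-pi..pi} \<Longrightarrow> \<bar>u2 l\<bar> \<le> B"
  proof -
    obtain B where "\<forall>x\<in>u2 ` {-pi..pi}. norm x \<le> B"
      using compact_imp_bounded[OF compact_continuous_image[OF u2 compact_Icc]] unfolding bounded_iff by blast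
    then have "\<bar>u2 l\<bar> \<le> B" if "l \<in> {-pi..pi}" for l using that by simp
    then show thesis by (rule that)
  qed
  have B0: "B \<ge> 0" by (rule order_trans[OF abs_ge_zero B[of 0]]) (use pi_gt_zero in simp)
  define C where "C = \<bar>u1 pi\<bar> + \<bar>u1 (-pi)\<bar> + 2 * pi * B"
  have "\<bar>\<integral>l. u l * cos (real k * l) \<partial>circle\<bar> \<le> C / (real k)\<^sup>2" if k: "k \<ge> 1" for k
  proof -
    have k0: "real k \<noteq> 0" using k by simp
    \<comment> \<open>\<open>?G\<close> is what two integrations by parts produce. Its first term vanishes at both
      ends since \<open>sin (k * pi) = 0\<close>.\<close>
    let ?G = "\<lambda>l. u l * sin (real k * l) / real k + u1 l * cos (real k * l) / (real k)\<^sup>2"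
    let ?g = "\<lambda>l. u l * cos (real k * l) + u2 l * cos (real k * l) / (real k)\<^sup>2"
    have i1: "integrable circle (\<lambda>l. u l * cos (real k * l))"
      unfolding integrable_circle by (intro borel_integrable_atLeastAtMost' continuous_intros cu)
    have i2: "integrable circle (\<lambda>l. u2 l * cos (real k * l) / (real k)\<^sup>2)"
      unfolding integrable_circle by (intro borel_integrable_atLeastAtMost' continuous_intros u2) (use k in auto)
    have "integral\<^sup>L circle ?g = ?G pi - ?G (-pi)"
    proof (rule integral_circle_FTC)
      fix l assume "-pi \<le> l" "l \<le> pi"
      then have l: "l \<in> {-pi..pi}" by simp
      have "(?G has_real_derivative ?g l) (at l)"
      proof -
        have s': "((\<lambda>l. sin (real k * l) / real k) has_real_derivative cos (real k * l)) (at l)"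
          using k0 by (auto intro!: derivative_eq_intros)
        have c': "((\<lambda>l. cos (real k * l) / (real k)\<^sup>2) has_real_derivative - (sin (real k * l) / real k)) (at l)"
        proof -
          have "((\<lambda>l. cos (real k * l) * (1 / (real k)\<^sup>2)) has_real_derivative - sin (real k * l) * real k * (1 / (real k)\<^sup>2)) (at l)"
            by (rule DERIV_cmult_right) (auto intro!: derivative_eq_intros)
          then show ?thesis using k0 by (simp add: power2_eq_square)
        qed
        have "((\<lambda>l. u l * (sin (real k * l) / real k) + u1 l * (cos (real k * l) / (real k)\<^sup>2)) has_real_derivative
            (u1 l * (sin (real k * l) / real k) + cos (real k * l) * u l) +
            (u2 l * (cos (real k * l) / (real k)\<^sup>2) + - (sin (real k * l) / real k) * u1 l)) (at l)"
          by (rule DERIV_add[OF DERIV_mult[OF u[OF l] s'] DERIV_mult[OF u1[OF l] c']])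
        then show ?thesis by (simp add: mult.commute)
      qed
      then show "(?G has_vector_derivative ?g l) (at l within {-pi..pi})"
        by (simp add: has_real_derivative_iff_has_vector_derivative has_vector_derivative_at_within)
    qed (intro continuous_intros cu u2, use k in auto)
    also have "\<dots> = (u1 pi - u1 (-pi)) * cos (real k * pi) / (real k)\<^sup>2"
      by (simp add: diff_divide_distrib left_diff_distrib)
    finally have eq: "(\<integral>l. u l * cos (real k * l) \<partial>circle) =
        (u1 pi - u1 (-pi)) * cos (real k * pi) / (real k)\<^sup>2 - (\<integral>l. u2 l * cos (real k * l) / (real k)\<^sup>2 \<partial>circle)"
      using Bochner_Integration.integral_add[OF i1 i2] by simp
    have a: "\<bar>(u1 pi - u1 (-pi)) * cos (real k * pi) / (real k)\<^sup>2\<bar> \<le> (\<bar>u1 pi\<bar> + \<bar>u1 (-pi)\<bar>) / (real k)\<^sup>2"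
    proof -
      have "\<bar>u1 pi - u1 (-pi)\<bar> * \<bar>cos (real k * pi)\<bar> \<le> (\<bar>u1 pi\<bar> + \<bar>u1 (-pi)\<bar>) * 1"
        by (intro mult_mono abs_triangle_ineq4 abs_cos_le_one) auto
      then show ?thesis by (simp add: abs_mult divide_right_mono)
    qed
    have b: "\<bar>\<integral>l. u2 l * cos (real k * l) / (real k)\<^sup>2 \<partial>circle\<bar> \<le> 2 * pi * B / (real k)\<^sup>2"
    proof -
      have "\<bar>\<integral>l. u2 l * cos (real k * l) / (real k)\<^sup>2 \<partial>circle\<bar> \<le> (\<integral>l. \<bar>u2 l * cos (real k * l) / (real k)\<^sup>2\<bar> \<partial>circle)"
        by (rule integral_abs_bound)
      also have "\<dots> \<le> (\<integral>l. B / (real k)\<^sup>2 \<partial>circle)"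
      proof (rule integral_mono)
        fix l assume "l \<in> space circle"
        then have "\<bar>u2 l\<bar> * \<bar>cos (real k * l)\<bar> \<le> B * 1"
          using B0 by (intro mult_mono B abs_cos_le_one) auto
        then show "\<bar>u2 l * cos (real k * l) / (real k)\<^sup>2\<bar> \<le> B / (real k)\<^sup>2"
          by (simp add: abs_mult divide_right_mono)
      qed (intro integrable_abs i2 circle.integrable_const)+
      also have "\<dots> = 2 * pi * B / (real k)\<^sup>2" by (simp add: measure_circle)
      finally show ?thesis .
    qed
    show ?thesis
      unfolding eq C_def add_divide_distrib[of "\<bar>u1 pi\<bar> + \<bar>u1 (-pi)\<bar>"] using a b by linarith
  qed
  then show ?thesis by (intro exI[of _ C] allI impI)
qed

section \<open>The outer function of the increment kernel\<close>

text \<open>The log modulus of the kernel is the sum of its Fourier series, which converges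
  absolutely: the function is smooth and even on \<open>{-pi..pi}\<close>. The periodic extension has a
  corner at the end points only, so the coefficients are of order \<open>1 / k\<^sup>2\<close>.\<close>
lemma outer_log_series:
  obtains a :: "nat \<Rightarrow> complex" where "summable (\<lambda>k. cmod (a k))" "\<And>k. Im (a k) = 0"
    "\<And>l. l \<in> {-pi..pi} \<Longrightarrow> 2 * Re (pseries a (cis (-l))) = ln ((cmod (incr_kernel 1 1 l))\<^sup>2)"
proof -
  have hol: "diff_quot holomorphic_on ball 0 (2 * pi)"
    by (rule holomorphic_on_subset[OF diff_quot_holomorphic]) simp
  obtain H where H: "H holomorphic_on ball 0 (2 * pi)"
    and eH: "\<And>w. w \<in> ball 0 (2 * pi) \<Longrightarrow> exp (H w) = diff_quot w"
    by (rule holomorphic_logarithm_exists[OF convex_ball open_ball hol, of 0])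
       (use diff_quot_nonzero in auto)
  have inball: "complex_of_real l \<in> ball 0 (2 * pi)" if "l \<in> {-pi..pi}" for l
  proof -
    have "\<bar>l\<bar> < 2 * pi" using that pi_gt_zero unfolding atLeastAtMost_iff by linarith
    then show ?thesis by simp
  qed
  define u u1 u2 where "u = (\<lambda>l. 2 * Re (H (of_real l)))"
    and "u1 = (\<lambda>l. 2 * Re (deriv H (of_real l)))" and "u2 = (\<lambda>l. 2 * Re (deriv (deriv H) (of_real l)))"
  have H1: "deriv H holomorphic_on ball 0 (2 * pi)" and H2: "deriv (deriv H) holomorphic_on ball 0 (2 * pi)"
    by (intro holomorphic_deriv H open_ball)+
  have re: "((\<lambda>l. 2 * Re (G (of_real l))) has_real_derivative 2 * Re (deriv G (of_real l))) (at l)"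
    if G: "G holomorphic_on ball 0 (2 * pi)" and l: "l \<in> {-pi..pi}" for G l
  proof -
    have "((\<lambda>l. G (of_real l)) has_vector_derivative deriv G (of_real l)) (at l)"
      by (rule has_vector_derivative_real_field[OF holomorphic_derivI[OF G open_ball inball[OF l]]])
    then have "((\<lambda>l. Re (G (of_real l))) has_vector_derivative Re (deriv G (of_real l))) (at l)"
      by (rule bounded_linear.has_vector_derivative[OF bounded_linear_Re])
    then have "((\<lambda>l. Re (G (of_real l))) has_real_derivative Re (deriv G (of_real l))) (at l)"
      by (simp add: has_real_derivative_iff_has_vector_derivative)
    then show ?thesis by (rule DERIV_cmult)
  qed
  have du: "(u has_real_derivative u1 l) (at l)" and du1: "(u1 has_real_derivative u2 l) (at l)"
    if "l \<in> {-pi..pi}" for l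
    unfolding u_def u1_def u2_def by (intro re H H1 that)+
  have cu: "continuous_on {-pi..pi} u"
    by (intro continuous_at_imp_continuous_on ballI DERIV_isCont[OF du])
  have cu2: "continuous_on {-pi..pi} u2"
    unfolding u2_def
    by (intro continuous_intros continuous_on_compose2[OF holomorphic_on_imp_continuous_on[OF H2]] image_subsetI inball)
  obtain C where C: "\<And>k. k \<ge> 1 \<Longrightarrow> \<bar>\<integral>l. u l * cos (real k * l) \<partial>circle\<bar> \<le> C / (real k)\<^sup>2"
    using smooth_cosine_coeffs_bound[OF du du1 cu2] by blast
  \<comment> \<open>The zeroth coefficient is halved: it occurs once in the cosine series, the others
    twice.\<close>
  define c where "c = (\<lambda>k. (if k = 0 then 1 / (4 * pi) else 1 / (2 * pi)) * (\<integral>l. u l * cos (real k * l) \<partial>circle))"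
  define a where "a = (\<lambda>k. complex_of_real (c k))"
  have a: "summable (\<lambda>k. cmod (a k))"
  proof (rule summable_comparison_test'[where N = 1])
    show "summable (\<lambda>k. C / (2 * pi) * inverse ((real k)\<^sup>2))"
      by (intro summable_mult inverse_power_summable) simp
    fix k :: nat assume "k \<ge> 1"
    have "norm (cmod (a k)) = \<bar>c k\<bar>" by (simp add: a_def del: norm_mult)
    also have "\<dots> = \<bar>\<integral>l. u l * cos (real k * l) \<partial>circle\<bar> / (2 * pi)"
      using \<open>k \<ge> 1\<close> by (simp add: c_def)
    also have "\<dots> \<le> C / (real k)\<^sup>2 / (2 * pi)"
      by (intro divide_right_mono C \<open>k \<ge> 1\<close>) simp
    finally show "norm (cmod (a k)) \<le> C / (2 * pi) * inverse ((real k)\<^sup>2)"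
      by (simp add: field_simps)
  qed
  have Im: "Im (a k) = 0" for k by (simp add: a_def)
  define v where "v = (\<lambda>l. 2 * Re (pseries a (cis (-l))))"
  have cp: "continuous_on {-pi..pi} (\<lambda>l. pseries a (cis (-l)))"
    by (rule continuous_on_compose2[OF continuous_on_pseries[OF a]]) (auto intro!: continuous_intros)
  have cv: "continuous_on {-pi..pi} v"
    unfolding v_def by (intro continuous_intros cp)
  have int: "integrable circle (\<lambda>l. g l * cos (real k * l))" if "continuous_on {-pi..pi} g" for g and k :: nat
    unfolding integrable_circle by (intro borel_integrable_atLeastAtMost' continuous_intros that)
  have vk: "(\<integral>l. v l * cos (real k * l) \<partial>circle) = (\<integral>l. u l * cos (real k * l) \<partial>circle)" for k :: nat
  proof -
    have ic: "integrable circle (\<lambda>l. of_real (v l) * cis (- (real k * l)))"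
      unfolding integrable_circle by (intro borel_integrable_atLeastAtMost' continuous_intros cv)
    have "(\<integral>l. v l * cos (real k * l) \<partial>circle) = (\<integral>l. Re (of_real (v l) * cis (- (real k * l))) \<partial>circle)"
      by simp
    also have "\<dots> = Re (\<integral>l. of_real (v l) * cis (- (real k * l)) \<partial>circle)"
      by (rule integral_Re[OF ic])
    also have "(\<integral>l. of_real (v l) * cis (- (real k * l)) \<partial>circle) = of_real (2 * pi) * fourier v k"
      by (simp add: fourier_def)
    also have "fourier v k = (if k = 0 then of_real (2 * Re (a 0)) else cnj (a k))"
      unfolding v_def by (rule fourier_pseries[OF a])
    also have "Re (of_real (2 * pi) * \<dots>) = (\<integral>l. u l * cos (real k * l) \<partial>circle)"
      by (simp add: a_def c_def)
    finally show ?thesis .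
  qed
  have u: "u l = ln ((cmod (incr_kernel 1 1 l))\<^sup>2)" if "l \<in> {-pi..pi}" for l
  proof -
    have "cmod (incr_kernel 1 1 l) = exp (Re (H (of_real l)))"
      unfolding diff_quot_of_real[symmetric] eH[OF inball[OF that], symmetric] by simp
    then show ?thesis by (simp add: u_def flip: exp_of_nat_mult)
  qed
  have "u l - v l = 0" if l: "l \<in> {-pi..pi}" for l
  proof (rule Fourier_coeffs_determine_even[OF _ _ _ l, where D = "\<lambda>l. u l - v l"])
    show "continuous_on {-pi..pi} (\<lambda>l. u l - v l)" by (intro continuous_intros cu cv)
    show "u (- l) - v (- l) = u l - v l" if l: "l \<in> {-pi..pi}" for l
    proof -
      have "u (-l) = u l"
        using l by (subst (1 2) u) (auto simp: incr_kernel_1_cnj[unfolded One_nat_def])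
      moreover have "pseries a (cis l) = cnj (pseries a (cis (-l)))"
        using pseries_cnj[OF a, of "cis l"] by (simp add: a_def cis_cnj)
      ultimately show ?thesis by (simp add: v_def)
    qed
    show "(\<integral>l. (u l - v l) * cos (real k * l) \<partial>circle) = 0" for k :: nat
      unfolding left_diff_distrib by (subst Bochner_Integration.integral_diff[OF int[OF cu] int[OF cv]]) (simp add: vk)
  qed
  then have "2 * Re (pseries a (cis (-l))) = ln ((cmod (incr_kernel 1 1 l))\<^sup>2)" if "l \<in> {-pi..pi}" for l
    using u[OF that] that by (simp add: v_def)
  with a Im show thesis by (rule that)
qed

text \<open>The step enters only through a polynomial in \<open>cis (-l)\<close>; everything else is the
  power of one kernel.\<close>
lemma incr_kernel_factor:
  assumes "\<mu> > 0"
  shows "incr_kernel n (int \<mu>) l = ((\<Sum>i<\<mu>. cis (-l) ^ i) * incr_kernel 1 1 l) ^ n"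
proof (cases "l = 0")
  case True
  then show ?thesis by (simp add: incr_kernel_def)
next
  case False
  have "1 - cis (- (of_int (int \<mu>) * l)) = 1 - cis (-l) ^ \<mu>"
    by (simp add: Complex.DeMoivre)
  also have "\<dots> = (1 - cis (-l)) * (\<Sum>i<\<mu>. cis (-l) ^ i)"
    by (rule one_diff_power_eq)
  finally show ?thesis
    using False by (simp add: incr_kernel_def power_mult_distrib power_divide mult.commute)
qed

text \<open>The Schwarz integral is additive in the logarithm of the modulus, so the outer
  function is a product: a quotient of the polynomials \<open>1 - z ^ \<mu>\<close> and \<open>1 - z\<close>, and an
  exponential of the power series of the smooth part.\<close>
lemma w_mu_factor:
  assumes a: "summable (\<lambda>k. cmod (a k))" and Im: "\<And>k. Im (a k) = 0"
    and log: "\<And>l. l \<in> {-pi..pi} \<Longrightarrow> 2 * Re (pseries a (cis (-l))) = ln ((cmod (incr_kernel 1 1 l))\<^sup>2)"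
    and \<mu>: "\<mu> > 0" and z: "cmod z < 1"
  shows "w_mu n \<mu> z = ((\<Sum>i<\<mu>. z ^ i) * exp (pseries a z)) ^ n"
proof -
  let ?v = "\<lambda>l. 2 * Re (pseries a (cis (-l)))"
  have one: "0 < (1::nat)" by simp
  note v = schwarz_pseries[OF a Im z]
  have real: "(\<lambda>k. cnj (a k)) = a" using Im by (intro ext) (simp add: complex_eq_iff)
  let ?L = "\<lambda>l. ln (cmod (1 - cis (- (l * real \<mu>))) ^ (2 * n) / l ^ (2 * n))"
  let ?u = "\<lambda>l. real n * (?v l + log_dist \<mu> l + (-1) * log_dist 1 l)"
  \<comment> \<open>The factor \<open>l ^ (2 * n)\<close> is traded for the smooth function \<open>incr_kernel 1 1\<close>, at the
    cost of \<open>log_dist 1\<close>.\<close>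
  have eq: "?L l = ?u l"
    if l: "l \<in> {-pi..<pi}" "l \<notin> {0} \<union> {l. cis (- (real \<mu> * l)) = 1} \<union> {l. cis (- (real 1 * l)) = 1}" for l
  proof -
    have l0: "l \<noteq> 0" and c: "cis (- (real \<mu> * l)) \<noteq> 1" "cis (-l) \<noteq> 1" using l by auto
    let ?A = "(cmod (1 - cis (- (real \<mu> * l))))\<^sup>2" and ?B = "(cmod (1 - cis (-l)))\<^sup>2"
    have A: "?A > 0" and B: "?B > 0" and L: "l\<^sup>2 > 0" using c l0 by simp_all
    have "?v l = ln ((cmod (incr_kernel 1 1 l))\<^sup>2)" using l by (intro log) auto
    also have "(cmod (incr_kernel 1 1 l))\<^sup>2 = ?B / l\<^sup>2"
      using l0 by (simp add: incr_kernel_def norm_divide norm_mult power_divide)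
    also have "ln \<dots> = ln ?B - ln (l\<^sup>2)" using B L by (rule ln_divide_pos)
    finally have "?u l = real n * (ln ?A - ln (l\<^sup>2))"
      by (simp add: log_dist_def)
    also have "\<dots> = real n * ln (?A / l\<^sup>2)" using ln_divide_pos[OF A L] by simp
    also have "\<dots> = ln ((?A / l\<^sup>2) ^ n)" using A L by (subst ln_realpow) simp_all
    also have "(?A / l\<^sup>2) ^ n = cmod (1 - cis (- (l * real \<mu>))) ^ (2 * n) / l ^ (2 * n)"
      by (simp add: power_divide power_mult mult.commute[of l])
    finally show ?thesis by (rule sym)
  qed
  have "(LINT l:{-pi..pi}|lborel. (cis l + z) / (cis l - z) * of_real (?L l)) =
      (\<integral>l. (cis l + z) / (cis l - z) * of_real (?L l) \<partial>circle)"
    by (rule integral_circle[symmetric])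
  also have "\<dots> = (\<integral>l. (cis l + z) / (cis l - z) * of_real (?u l) \<partial>circle)"
  proof (rule integral_discrete_difference[where X = "{-pi..<pi} \<inter> ({0} \<union> {l. cis (- (real \<mu> * l)) = 1} \<union> {l. cis (- (real 1 * l)) = 1})"])
    show "countable ({-pi..<pi} \<inter> ({0} \<union> {l. cis (- (real \<mu> * l)) = 1} \<union> {l. cis (- (real 1 * l)) = 1}))"
      by (rule countable_Int2, intro countable_Un countable_cis_eq_1 \<mu>) simp_all
    fix l
    show "emeasure circle {l} = 0" if "l \<in> {-pi..<pi} \<inter> ({0} \<union> {l. cis (- (real \<mu> * l)) = 1} \<union> {l. cis (- (real 1 * l)) = 1})"
      using that by (subst emeasure_circle) auto
    show "{l} \<in> sets circle" if "l \<in> {-pi..<pi} \<inter> ({0} \<union> {l. cis (- (real \<mu> * l)) = 1} \<union> {l. cis (- (real 1 * l)) = 1})"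
      using that unfolding sets_circle by (subst sets_restrict_space_iff) auto
    show "(cis l + z) / (cis l - z) * of_real (?L l) = (cis l + z) / (cis l - z) * of_real (?u l)"
      if "l \<in> space circle" "l \<notin> {-pi..<pi} \<inter> ({0} \<union> {l. cis (- (real \<mu> * l)) = 1} \<union> {l. cis (- (real 1 * l)) = 1})"
    proof -
      have "?L l = ?u l" by (rule eq) (use that in auto)
      then show ?thesis by (simp only:)
    qed
  qed
  finally have "w_mu n \<mu> z = exp (schwarz ?u z)"
    unfolding w_mu_def schwarz_def by (simp only:)
  also have "schwarz ?u z = of_nat n * (schwarz ?v z + schwarz (log_dist \<mu>) z + (-1) * schwarz (log_dist 1) z)"
  proof -
    note i = v(2) schwarz_log_dist(1)[OF \<mu>] schwarz_log_dist(1)[OF one]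
    show ?thesis
      by (simp only: schwarz_cmult schwarz_add[OF Bochner_Integration.integrable_add[OF i(1,2)] integrable_mult_right[OF i(3)] z]
          schwarz_add[OF i(1,2) z] of_real_of_nat_eq of_real_minus of_real_1)
  qed
  also have "schwarz ?v z = pseries a z" using v(1) by (simp only: real)
  also have "exp (of_nat n * (pseries a z + schwarz (log_dist \<mu>) z + (-1) * schwarz (log_dist 1) z)) =
      (exp (pseries a z) * exp (schwarz (log_dist \<mu>) z) / exp (schwarz (log_dist 1) z)) ^ n"
    unfolding exp_of_nat_mult by (simp add: exp_add exp_diff)
  also have "exp (schwarz (log_dist \<mu>) z) = 1 - z ^ \<mu>" by (rule schwarz_log_dist(2)[OF \<mu> z])
  also have "exp (schwarz (log_dist 1) z) = 1 - z" using schwarz_log_dist(2)[OF one z] by (simp only: power_one_right)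
  also have "1 - z ^ \<mu> = (1 - z) * (\<Sum>i<\<mu>. z ^ i)" by (rule one_diff_power_eq)
  also have "exp (pseries a z) * ((1 - z) * (\<Sum>i<\<mu>. z ^ i)) / (1 - z) = (\<Sum>i<\<mu>. z ^ i) * exp (pseries a z)"
  proof -
    have "1 - z \<noteq> 0" using z by auto
    then show ?thesis by simp
  qed
  finally show ?thesis .
qed

lemma phi_mu_has_abs_pseries:
  assumes a: "summable (\<lambda>k. cmod (a k))" and Im: "\<And>k. Im (a k) = 0"
    and log: "\<And>l. l \<in> {-pi..pi} \<Longrightarrow> 2 * Re (pseries a (cis (-l))) = ln ((cmod (incr_kernel 1 1 l))\<^sup>2)"
    and \<mu>: "\<mu> > 0" and \<phi>: "summable (\<lambda>k. cmod (\<phi> k))"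
  shows "has_abs_pseries (phi_mu n \<phi> \<mu>) (\<lambda>z. ((\<Sum>i<\<mu>. z ^ i) * exp (pseries a z)) ^ n * pseries \<phi> z)"
proof -
  have "has_abs_pseries a (pseries a)" and p: "has_abs_pseries \<phi> (pseries \<phi>)"
    using a \<phi> by (simp_all add: has_abs_pseries_def)
  then obtain e where e: "has_abs_pseries e (\<lambda>z. exp (pseries a z))"
    using has_abs_pseries_exp by blast
  have "has_abs_pseries (\<lambda>k. if k < \<mu> then 1 else 0) (\<lambda>z. \<Sum>i<\<mu>. 1 * z ^ i)"
    by (rule has_abs_pseries_finite)
  then have "has_abs_pseries (\<lambda>k. if k < \<mu> then 1 else 0) (\<lambda>z. \<Sum>i<\<mu>. z ^ i)"
    by (simp only: mult_1)
  from has_abs_pseries_power[OF has_abs_pseries_mult[OF this e]]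
  obtain d where d: "has_abs_pseries d (\<lambda>z. ((\<Sum>i<\<mu>. z ^ i) * exp (pseries a z)) ^ n)" by blast
  from has_abs_pseries_mult[OF d p]
  obtain c where c: "has_abs_pseries c (\<lambda>z. ((\<Sum>i<\<mu>. z ^ i) * exp (pseries a z)) ^ n * pseries \<phi> z)" by blast
  have "phi_mu n \<phi> \<mu> k = c k" for k
  proof -
    have "fps_expansion (\<lambda>z. w_mu n \<mu> z * pseries \<phi> z) 0 = Abs_fps c"
    proof (rule has_abs_pseries_fps_expansion[OF c])
      show "w_mu n \<mu> z * pseries \<phi> z = ((\<Sum>i<\<mu>. z ^ i) * exp (pseries a z)) ^ n * pseries \<phi> z" if "cmod z < 1" for z
        by (simp only: w_mu_factor[OF a Im log \<mu> that])
    qed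
    then show ?thesis by (simp add: phi_mu_def)
  qed
  then have "phi_mu n \<phi> \<mu> = c" by (rule ext)
  with c show ?thesis by simp
qed

section \<open>The spectral measure\<close>

lemma sets_half_open_generated:
  fixes a b :: real
  assumes "a \<le> b"
  shows "sets (restrict_space borel {a..<b}) = sigma_sets {a..<b} ((\<lambda>x. {a..<x}) ` {a..b})"
proof -
  have "sets (restrict_space borel {a..<b}) = (\<inter>) {a..<b} ` sets (sigma UNIV (range (lessThan :: real \<Rightarrow> real set)))"
    by (simp only: sets_restrict_space borel_Iio)
  also have "\<dots> = (\<inter>) {a..<b} ` sigma_sets UNIV (range lessThan)"
    by simp
  also have "\<dots> = sigma_sets {a..<b} ((\<inter>) {a..<b} ` range lessThan)"
  proof (rule sigma_sets_Int)
    have "{a..<b} \<in> sets (sigma UNIV (range (lessThan :: real \<Rightarrow> real set)))"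
      by (simp only: borel_Iio[symmetric]) simp
    then show "{a..<b} \<in> sigma_sets UNIV (range lessThan)" by simp
  qed simp
  also have "(\<inter>) {a..<b} ` range lessThan = (\<lambda>x. {a..<x}) ` {a..b}"
  proof (intro equalityI subsetI)
    fix X assume "X \<in> (\<inter>) {a..<b} ` range lessThan"
    then obtain x where "X = {a..<b} \<inter> {..<x}" by blast
    then have "X = {a..<max a (min x b)}" by auto
    then show "X \<in> (\<lambda>x. {a..<x}) ` {a..b}" using assms by (intro image_eqI) auto
  next
    fix X assume "X \<in> (\<lambda>x. {a..<x}) ` {a..b}"
    then obtain x where "x \<in> {a..b}" "X = {a..<x}" by blast
    then have "X = {a..<b} \<inter> {..<x}" by auto
    then show "X \<in> (\<inter>) {a..<b} ` range lessThan" by blast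
  qed
  finally show ?thesis by simp
qed

text \<open>The intervals on which the two measures agree are stable under intersection and
  generate the sigma-algebra.\<close>
lemma spectral_measure_unique:
  assumes "sets M = sets (restrict_space borel {-pi..<pi})" "sets N = sets (restrict_space borel {-pi..<pi})"
    and M: "\<And>x. x \<in> {-pi..pi} \<Longrightarrow> emeasure M {-pi..<x} = ennreal (F x)"
    and N: "\<And>x. x \<in> {-pi..pi} \<Longrightarrow> emeasure N {-pi..<x} = ennreal (F x)"
  shows "M = N"
proof (rule measure_eqI_generator_eq[where A = "\<lambda>_. {-pi..<pi}"])
  have le: "- pi \<le> pi" using pi_gt_zero by linarith
  note gen = sets_half_open_generated[OF le]
  show "Int_stable ((\<lambda>x. {-pi..<x}) ` {-pi..pi})"
  proof (rule Int_stableI)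
    fix X Y assume "X \<in> (\<lambda>x. {-pi..<x}) ` {-pi..pi}" "Y \<in> (\<lambda>x. {-pi..<x}) ` {-pi..pi}"
    then obtain x y where "x \<in> {-pi..pi}" "X = {-pi..<x}" "y \<in> {-pi..pi}" "Y = {-pi..<y}" by blast
    then show "X \<inter> Y \<in> (\<lambda>x. {-pi..<x}) ` {-pi..pi}"
      by (intro image_eqI[where x = "min x y"]) auto
  qed
  show "sets M = sigma_sets {-pi..<pi} ((\<lambda>x. {-pi..<x}) ` {-pi..pi})"
    "sets N = sigma_sets {-pi..<pi} ((\<lambda>x. {-pi..<x}) ` {-pi..pi})"
    using assms(1,2) gen by simp_all
  show "emeasure M X = emeasure N X" if "X \<in> (\<lambda>x. {-pi..<x}) ` {-pi..pi}" for X
    using that M N by auto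
  show "range (\<lambda>_::nat. {-pi..<pi}) \<subseteq> (\<lambda>x. {-pi..<x}) ` {-pi..pi}"
    using le by auto
  show "emeasure M {-pi..<pi} \<noteq> \<infinity>"
    using M[of pi] le by simp
qed auto

lemma spectral_measure_density:
  assumes dens: "has_spectral_density F f" and can: "canonical_factorization f \<phi>"
  shows "spectral_measure F = density circle (\<lambda>l. ennreal ((cmod (pseries \<phi> (cis (-l))))\<^sup>2 / (2 * pi)))"
      (is "_ = ?N")
    and "x \<in> {-pi..pi} \<Longrightarrow> emeasure (spectral_measure F) {-pi..<x} = ennreal (F x)"
proof -
  define g where "g = (\<lambda>l. (cmod (pseries \<phi> (cis (-l))))\<^sup>2 / (2 * pi))"
  have "conv_radius \<phi> > 1" using can by (simp add: canonical_factorization_def)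
  then have \<phi>: "summable (\<lambda>k. cmod (\<phi> k))" by (rule abs_coeffs_conv_radius_gt_1)
  have "continuous_on UNIV (\<lambda>l. pseries \<phi> (cis (-l)))"
    by (rule continuous_on_compose2[OF continuous_on_pseries[OF \<phi>]]) (auto intro!: continuous_intros)
  then have cg: "continuous_on UNIV g"
    unfolding g_def by (intro continuous_intros) auto
  have gm: "g \<in> borel_measurable borel" by (rule borel_measurable_continuous_onI[OF cg])
  have g0: "g l \<ge> 0" for l by (simp add: g_def)
  have fint: "set_integrable lborel {-pi..pi} f" and F: "\<And>x. x \<in> {-pi..pi} \<Longrightarrow> F x = 1 / (2 * pi) * (LINT l:{-pi..x}|lborel. f l)"
    using dens by (auto simp: has_spectral_density_def)
  have fg: "AE l in lborel. l \<in> {-pi..pi} \<longrightarrow> f l = 2 * pi * g l"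
    using can by (simp add: canonical_factorization_def g_def)
  have N_eq: "?N = density circle (\<lambda>l. ennreal (g l))" by (simp only: g_def)
  have N: "sets ?N = sets (restrict_space borel {-pi..<pi})"
    by (simp add: sets_circle)
  have em: "emeasure ?N {-pi..<x} = ennreal (F x)" if x: "x \<in> {-pi..pi}" for x
  proof -
    have sx: "{-pi..<x} \<in> sets circle"
      unfolding sets_circle using x by (subst sets_restrict_space_iff) auto
    have ind: "(indicator {-pi..<x} :: real \<Rightarrow> real) \<in> borel_measurable borel" by simp
    have gi: "integrable circle (\<lambda>l. g l * indicator {-pi..<x} l)"
    proof -
      have "integrable circle g"
        unfolding integrable_circle by (rule borel_integrable_atLeastAtMost'[OF continuous_on_subset[OF cg]]) simp
      then show ?thesis by (rule integrable_real_mult_indicator[OF sx])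
    qed
    have "emeasure ?N {-pi..<x} = (\<integral>\<^sup>+l. ennreal (g l) * indicator {-pi..<x} l \<partial>circle)"
      unfolding N_eq by (rule emeasure_density) (use sx measurable_circle[OF gm] in auto)
    also have "\<dots> = (\<integral>\<^sup>+l. ennreal (g l * indicator {-pi..<x} l) \<partial>circle)"
      by (intro nn_integral_cong) (auto simp: indicator_def)
    also have "\<dots> = ennreal (\<integral>l. g l * indicator {-pi..<x} l \<partial>circle)"
      by (rule nn_integral_eq_integral[OF gi]) (auto simp: g0)
    also have "(\<integral>l. g l * indicator {-pi..<x} l \<partial>circle) = F x"
    proof -
      have fx: "set_integrable lborel {-pi..x} f"
        by (rule set_integrable_subset[OF fint]) (use x in auto)
      have "(\<integral>l. g l * indicator {-pi..<x} l \<partial>circle) = (\<integral>l. indicator {-pi..pi} l *\<^sub>R (g l * indicator {-pi..<x} l) \<partial>lborel)"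
        by (simp add: integral_circle set_lebesgue_integral_def)
      also have "\<dots> = (\<integral>l. 1 / (2 * pi) * (indicator {-pi..x} l *\<^sub>R f l) \<partial>lborel)"
      proof (rule integral_cong_AE)
        show "(\<lambda>l. indicator {-pi..pi} l *\<^sub>R (g l * indicator {-pi..<x} l)) \<in> borel_measurable lborel"
          using gm by simp
        show "(\<lambda>l. 1 / (2 * pi) * (indicator {-pi..x} l *\<^sub>R f l)) \<in> borel_measurable lborel"
          using borel_measurable_integrable[OF fx[unfolded set_integrable_def]] by simp
        show "AE l in lborel. indicator {-pi..pi} l *\<^sub>R (g l * indicator {-pi..<x} l) = 1 / (2 * pi) * (indicator {-pi..x} l *\<^sub>R f l)"
          using fg AE_lborel_singleton[of x]
          by eventually_elim (use x in \<open>auto simp: indicator_def\<close>)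
      qed
      also have "\<dots> = F x"
        by (simp add: F[OF x] set_lebesgue_integral_def)
      finally show ?thesis .
    qed
    finally show ?thesis .
  qed
  show thesis1: "spectral_measure F = ?N"
    unfolding spectral_measure_def
  proof (rule the_equality)
    show "sets ?N = sets (restrict_space borel {-pi..<pi}) \<and> (\<forall>x\<in>{-pi..pi}. emeasure ?N {-pi..<x} = ennreal (F x))"
      using N em by blast
    fix M assume M: "sets M = sets (restrict_space borel {-pi..<pi}) \<and> (\<forall>x\<in>{-pi..pi}. emeasure M {-pi..<x} = ennreal (F x))"
    show "M = ?N"
      by (rule spectral_measure_unique[where F = F]) (use M N em in auto)
  qed
  show "emeasure (spectral_measure F) {-pi..<x} = ennreal (F x)" if "x \<in> {-pi..pi}"
    unfolding thesis1 by (rule em[OF that])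
qed

section \<open>The functional as a combination of increments\<close>

text \<open>The entries of \<open>b_vec\<close>, extended by zero beyond \<open>N\<close> so that sums over both indices
  need no case distinctions.\<close>
definition b_coeff :: "nat \<Rightarrow> nat \<Rightarrow> nat \<Rightarrow> (nat \<Rightarrow> complex) \<Rightarrow> nat \<Rightarrow> complex" where
  "b_coeff n \<mu> N a k = (\<Sum>i\<le>N. d_coeff n \<mu> i * (if k + i \<le> N then a (k + i) else 0))"

lemma b_coeff_eq_0: "k > N \<Longrightarrow> b_coeff n \<mu> N a k = 0"
  by (auto simp: b_coeff_def intro!: sum.neutral)

lemma index_b_vec:
  assumes "k \<le> N"
  shows "vec_index (b_vec n \<mu> N a) k = b_coeff n \<mu> N a k"
proof -
  have "vec_index (b_vec n \<mu> N a) k = (\<Sum>j<Suc N. (if k \<le> j then d_coeff n \<mu> (j - k) else 0) * a j)"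
    using assms by (simp add: b_vec_def D_mat_def scalar_prod_def lessThan_atLeast0 del: sum.op_ivl_Suc sum.lessThan_Suc)
  also have "\<dots> = (\<Sum>j\<in>{k..N}. d_coeff n \<mu> (j - k) * a j)"
    by (rule sum.mono_neutral_cong_right) auto
  also have "\<dots> = (\<Sum>i\<in>{..N-k}. d_coeff n \<mu> i * a (k + i))"
    by (rule sum.reindex_bij_witness[of _ "\<lambda>i. k + i" "\<lambda>j. j - k"]) (use assms in auto)
  also have "\<dots> = b_coeff n \<mu> N a k"
    unfolding b_coeff_def by (rule sum.mono_neutral_cong_left) (use assms in auto)
  finally show ?thesis .
qed

lemma dim_b_vec [simp]: "dim_vec (b_vec n \<mu> N a) = Suc N"
  by (simp add: b_vec_def D_mat_def)

lemma dim_r_vec [simp]: "dim_vec (r_vec n \<phi> \<mu> N a) = Suc N"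
  by (simp add: r_vec_def D_mat_def)

text \<open>Row \<open>m\<close> is the coefficient of \<open>cis (m * l)\<close> in the product of the polynomial with
  coefficients \<open>b_vec\<close> in \<open>cis l\<close> and the series with coefficients \<open>phi_mu\<close> in
  \<open>cis (-l)\<close>.\<close>
lemma index_r_vec:
  assumes m: "m \<le> N"
  shows "vec_index (r_vec n \<phi> \<mu> N a) m = (\<Sum>j\<le>N. phi_mu n \<phi> \<mu> j * b_coeff n \<mu> N a (m + j))"
proof -
  define p where "p = phi_mu n \<phi> \<mu>"
  define c where "c = (\<lambda>k. \<Sum>j\<le>N. (if k + j \<le> N then a (k + j) else 0) * p j)"
  have c: "vec_index (A_mat N a *\<^sub>v Matrix.vec (N + 1) p) k = c k" if "k \<le> N" for k
    using that by (simp add: A_mat_def scalar_prod_def c_def atLeast0LessThan lessThan_Suc_atMost)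
  have "vec_index (r_vec n \<phi> \<mu> N a) m = (\<Sum>k<Suc N. (if m \<le> k then d_coeff n \<mu> (k - m) else 0) * c k)"
    using m by (simp add: r_vec_def D_mat_def scalar_prod_def lessThan_atLeast0 p_def[symmetric] A_mat_def c_def del: sum.op_ivl_Suc sum.lessThan_Suc)
       (auto intro!: sum.cong simp: atLeast0LessThan lessThan_Suc_atMost)
  also have "\<dots> = (\<Sum>k\<in>{m..N}. d_coeff n \<mu> (k - m) * c k)"
    by (rule sum.mono_neutral_cong_right) auto
  also have "\<dots> = (\<Sum>i\<in>{..N-m}. d_coeff n \<mu> i * c (m + i))"
    by (rule sum.reindex_bij_witness[of _ "\<lambda>i. m + i" "\<lambda>j. j - m"]) (use m in auto)
  also have "\<dots> = (\<Sum>i\<le>N. d_coeff n \<mu> i * c (m + i))"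
    by (rule sum.mono_neutral_left) (auto simp: c_def intro!: sum.neutral)
  also have "\<dots> = (\<Sum>i\<le>N. \<Sum>j\<le>N. p j * (d_coeff n \<mu> i * (if m + j + i \<le> N then a (m + j + i) else 0)))"
    unfolding c_def sum_distrib_left by (intro sum.cong) (auto simp: add_ac)
  also have "\<dots> = (\<Sum>j\<le>N. p j * b_coeff n \<mu> N a (m + j))"
    unfolding b_coeff_def sum_distrib_left by (rule sum.swap)
  finally show ?thesis by (simp only: p_def)
qed

text \<open>The numbers \<open>d_coeff\<close> are the coefficients of \<open>1 / (1 - x ^ \<mu>) ^ n\<close>, and the
  alternating binomials those of \<open>(1 - x ^ \<mu>) ^ n\<close>.\<close>
lemma d_coeff_inverse:
  assumes "\<mu> > 0"
  shows "(\<Sum>l\<le>n. (-1) ^ l * of_nat (n choose l) * (if l * \<mu> \<le> m then d_coeff n \<mu> (m - l * \<mu>) else 0)) =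
    (if m = 0 then 1 else 0)"
proof -
  let ?D = "Abs_fps (\<lambda>i. if \<mu> dvd i then 1 else 0) :: complex fps"
  have "(1 - fps_X ^ \<mu>) * ?D = 1"
  proof (rule fps_ext)
    fix i
    have "\<mu> dvd i \<longleftrightarrow> \<mu> dvd (i - \<mu>)" if "\<mu> \<le> i"
      using that by (simp add: dvd_minus_self)
    moreover have "\<mu> dvd i \<longleftrightarrow> i = 0" if "i < \<mu>"
      using that by (auto dest: dvd_imp_le)
    ultimately show "fps_nth ((1 - fps_X ^ \<mu>) * ?D) i = fps_nth 1 i"
      using assms by (simp add: left_diff_distrib fps_X_power_mult_nth)
  qed
  then have "((1 - fps_X ^ \<mu>) * ?D) ^ n = 1" by simp
  then have "(1 - fps_X ^ \<mu>) ^ n * ?D ^ n = 1" by (simp only: power_mult_distrib)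
  moreover have "(1 - fps_X ^ \<mu> :: complex fps) ^ n = (\<Sum>l\<le>n. fps_const ((-1) ^ l * of_nat (n choose l)) * fps_X ^ (l * \<mu>))"
  proof -
    have "(1 - fps_X ^ \<mu> :: complex fps) ^ n = (- (fps_X ^ \<mu>) + 1) ^ n" by simp
    also have "\<dots> = (\<Sum>l\<le>n. of_nat (n choose l) * (- (fps_X ^ \<mu>)) ^ l * 1 ^ (n - l))"
      by (rule binomial_ring)
    also have "\<dots> = (\<Sum>l\<le>n. fps_const ((-1) ^ l * of_nat (n choose l)) * fps_X ^ (l * \<mu>))"
    proof (intro sum.cong refl)
      fix l
      have "(- (fps_X ^ \<mu> :: complex fps)) ^ l = (-1) ^ l * fps_X ^ (l * \<mu>)"
        by (simp add: power_minus[of "fps_X ^ \<mu>"] mult.commute[of l] power_mult)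
      moreover have "fps_const ((-1) ^ l * of_nat (n choose l) :: complex) = (-1) ^ l * of_nat (n choose l)"
        by (simp add: fps_of_nat flip: fps_const_mult fps_const_power fps_const_neg)
      ultimately show "of_nat (n choose l) * (- (fps_X ^ \<mu>)) ^ l * 1 ^ (n - l) =
          fps_const ((-1) ^ l * of_nat (n choose l) :: complex) * fps_X ^ (l * \<mu>)"
        by (simp only: power_one mult_1_right) (simp only: mult_ac)
    qed
    finally show ?thesis .
  qed
  ultimately have "(\<Sum>l\<le>n. fps_const ((-1) ^ l * of_nat (n choose l)) * (fps_X ^ (l * \<mu>) * ?D ^ n)) = 1"
    by (simp add: sum_distrib_right mult.assoc)
  then have "fps_nth (\<Sum>l\<le>n. fps_const ((-1) ^ l * of_nat (n choose l)) * (fps_X ^ (l * \<mu>) * ?D ^ n)) m = fps_nth 1 m"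
    by (simp only:)
  then have "(\<Sum>l\<le>n. (-1) ^ l * of_nat (n choose l) * (if m < l * \<mu> then 0 else d_coeff n \<mu> (m - l * \<mu>))) = (if m = 0 then 1 else 0)"
    by (simp only: fps_sum_nth fps_mult_left_const_nth fps_X_power_mult_nth d_coeff_def fps_one_nth)
  also have "(\<Sum>l\<le>n. (-1) ^ l * of_nat (n choose l) * (if m < l * \<mu> then 0 else d_coeff n \<mu> (m - l * \<mu>))) =
      (\<Sum>l\<le>n. (-1) ^ l * of_nat (n choose l) * (if l * \<mu> \<le> m then d_coeff n \<mu> (m - l * \<mu>) else 0))"
    by (intro sum.cong) auto
  finally show ?thesis .
qed

text \<open>The \<open>n\<close>th difference with step \<open>\<mu>\<close> undoes the summation by which \<open>b_vec\<close> was formed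
  from \<open>a\<close>.\<close>
lemma b_coeff_differences:
  assumes \<mu>: "\<mu> > 0" and p: "p \<le> N"
  shows "(\<Sum>l\<le>n. (-1) ^ l * of_nat (n choose l) * b_coeff n \<mu> N a (p + l * \<mu>)) = a p"
proof -
  let ?s = "\<lambda>l. (-1) ^ l * of_nat (n choose l) :: complex"
  have b: "b_coeff n \<mu> N a (p + q) = (\<Sum>m\<le>N-p. (if q \<le> m then d_coeff n \<mu> (m - q) else 0) * a (p + m))" for q
  proof (cases "p + q \<le> N")
    case True
    have "b_coeff n \<mu> N a (p + q) = (\<Sum>i\<le>N-p-q. d_coeff n \<mu> i * a (p + q + i))"
      unfolding b_coeff_def by (rule sum.mono_neutral_cong_right) (use True in auto)
    also have "\<dots> = (\<Sum>m\<in>{q..N-p}. d_coeff n \<mu> (m - q) * a (p + m))"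
      by (rule sum.reindex_bij_witness[of _ "\<lambda>j. j - q" "\<lambda>i. q + i"]) (use True in \<open>auto simp: add_ac\<close>)
    also have "\<dots> = (\<Sum>m\<le>N-p. (if q \<le> m then d_coeff n \<mu> (m - q) else 0) * a (p + m))"
      by (rule sum.mono_neutral_cong_left) auto
    finally show ?thesis .
  next
    case False
    then have "b_coeff n \<mu> N a (p + q) = 0" by (intro b_coeff_eq_0) simp
    moreover have "(\<Sum>m\<le>N-p. (if q \<le> m then d_coeff n \<mu> (m - q) else 0) * a (p + m)) = 0"
    proof (rule sum.neutral, rule ballI)
      fix m assume "m \<in> {..N - p}"
      then have "\<not> q \<le> m" using False p by auto
      then show "(if q \<le> m then d_coeff n \<mu> (m - q) else 0) * a (p + m) = 0" by simp
    qed
    ultimately show ?thesis by simp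
  qed
  have "(\<Sum>l\<le>n. ?s l * b_coeff n \<mu> N a (p + l * \<mu>)) =
      (\<Sum>m\<le>N-p. (\<Sum>l\<le>n. ?s l * (if l * \<mu> \<le> m then d_coeff n \<mu> (m - l * \<mu>) else 0)) * a (p + m))"
    unfolding b sum_distrib_left sum_distrib_right mult.assoc by (rule sum.swap)
  also have "\<dots> = (\<Sum>m\<le>N-p. (if m = 0 then 1 else 0) * a (p + m))"
    by (simp only: d_coeff_inverse[OF \<mu>])
  also have "\<dots> = (\<Sum>m\<in>{0}. a (p + m))"
    by (rule sum.mono_neutral_cong_right) auto
  finally show ?thesis by simp
qed

text \<open>In the sum of increments, the coefficient of \<open>\<xi> p\<close> is \<open>a p\<close> for \<open>p \<ge> 0\<close> by
  \<open>b_coeff_differences\<close>, and for \<open>p < 0\<close> it is \<open>v_coeff\<close> by definition.\<close>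
lemma functional_eq_increments:
  assumes \<mu>: "\<mu> > 0"
  shows "A_functional N a \<xi> \<omega> + V_functional n \<mu> N a \<xi> \<omega> =
    (\<Sum>k\<le>N. b_coeff n \<mu> N a k * increment n \<xi> (int k) (int \<mu>) \<omega>)"
proof -
  let ?s = "\<lambda>l. (-1) ^ l * of_nat (n choose l) :: complex"
  \<comment> \<open>\<open>\<beta>\<close> extends the coefficients by zero, and \<open>w p\<close> is then the coefficient of \<open>\<xi> p\<close> in
    the sum of increments.\<close>
  define \<beta> where "\<beta> = (\<lambda>k::int. if 0 \<le> k \<and> k \<le> int N then b_coeff n \<mu> N a (nat k) else 0)"
  define w where "w = (\<lambda>p. \<Sum>l\<le>n. ?s l * \<beta> (p + int l * int \<mu>))"
  have "(\<Sum>k\<le>N. b_coeff n \<mu> N a k * increment n \<xi> (int k) (int \<mu>) \<omega>) =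
      (\<Sum>l\<le>n. ?s l * (\<Sum>k\<le>N. b_coeff n \<mu> N a k * \<xi> (int k - int l * int \<mu>) \<omega>))"
    unfolding increment_def sum_distrib_left by (subst sum.swap) (simp add: mult_ac)
  also have "\<dots> = (\<Sum>l\<le>n. ?s l * (\<Sum>p\<in>{- int (\<mu> * n)..int N}. \<beta> (p + int l * int \<mu>) * \<xi> p \<omega>))"
  proof (intro sum.cong refl arg_cong2[where f = "(*)"])
    fix l assume l: "l \<in> {..n}"
    have lm: "int l * int \<mu> \<le> int (\<mu> * n)"
      using l by (simp add: mult.commute mult_left_mono)
    have "(\<Sum>k\<le>N. b_coeff n \<mu> N a k * \<xi> (int k - int l * int \<mu>) \<omega>) =
        (\<Sum>p\<in>{- (int l * int \<mu>)..int N - int l * int \<mu>}. \<beta> (p + int l * int \<mu>) * \<xi> p \<omega>)"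
      by (rule sum.reindex_bij_witness[of _ "\<lambda>p. nat (p + int l * int \<mu>)" "\<lambda>k. int k - int l * int \<mu>"])
         (auto simp: \<beta>_def)
    also have "\<dots> = (\<Sum>p\<in>{- int (\<mu> * n)..int N}. \<beta> (p + int l * int \<mu>) * \<xi> p \<omega>)"
    proof (rule sum.mono_neutral_left)
      have "0 \<le> int l * int \<mu>" by simp
      then show "{- (int l * int \<mu>)..int N - int l * int \<mu>} \<subseteq> {- int (\<mu> * n)..int N}"
        using lm unfolding atLeastatMost_subset_iff by linarith
      show "\<forall>i\<in>{- int (\<mu> * n)..int N} - {- (int l * int \<mu>)..int N - int l * int \<mu>}. \<beta> (i + int l * int \<mu>) * \<xi> i \<omega> = 0"
        by (auto simp: \<beta>_def)
    qed simp
    finally show "(\<Sum>k\<le>N. b_coeff n \<mu> N a k * \<xi> (int k - int l * int \<mu>) \<omega>) = (\<Sum>p\<in>{- int (\<mu> * n)..int N}. \<beta> (p + int l * int \<mu>) * \<xi> p \<omega>)" .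
  qed
  also have "\<dots> = (\<Sum>p\<in>{- int (\<mu> * n)..int N}. w p * \<xi> p \<omega>)"
    unfolding w_def sum_distrib_left sum_distrib_right mult.assoc by (rule sum.swap)
  also have "\<dots> = (\<Sum>p\<in>{0..int N}. w p * \<xi> p \<omega>) + (\<Sum>p\<in>{- int (\<mu> * n)..-1}. w p * \<xi> p \<omega>)"
  proof -
    have nn: "- int (\<mu> * n) \<le> 0" by simp
    have "{- int (\<mu> * n)..int N} = {0..int N} \<union> {- int (\<mu> * n)..-1}"
      using nn by (auto simp del: of_nat_mult intro: order_trans[of _ 0])
    then show ?thesis
      by (simp only:) (rule sum.union_disjoint, auto)
  qed
  also have "(\<Sum>p\<in>{0..int N}. w p * \<xi> p \<omega>) = A_functional N a \<xi> \<omega>"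
  proof -
    have "w (int p) = a p" if "p \<le> N" for p
    proof -
      have "\<beta> (int p + int l * int \<mu>) = b_coeff n \<mu> N a (p + l * \<mu>)" for l
      proof -
        have "int p + int l * int \<mu> = int (p + l * \<mu>)" by simp
        then show ?thesis
          unfolding \<beta>_def by (simp only:) (auto simp: b_coeff_eq_0 simp del: of_nat_add of_nat_mult)
      qed
      then show ?thesis using b_coeff_differences[OF \<mu> that] by (simp add: w_def)
    qed
    then show ?thesis
      unfolding A_functional_def
    proof (intro sum.reindex_bij_witness[of _ int nat])
      fix p assume p: "p \<in> {0..int N}"
      then have "w (int (nat p)) = a (nat p)" by (intro \<open>\<And>p. p \<le> N \<Longrightarrow> w (int p) = a p\<close>) auto
      then show "a (nat p) * \<xi> (int (nat p)) \<omega> = w p * \<xi> p \<omega>" using p by simp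
    qed auto
  qed
  also have "(\<Sum>p\<in>{- int (\<mu> * n)..-1}. w p * \<xi> p \<omega>) = V_functional n \<mu> N a \<xi> \<omega>"
    unfolding V_functional_def
  proof (intro sum.cong refl arg_cong2[where f = "(*)"])
    fix p assume p: "p \<in> {- int (\<mu> * n)..-1}"
    let ?I = "{\<lceil>- real_of_int p / real \<mu>\<rceil>..min \<lfloor>(real N - real_of_int p) / real \<mu>\<rfloor> (int n)}"
    have I: "l \<in> ?I \<longleftrightarrow> 0 \<le> p + l * int \<mu> \<and> p + l * int \<mu> \<le> int N \<and> l \<le> int n" for l
    proof -
      have "\<lceil>- real_of_int p / real \<mu>\<rceil> \<le> l \<longleftrightarrow> - real_of_int p \<le> real_of_int l * real \<mu>"
        using \<mu> by (simp only: ceiling_le_iff) (rule pos_divide_le_eq, simp)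
      also have "\<dots> \<longleftrightarrow> real_of_int 0 \<le> real_of_int (p + l * int \<mu>)" by auto
      also have "\<dots> \<longleftrightarrow> 0 \<le> p + l * int \<mu>" by (simp only: of_int_le_iff)
      finally have 1: "\<lceil>- real_of_int p / real \<mu>\<rceil> \<le> l \<longleftrightarrow> 0 \<le> p + l * int \<mu>" .
      have "l \<le> \<lfloor>(real N - real_of_int p) / real \<mu>\<rfloor> \<longleftrightarrow> real_of_int l * real \<mu> \<le> real N - real_of_int p"
        using \<mu> by (simp only: le_floor_iff) (rule pos_le_divide_eq, simp)
      also have "\<dots> \<longleftrightarrow> real_of_int (p + l * int \<mu>) \<le> real_of_int (int N)" by auto
      also have "\<dots> \<longleftrightarrow> p + l * int \<mu> \<le> int N" by (simp only: of_int_le_iff)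
      finally show ?thesis using 1 by auto
    qed
    have nonneg: "l \<ge> 0" if "0 \<le> p + l * int \<mu>" for l
    proof (rule ccontr)
      assume "\<not> l \<ge> 0"
      then have "l * int \<mu> \<le> 0" by (simp add: mult_nonpos_nonneg)
      then show False using that p by simp
    qed
    have "w p = (\<Sum>l\<in>{l. l \<le> n \<and> 0 \<le> p + int l * int \<mu> \<and> p + int l * int \<mu> \<le> int N}. ?s l * b_coeff n \<mu> N a (nat (p + int l * int \<mu>)))"
      unfolding w_def by (rule sum.mono_neutral_cong_right) (auto simp: \<beta>_def)
    also have "\<dots> = (\<Sum>l\<in>?I. (-1) ^ nat l * of_nat (n choose nat l) * vec_index (b_vec n \<mu> N a) (nat (l * int \<mu> + p)))"
      by (rule sum.reindex_bij_witness[of _ nat int])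
         (simp_all only: I mem_Collect_eq of_nat_le_iff nat_int of_nat_0_le_iff simp_thms int_nat_eq nonneg if_True
            index_b_vec[symmetric] nat_le_iff add.commute[of p])
    finally show "w p = v_coeff n \<mu> N a p" by (simp only: v_coeff_def)
  qed
  finally show ?thesis by (rule sym)
qed

section \<open>The innovation representation\<close>

text \<open>Multiplication by \<open>cis (-l)\<close> shifts the family \<open>W\<close> by one step into the past, so
  multiplication by an absolutely convergent power series in \<open>cis (-l)\<close> stays in the
  closed span of the past.\<close>
lemma shift_series:
  fixes W :: "int \<Rightarrow> real \<Rightarrow> complex"
  assumes W: "\<And>m l. W m l = cis (of_int m * l) * w l" and L2: "\<And>m. W m \<in> L2 M"
    and c: "summable (\<lambda>k. cmod (c k))"
  shows "(\<lambda>l. pseries c (cis (-l)) * W m l) \<in> L2 M"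
    and "(\<lambda>K. mse M (\<lambda>l. pseries c (cis (-l)) * W m l) (\<lambda>l. \<Sum>k<K. c k * W (m - int k) l)) \<longlonglongrightarrow> 0"
    and "(\<lambda>l. pseries c (cis (-l)) * W m l) \<in> L2_span M {W k | k. k \<le> m}"
proof -
  have eq: "(\<lambda>l. \<Sum>k. c k * W (m - int k) l) = (\<lambda>l. pseries c (cis (-l)) * W m l)"
  proof
    fix l
    have "(\<lambda>k. c k * cis (-l) ^ k) sums pseries c (cis (-l))"
      by (rule pseries_sums[OF c]) simp
    then have "(\<lambda>k. (c k * cis (-l) ^ k) * W m l) sums (pseries c (cis (-l)) * W m l)"
      by (rule sums_mult2)
    moreover have "(c k * cis (-l) ^ k) * W m l = c k * W (m - int k) l" for k
    proof -
      have "cis (-l) ^ k * cis (of_int m * l) = cis (of_int (m - int k) * l)"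
        by (simp add: Complex.DeMoivre cis_mult left_diff_distrib)
      then show ?thesis by (simp add: W mult.assoc[symmetric])
    qed
    ultimately show "(\<Sum>k. c k * W (m - int k) l) = pseries c (cis (-l)) * W m l"
      by (simp add: sums_iff)
  qed
  have b: "(\<integral>l. (cmod (W (m - int k) l))\<^sup>2 \<partial>M) \<le> (\<integral>l. (cmod (w l))\<^sup>2 \<partial>M)" for k
    by (simp add: W norm_mult)
  note s = L2_abs_series[where X = "\<lambda>k. W (m - int k)", OF L2 b c, unfolded eq]
  show "(\<lambda>l. pseries c (cis (-l)) * W m l) \<in> L2 M" by (rule s(1))
  show "(\<lambda>K. mse M (\<lambda>l. pseries c (cis (-l)) * W m l) (\<lambda>l. \<Sum>k<K. c k * W (m - int k) l)) \<longlonglongrightarrow> 0"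
    by (rule s(2))
  have S: "{W k | k. k \<le> m} \<subseteq> L2 M" using L2 by blast
  show "(\<lambda>l. pseries c (cis (-l)) * W m l) \<in> L2_span M {W k | k. k \<le> m}"
  proof (rule L2_span_limit_seq[OF S s(1) _ s(2)])
    fix K
    have "W (m - int k) \<in> {W k | k. k \<le> m}" for k
      by (intro CollectI exI[of _ "m - int k"] conjI refl) simp
    then show "(\<lambda>l. \<Sum>k<K. c k * W (m - int k) l) \<in> L2_span M {W k | k. k \<le> m}"
      by (intro L2_span_sum[OF S] L2_span_base[OF S])
  qed
qed

text \<open>The hypotheses of the theorem in the form in which they are used, together with the
  power series \<open>g\<close> from \<open>outer_log_series\<close>.\<close>
locale canonical_increments = orth_measure P "spectral_measure F" Z
  for P :: "'a measure" and F :: "real \<Rightarrow> real" and Z :: "real set \<Rightarrow> 'a \<Rightarrow> complex" +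
  fixes \<xi> :: "int \<Rightarrow> 'a \<Rightarrow> complex" and n :: nat and \<phi> g :: "nat \<Rightarrow> complex"
  assumes prob: "prob_space P"
    and mean: "\<And>m \<nu>. (\<integral>\<omega>. increment n \<xi> m \<nu> \<omega> \<partial>P) = 0"
    and rep: "\<And>m \<nu>. \<nu> > 0 \<Longrightarrow> has_stochastic_integral P (spectral_measure F) Z
        (\<lambda>l. cis (of_int m * l) * incr_kernel n \<nu> l) (increment n \<xi> m \<nu>)"
    and density: "spectral_measure F = density circle (\<lambda>l. ennreal ((cmod (pseries \<phi> (cis (-l))))\<^sup>2 / (2 * pi)))"
    and radius: "conv_radius \<phi> > 1"
    and nonzero: "\<And>z. cmod z \<le> 1 \<Longrightarrow> pseries \<phi> z \<noteq> 0"
    and g_summable: "summable (\<lambda>k. cmod (g k))"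
    and g_Im: "\<And>k. Im (g k) = 0"
    and g_log: "\<And>l. l \<in> {-pi..pi} \<Longrightarrow> 2 * Re (pseries g (cis (-l))) = ln ((cmod (incr_kernel 1 1 l))\<^sup>2)"
begin

abbreviation M :: "real measure" where "M \<equiv> spectral_measure F"

definition \<Phi> :: "real \<Rightarrow> complex" where "\<Phi> l = pseries \<phi> (cis (-l))"

text \<open>The phase left over when the kernel is divided by its outer factor.\<close>
definition \<theta> :: "real \<Rightarrow> complex" where
  "\<theta> l = (incr_kernel 1 1 l / exp (pseries g (cis (-l)))) ^ n"

text \<open>Up to the normalization by \<open>2 * pi\<close>, an isometry from \<open>L\<^sub>2\<close> of the circle into
  \<open>L\<^sub>2(dF)\<close>: it divides out the square root \<open>\<Phi>\<close> of the density and attaches the common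
  phase \<open>\<theta>\<close> of the kernels.\<close>
definition T :: "(real \<Rightarrow> complex) \<Rightarrow> real \<Rightarrow> complex" where
  "T u l = u l * \<theta> l / \<Phi> l"

definition e :: "int \<Rightarrow> real \<Rightarrow> complex" where
  "e m = T (\<lambda>l. cis (of_int m * l))"

lemma \<phi>_summable: "summable (\<lambda>k. cmod (\<phi> k))"
  by (rule abs_coeffs_conv_radius_gt_1[OF radius])

lemma \<Phi>_nonzero: "\<Phi> l \<noteq> 0"
  unfolding \<Phi>_def by (rule nonzero) simp

lemma \<theta>_norm:
  assumes "l \<in> {-pi..pi}"
  shows "cmod (\<theta> l) = 1"
proof -
  have "incr_kernel 1 1 l \<noteq> 0"
    unfolding diff_quot_of_real[symmetric]
  proof (rule diff_quot_nonzero)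
    have "\<bar>l\<bar> < 2 * pi" using assms pi_gt_zero unfolding atLeastAtMost_iff by linarith
    then show "cmod (complex_of_real l) < 2 * pi" by simp
  qed
  then have pos: "(cmod (incr_kernel 1 1 l))\<^sup>2 > 0" by simp
  have "(cmod (exp (pseries g (cis (-l)))))\<^sup>2 = exp (2 * Re (pseries g (cis (-l))))"
    by (simp add: power2_eq_square flip: exp_add)
  also have "\<dots> = (cmod (incr_kernel 1 1 l))\<^sup>2"
    unfolding g_log[OF assms] using pos by (rule exp_ln)
  finally have "cmod (exp (pseries g (cis (-l)))) = cmod (incr_kernel 1 1 l)"
    by (rule power2_eq_imp_eq) simp_all
  then show ?thesis
    using \<open>incr_kernel 1 1 l \<noteq> 0\<close> unfolding \<theta>_def norm_power norm_divide by simp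
qed

lemma pseries_cis_measurable: "(\<lambda>l. pseries c (cis (-l))) \<in> borel_measurable borel"
  unfolding pseries_def by measurable

lemma incr_kernel_measurable: "incr_kernel k \<nu> \<in> borel_measurable borel"
  unfolding incr_kernel_def[abs_def] by measurable

lemma T_measurable:
  assumes "u \<in> borel_measurable borel"
  shows "T u \<in> borel_measurable borel"
proof -
  have "exp \<in> borel_measurable (borel :: complex measure)"
    by (intro borel_measurable_continuous_onI continuous_intros)
  from measurable_compose[OF pseries_cis_measurable this] show ?thesis
    unfolding T_def[abs_def] \<theta>_def \<Phi>_def
    by (intro borel_measurable_divide borel_measurable_times borel_measurable_power assms
        incr_kernel_measurable pseries_cis_measurable)
qed

lemma sets_M: "sets M = sets circle"
  unfolding density by simp

lemma measurable_M: "u \<in> borel_measurable borel \<Longrightarrow> u \<in> borel_measurable M"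
  using measurable_circle measurable_cong_sets[OF sets_M refl] by blast

lemma weight_measurable: "(\<lambda>l. (cmod (pseries \<phi> (cis (-l))))\<^sup>2 / (2 * pi)) \<in> borel_measurable circle"
  by (intro measurable_circle borel_measurable_divide borel_measurable_power
      measurable_compose[OF pseries_cis_measurable borel_measurable_norm] borel_measurable_const)

lemma weight_T:
  assumes "l \<in> {-pi..<pi}"
  shows "((cmod (pseries \<phi> (cis (-l))))\<^sup>2 / (2 * pi)) *\<^sub>R (T u l * cnj (T v l)) = 1 / (2 * of_real pi) * (u l * cnj (v l))"
proof -
  have t: "\<theta> l * cnj (\<theta> l) = 1"
    using \<theta>_norm[of l] assms by (simp add: complex_norm_square[symmetric])
  have p: "of_real ((cmod (\<Phi> l))\<^sup>2) = \<Phi> l * cnj (\<Phi> l)" by (rule complex_norm_square)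
  have "((cmod (\<Phi> l))\<^sup>2 / (2 * pi)) *\<^sub>R (T u l * cnj (T v l)) =
      (\<Phi> l * cnj (\<Phi> l)) / (2 * of_real pi) * ((u l * cnj (v l)) * (\<theta> l * cnj (\<theta> l)) / (\<Phi> l * cnj (\<Phi> l)))"
    unfolding scaleR_conv_of_real of_real_divide p by (simp add: T_def)
  also have "\<dots> = 1 / (2 * of_real pi) * (u l * cnj (v l))"
    unfolding t using \<Phi>_nonzero[of l] by simp
  finally show ?thesis by (simp only: \<Phi>_def)
qed

lemma T_inner:
  assumes "u \<in> borel_measurable borel" "v \<in> borel_measurable borel"
  shows "(\<integral>l. T u l * cnj (T v l) \<partial>M) = 1 / (2 * of_real pi) * (\<integral>l. u l * cnj (v l) \<partial>circle)"
proof -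
  have "(\<integral>l. T u l * cnj (T v l) \<partial>M) = (\<integral>l. ((cmod (pseries \<phi> (cis (-l))))\<^sup>2 / (2 * pi)) *\<^sub>R (T u l * cnj (T v l)) \<partial>circle)"
    unfolding density
  proof (rule integral_density)
    note [measurable] = T_measurable[OF assms(1)] T_measurable[OF assms(2)]
    show "(\<lambda>l. T u l * cnj (T v l)) \<in> borel_measurable circle" by (rule measurable_circle) measurable
  qed (use weight_measurable in auto)
  also have "\<dots> = (\<integral>l. 1 / (2 * of_real pi) * (u l * cnj (v l)) \<partial>circle)"
    by (rule Bochner_Integration.integral_cong) (use weight_T in auto)
  finally show ?thesis by (simp only: integral_mult_right_zero)
qed

lemma T_L2:
  assumes "u \<in> borel_measurable borel" "\<And>l. cmod (u l) \<le> B"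
  shows "T u \<in> L2 M"
proof (rule L2I)
  show m: "T u \<in> borel_measurable M" by (intro measurable_M T_measurable assms)
  have "integrable M (\<lambda>l. T u l * cnj (T u l))"
    unfolding density
  proof (subst integrable_density)
    note [measurable] = T_measurable[OF assms(1)]
    show "(\<lambda>l. T u l * cnj (T u l)) \<in> borel_measurable circle" by (rule measurable_circle) measurable
    have "integrable circle (\<lambda>l. u l * cnj (u l))"
    proof (rule integrable_circle_bounded)
      note [measurable] = assms(1)
      show "(\<lambda>l. u l * cnj (u l)) \<in> borel_measurable circle" by (rule measurable_circle) measurable
      show "cmod (u l * cnj (u l)) \<le> B * B" for l
        unfolding norm_mult complex_mod_cnj by (intro mult_mono assms order_trans[OF norm_ge_zero assms(2)]) simp
    qed
    then have "integrable circle (\<lambda>l. 1 / (2 * of_real pi) * (u l * cnj (u l)))"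
      by (rule integrable_mult_right)
    then show "integrable circle (\<lambda>l. ((cmod (pseries \<phi> (cis (-l))))\<^sup>2 / (2 * pi)) *\<^sub>R (T u l * cnj (T u l)))"
      by (rule Bochner_Integration.integrable_cong[THEN iffD1, rotated 2]) (use weight_T in auto)
  qed (use weight_measurable in auto)
  then have "integrable M (\<lambda>l. complex_of_real ((cmod (T u l))\<^sup>2))"
    by (simp only: complex_norm_square)
  then show "integrable M (\<lambda>l. (cmod (T u l))\<^sup>2)"
    by (simp only: complex_of_real_integrable_eq)
qed

lemma T_diff: "T u l - T v l = T (\<lambda>l. u l - v l) l"
  by (simp add: T_def left_diff_distrib diff_divide_distrib)

lemma T_norm:
  assumes "u \<in> borel_measurable borel"
  shows "(\<integral>l. (cmod (T u l))\<^sup>2 \<partial>M) = 1 / (2 * pi) * (\<integral>l. (cmod (u l))\<^sup>2 \<partial>circle)"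
proof -
  have "complex_of_real (\<integral>l. (cmod (T u l))\<^sup>2 \<partial>M) = (\<integral>l. T u l * cnj (T u l) \<partial>M)"
    by (simp only: integral_complex_of_real[symmetric] complex_norm_square)
  also have "\<dots> = 1 / (2 * of_real pi) * (\<integral>l. u l * cnj (u l) \<partial>circle)"
    by (rule T_inner[OF assms assms])
  also have "(\<integral>l. u l * cnj (u l) \<partial>circle) = complex_of_real (\<integral>l. (cmod (u l))\<^sup>2 \<partial>circle)"
    by (simp only: integral_complex_of_real[symmetric] complex_norm_square)
  also have "1 / (2 * of_real pi) * complex_of_real (\<integral>l. (cmod (u l))\<^sup>2 \<partial>circle) =
      complex_of_real (1 / (2 * pi) * (\<integral>l. (cmod (u l))\<^sup>2 \<partial>circle))" by simp
  finally show ?thesis by (simp only: of_real_eq_iff)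
qed

lemma T_mse:
  assumes "u \<in> borel_measurable borel" "v \<in> borel_measurable borel"
  shows "mse M (T u) (T v) = 1 / (2 * pi) * mse circle u v"
proof -
  note [measurable] = assms
  have "(\<lambda>l. u l - v l) \<in> borel_measurable borel" by measurable
  then show ?thesis unfolding mse_def T_diff by (rule T_norm)
qed

lemma cis_int_measurable: "(\<lambda>l. cis (of_int m * l)) \<in> borel_measurable borel"
  by measurable

lemma e_L2: "e m \<in> L2 M"
  unfolding e_def by (rule T_L2[where B = 1]) simp_all

lemma e_inner: "(\<integral>l. e m l * cnj (e k l) \<partial>M) = (if m = k then 1 else 0)"
  unfolding e_def by (subst T_inner[OF cis_int_measurable cis_int_measurable]) (simp only: integral_circle_cis_mult_cnj, simp)

lemma e_norm: "(\<integral>l. (cmod (e m l))\<^sup>2 \<partial>M) = 1"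
  unfolding e_def by (subst T_norm[OF cis_int_measurable]) (simp add: measure_circle)

lemma e_shift: "e m l = cis (of_int m * l) * (\<theta> l / \<Phi> l)"
  by (simp add: e_def T_def)

lemmas e_series = shift_series[where W = e, OF e_shift e_L2]

text \<open>The outer function \<open>w_mu\<close> continued to the closed disc.\<close>
definition Q :: "nat \<Rightarrow> complex \<Rightarrow> complex" where
  "Q \<nu> z = ((\<Sum>i<\<nu>. z ^ i) * exp (pseries g z)) ^ n"

lemma phi_mu_series:
  assumes "\<nu> > 0"
  shows "summable (\<lambda>k. cmod (phi_mu n \<phi> \<nu> k))"
    and "cmod z \<le> 1 \<Longrightarrow> pseries (phi_mu n \<phi> \<nu>) z = Q \<nu> z * pseries \<phi> z"
  using phi_mu_has_abs_pseries[OF g_summable g_Im g_log assms \<phi>_summable]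
  by (simp_all add: has_abs_pseries_def Q_def)

text \<open>The factor \<open>\<theta>\<close> does not depend on \<open>\<nu>\<close>; this is why one innovation sequence serves
  all steps.\<close>
lemma kernel_eq:
  assumes "\<nu> > 0"
  shows "incr_kernel n (int \<nu>) l = Q \<nu> (cis (-l)) * \<theta> l"
    and "incr_kernel n (int \<nu>) l = pseries (phi_mu n \<phi> \<nu>) (cis (-l)) * \<theta> l / \<Phi> l"
proof -
  show 1: "incr_kernel n (int \<nu>) l = Q \<nu> (cis (-l)) * \<theta> l"
    unfolding incr_kernel_factor[OF assms] Q_def \<theta>_def power_mult_distrib[symmetric] by simp
  have "pseries (phi_mu n \<phi> \<nu>) (cis (-l)) = Q \<nu> (cis (-l)) * \<Phi> l"
    by (subst phi_mu_series(2)[OF assms]) (simp_all add: \<Phi>_def)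
  then show "incr_kernel n (int \<nu>) l = pseries (phi_mu n \<phi> \<nu>) (cis (-l)) * \<theta> l / \<Phi> l"
    using \<Phi>_nonzero[of l] by (simp add: 1)
qed

definition kernel :: "nat \<Rightarrow> int \<Rightarrow> real \<Rightarrow> complex" where
  "kernel \<nu> m l = cis (of_int m * l) * incr_kernel n (int \<nu>) l"

lemma kernel_L2: "\<nu> > 0 \<Longrightarrow> kernel \<nu> m \<in> L2 M"
  using has_stochastic_integralD(1)[OF rep, of "int \<nu>" m] by (simp add: kernel_def[abs_def])

lemma kernel_stint: "\<nu> > 0 \<Longrightarrow> stint (kernel \<nu> m) (increment n \<xi> m (int \<nu>))"
  using rep[of "int \<nu>" m] by (simp add: kernel_def[abs_def])

lemma kernel_norm: "(\<integral>l. (cmod (kernel \<nu> m l))\<^sup>2 \<partial>M) = (\<integral>l. (cmod (kernel \<nu> 0 l))\<^sup>2 \<partial>M)"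
  by (simp add: kernel_def norm_mult)

lemmas kernel_series = shift_series[where W = "kernel \<nu>" for \<nu>, OF kernel_def kernel_L2]

lemma kernel_eq_e_series:
  assumes "\<nu> > 0"
  shows "kernel \<nu> m = (\<lambda>l. pseries (phi_mu n \<phi> \<nu>) (cis (-l)) * e m l)"
  by (rule ext) (simp add: kernel_def kernel_eq(2)[OF assms] e_shift)

lemma inverse_outer:
  obtains c where "has_abs_pseries c (\<lambda>z. exp (- pseries g z) ^ n * inverse (pseries \<phi> z))"
proof -
  have "has_abs_pseries g (pseries g)" using g_summable by (simp add: has_abs_pseries_def)
  then obtain a where "has_abs_pseries a (\<lambda>z. exp (- pseries g z))"
    using has_abs_pseries_exp_uminus by blast
  then obtain b where b: "has_abs_pseries b (\<lambda>z. exp (- pseries g z) ^ n)"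
    using has_abs_pseries_power by blast
  obtain d where "has_abs_pseries d (\<lambda>z. inverse (pseries \<phi> z))"
    using has_abs_pseries_inverse[OF radius nonzero] by blast
  from has_abs_pseries_mult[OF b this] show thesis by (rule that)
qed

lemma Q_inverse:
  "Q \<nu> z * (exp (- pseries g z) ^ n * w) = (\<Sum>i<\<nu>. z ^ i) ^ n * w"
proof -
  have "exp (pseries g z) * exp (- pseries g z) = 1" by (simp flip: exp_add)
  then have "exp (pseries g z) ^ n * exp (- pseries g z) ^ n = 1" by (simp flip: power_mult_distrib)
  then show ?thesis unfolding Q_def power_mult_distrib by (simp add: mult.assoc mult.left_commute)
qed

text \<open>The coefficients of the inverse of \<open>Q 1 * pseries \<phi>\<close>, which has no zeros on the
  closed disc because \<open>Q 1\<close> is an exponential.\<close>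
definition c0 :: "nat \<Rightarrow> complex" where
  "c0 = (SOME c. has_abs_pseries c (\<lambda>z. exp (- pseries g z) ^ n * inverse (pseries \<phi> z)))"

lemma c0: "has_abs_pseries c0 (\<lambda>z. exp (- pseries g z) ^ n * inverse (pseries \<phi> z))"
proof -
  obtain c where "has_abs_pseries c (\<lambda>z. exp (- pseries g z) ^ n * inverse (pseries \<phi> z))"
    by (rule inverse_outer)
  then show ?thesis unfolding c0_def
    by (rule someI[where P = "\<lambda>c. has_abs_pseries c (\<lambda>z. exp (- pseries g z) ^ n * inverse (pseries \<phi> z))"])
qed

lemma c0_summable: "summable (\<lambda>k. cmod (c0 k))"
  using c0 by (simp add: has_abs_pseries_def)

lemma e_eq_kernel_series: "e m = (\<lambda>l. pseries c0 (cis (-l)) * kernel 1 m l)"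
proof
  fix l
  have "pseries c0 (cis (-l)) = exp (- pseries g (cis (-l))) ^ n * inverse (\<Phi> l)"
    using c0 by (simp add: has_abs_pseries_def \<Phi>_def)
  moreover have "kernel 1 m l = cis (of_int m * l) * (Q 1 (cis (-l)) * \<theta> l)"
    unfolding kernel_def using kernel_eq(1)[of 1 l] by simp
  ultimately have "pseries c0 (cis (-l)) * kernel 1 m l =
      cis (of_int m * l) * \<theta> l * (Q 1 (cis (-l)) * (exp (- pseries g (cis (-l))) ^ n * inverse (\<Phi> l)))"
    by (simp only: mult_ac)
  also have "\<dots> = e m l"
    unfolding Q_inverse by (simp add: e_def T_def divide_inverse)
  finally show "e m l = pseries c0 (cis (-l)) * kernel 1 m l" by (rule sym)
qed

lemma one_pos_int: "0 < (1::int)" and one_pos_nat: "0 < (1::nat)"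
  by simp_all

text \<open>The innovations, obtained by inverting the moving average for step \<open>1\<close>.\<close>
definition \<epsilon> :: "int \<Rightarrow> 'a \<Rightarrow> complex" where
  "\<epsilon> m \<omega> = (\<Sum>k. c0 k * increment n \<xi> (m - int k) 1 \<omega>)"

lemma increment_stint: "stint (kernel 1 m) (increment n \<xi> m 1)"
  using kernel_stint[OF one_pos_nat, of m] by (simp only: of_nat_1)

lemma increment_L2: "\<nu> > 0 \<Longrightarrow> increment n \<xi> m \<nu> \<in> L2 P"
  by (rule has_stochastic_integralD(2)[OF rep])

lemma \<epsilon>_series:
  shows "\<epsilon> m \<in> L2 P"
    and "(\<lambda>K. mse P (\<epsilon> m) (\<lambda>\<omega>. \<Sum>k<K. c0 k * increment n \<xi> (m - int k) 1 \<omega>)) \<longlonglongrightarrow> 0"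
proof -
  have b: "(\<integral>\<omega>. (cmod (increment n \<xi> (m - int k) 1 \<omega>))\<^sup>2 \<partial>P) \<le> (\<integral>l. (cmod (kernel 1 0 l))\<^sup>2 \<partial>M)" for k
    unfolding stint_norm[OF increment_stint[of "m - int k"]] kernel_norm[of 1 "m - int k"] by (rule order_refl)
  note s = L2_abs_series[where X = "\<lambda>k. increment n \<xi> (m - int k) 1", OF increment_L2[OF one_pos_int] b c0_summable]
  show "\<epsilon> m \<in> L2 P"
    using s(1) unfolding \<epsilon>_def[abs_def] .
  show "(\<lambda>K. mse P (\<epsilon> m) (\<lambda>\<omega>. \<Sum>k<K. c0 k * increment n \<xi> (m - int k) 1 \<omega>)) \<longlonglongrightarrow> 0"
    using s(2) unfolding \<epsilon>_def[abs_def] .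
qed

lemma \<epsilon>_stint: "stint (e m) (\<epsilon> m)"
proof (rule stint_limit_seq[OF e_L2 \<epsilon>_series(1) _ _ \<epsilon>_series(2)])
  show "stint (\<lambda>l. \<Sum>k<K. c0 k * kernel 1 (m - int k) l) (\<lambda>\<omega>. \<Sum>k<K. c0 k * increment n \<xi> (m - int k) 1 \<omega>)" for K
    by (rule stint_sum[OF increment_stint])
  show "(\<lambda>K. mse M (e m) (\<lambda>l. \<Sum>k<K. c0 k * kernel 1 (m - int k) l)) \<longlonglongrightarrow> 0"
    unfolding e_eq_kernel_series by (rule kernel_series(2)[OF one_pos_nat c0_summable])
qed

lemma increment_moving_average:
  assumes "\<nu> > 0"
  shows "moving_average P \<epsilon> (phi_mu n \<phi> \<nu>) m (increment n \<xi> m (int \<nu>))"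
proof -
  have "mse P (increment n \<xi> m (int \<nu>)) (\<lambda>\<omega>. \<Sum>k<K. phi_mu n \<phi> \<nu> k * \<epsilon> (m - int k) \<omega>) =
      mse M (\<lambda>l. pseries (phi_mu n \<phi> \<nu>) (cis (-l)) * e m l) (\<lambda>l. \<Sum>k<K. phi_mu n \<phi> \<nu> k * e (m - int k) l)" for K
    unfolding kernel_eq_e_series[OF assms, symmetric]
    by (rule stint_mse[OF kernel_stint[OF assms] stint_sum[OF \<epsilon>_stint]])
  then show ?thesis
    unfolding moving_average_def by (simp only: e_series(2)[OF phi_mu_series(1)[OF assms]])
qed

lemma \<epsilon>_mean: "(\<integral>\<omega>. \<epsilon> m \<omega> \<partial>P) = 0"
proof -
  interpret prob_space P by (rule prob)
  have one: "(\<lambda>_. 1 :: complex) \<in> L2 P" by (rule L2I) simp_all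
  let ?S = "\<lambda>K \<omega>. \<Sum>k<K. c0 k * increment n \<xi> (m - int k) 1 \<omega>"
  have S: "?S K \<in> L2 P" for K
    by (intro L2_sum L2_scale increment_L2 one_pos_int)
  have int: "integrable P (increment n \<xi> (m - int k) 1)" for k
    using L2_mult_cnj_integrable[OF increment_L2[OF one_pos_int] one] by simp
  have "(\<integral>\<omega>. ?S K \<omega> * cnj 1 \<partial>P) = 0" for K
    by (simp add: Bochner_Integration.integral_sum int mean)
  moreover have "(\<lambda>K. \<integral>\<omega>. ?S K \<omega> * cnj 1 \<partial>P) \<longlonglongrightarrow> (\<integral>\<omega>. \<epsilon> m \<omega> * cnj 1 \<partial>P)"
    by (rule tendsto_inner_L2[OF \<epsilon>_series(1) one S one \<epsilon>_series(2)]) simp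
  ultimately have "(\<lambda>K::nat. 0) \<longlonglongrightarrow> (\<integral>\<omega>. \<epsilon> m \<omega> * cnj 1 \<partial>P)" by (simp only:)
  then show ?thesis by (simp add: LIMSEQ_const_iff)
qed

text \<open>Each of the two families is a sum over the past of the other: the innovations by the
  inverse series \<open>c0\<close>, the increments by their moving averages.\<close>
lemma innovations: "innovation_sequence P n \<xi> \<epsilon>"
  unfolding innovation_sequence_def
proof (intro conjI allI)
  fix m m' t :: int
  show "\<epsilon> m \<in> L2 P" by (rule \<epsilon>_series(1))
  show "(\<integral>\<omega>. \<epsilon> m \<omega> \<partial>P) = 0" by (rule \<epsilon>_mean)
  show "(\<integral>\<omega>. \<epsilon> m \<omega> * cnj (\<epsilon> m' \<omega>) \<partial>P) = (if m = m' then 1 else 0)"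
    unfolding stint_inner[OF \<epsilon>_stint \<epsilon>_stint] by (rule e_inner)
  let ?S = "{\<epsilon> m | m. m \<le> t}" and ?I = "{increment n \<xi> m \<nu> | m \<nu>. m \<le> t \<and> \<nu> > 0}"
  have S: "?S \<subseteq> L2 P" using \<epsilon>_series(1) by blast
  have I: "?I \<subseteq> L2 P" using increment_L2 by blast
  show "L2_span P ?S = L2_span P ?I"
  proof (intro equalityI L2_span_subset S I subsetI)
    fix s assume "s \<in> ?S"
    then obtain m where m: "m \<le> t" "s = \<epsilon> m" by blast
    show "s \<in> L2_span P ?I"
      unfolding m(2)
    proof (rule L2_span_limit_seq[OF I \<epsilon>_series(1) _ \<epsilon>_series(2)])
      fix K
      have "increment n \<xi> (m - int k) 1 \<in> ?I" for k
        by (intro CollectI exI[of _ "m - int k"] exI[of _ "1::int"] conjI refl) (use m(1) in simp_all)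
      then show "(\<lambda>\<omega>. \<Sum>k<K. c0 k * increment n \<xi> (m - int k) 1 \<omega>) \<in> L2_span P ?I"
        by (intro L2_span_sum[OF I] L2_span_base[OF I])
    qed
  next
    fix s assume "s \<in> ?I"
    then obtain m \<nu> where m: "m \<le> t" "s = increment n \<xi> m \<nu>" "\<nu> > 0" by blast
    define k where "k = nat \<nu>"
    have k: "k > 0" "\<nu> = int k" using m(3) by (simp_all add: k_def)
    show "s \<in> L2_span P ?S"
      unfolding m(2)
    proof (rule L2_span_limit_seq[OF S increment_L2[OF m(3)]])
      show "(\<lambda>K. mse P (increment n \<xi> m \<nu>) (\<lambda>\<omega>. \<Sum>j<K. phi_mu n \<phi> k j * \<epsilon> (m - int j) \<omega>)) \<longlonglongrightarrow> 0"
        using increment_moving_average[OF k(1), of m] unfolding moving_average_def k(2) .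
      fix K
      have "\<epsilon> (m - int j) \<in> ?S" for j
        by (intro CollectI exI[of _ "m - int j"] conjI refl) (use m(1) in simp)
      then show "(\<lambda>\<omega>. \<Sum>j<K. phi_mu n \<phi> k j * \<epsilon> (m - int j) \<omega>) \<in> L2_span P ?S"
        by (intro L2_span_sum[OF S] L2_span_base[OF S])
    qed
  qed
qed

section \<open>The past of the process\<close>

text \<open>\<open>Q \<mu>\<close> may vanish at roots of unity, so its inverse is not a power series on the
  closed disc. Dividing by \<open>(1 - s * z ^ \<mu>) ^ n\<close> with \<open>s < 1\<close> instead gives approximations
  by series in the kernels, which converge boundedly as \<open>s\<close> tends to \<open>1\<close>.\<close>
lemma e_in_span_kernel:
  assumes \<mu>: "\<mu> > 0"
  shows "e m \<in> L2_span M {kernel \<mu> k | k. k \<le> m}"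
proof -
  let ?S = "{kernel \<mu> k | k. k \<le> m}"
  have S: "?S \<subseteq> L2 M" using kernel_L2[OF \<mu>] by blast
  obtain s :: "nat \<Rightarrow> real" where "\<And>i. 0 < s i" and s1: "\<And>i. s i < 1" and s_lim: "s \<longlonglongrightarrow> 1"
    using Abel_sequence by blast
  then have s: "0 \<le> s i" "s i < 1" for i by (simp_all add: less_imp_le)
  \<comment> \<open>\<open>q i\<close> is the boundary value of \<open>((1 - z ^ \<mu>) / (1 - s i * z ^ \<mu>)) ^ n\<close>: divisible by
    \<open>Q \<mu>\<close>, at most \<open>2 ^ n\<close> in modulus, and convergent to \<open>1\<close> off the zeros of
    \<open>1 - z ^ \<mu>\<close>.\<close>
  define q where "q = (\<lambda>i l. ((1 - cis (- (real \<mu> * l))) * inverse (1 - of_real (s i) * cis (- (real \<mu> * l)))) ^ n)"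
  define f where "f = (\<lambda>i. T (\<lambda>l. cis (of_int m * l) * q i l))"
  have q_meas: "q i \<in> borel_measurable borel" for i
    unfolding q_def by measurable
  have den: "1 - s i \<le> cmod (1 - of_real (s i) * cis (- (real \<mu> * l)))" for i l
    using norm_triangle_ineq2[of 1 "of_real (s i) * cis (- (real \<mu> * l))"] s[of i] by (simp add: norm_mult)
  have q_bound: "cmod (q i l) \<le> 2 ^ n" for i l
  proof -
    let ?\<zeta> = "cis (- (real \<mu> * l))"
    have pos: "cmod (1 - of_real (s i) * ?\<zeta>) > 0" using den[of i l] s[of i] by linarith
    have "1 - ?\<zeta> = (1 - of_real (s i) * ?\<zeta>) - of_real (1 - s i) * ?\<zeta>" by (simp add: algebra_simps)
    then have "cmod (1 - ?\<zeta>) \<le> cmod (1 - of_real (s i) * ?\<zeta>) + cmod (of_real (1 - s i) * ?\<zeta>)"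
      by (metis norm_triangle_ineq4)
    also have "cmod (of_real (1 - s i) * ?\<zeta>) = 1 - s i"
      unfolding norm_mult norm_of_real norm_cis using s[of i] by simp
    also have "\<dots> \<le> cmod (1 - of_real (s i) * ?\<zeta>)" by (rule den)
    finally have "cmod (1 - ?\<zeta>) \<le> 2 * cmod (1 - of_real (s i) * ?\<zeta>)" by simp
    then have "cmod ((1 - ?\<zeta>) * inverse (1 - of_real (s i) * ?\<zeta>)) \<le> 2"
      unfolding norm_mult norm_inverse by (simp only: divide_inverse[symmetric] pos_divide_le_eq[OF pos])
    then show ?thesis unfolding q_def norm_power by (rule power_mono) simp
  qed
  have f_span: "f i \<in> L2_span M ?S" for i
  proof -
    have "has_abs_pseries (\<lambda>k. if k < 2 then (if k = 0 then 1 else -1) else 0) (\<lambda>z. \<Sum>k<2. (if k = 0 then 1 else -1) * z ^ k)"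
      by (rule has_abs_pseries_finite)
    moreover have "(\<lambda>z. \<Sum>k<2. (if k = 0 then 1 else -1) * z ^ k) = (\<lambda>z :: complex. 1 - z)"
      by (simp add: numeral_2_eq_2)
    ultimately obtain a where a: "has_abs_pseries a (\<lambda>z. 1 - z)" by metis
    obtain b where "has_abs_pseries b (\<lambda>z. inverse (1 - of_real (s i) * z ^ \<mu>))"
      using geometric_inverse_has_abs_pseries[OF s \<mu>] by blast
    from has_abs_pseries_power[OF has_abs_pseries_mult[OF a this]]
    obtain d where "has_abs_pseries d (\<lambda>z. ((1 - z) * inverse (1 - of_real (s i) * z ^ \<mu>)) ^ n)" by blast
    from has_abs_pseries_mult[OF this c0] obtain c
      where c: "has_abs_pseries c (\<lambda>z. ((1 - z) * inverse (1 - of_real (s i) * z ^ \<mu>)) ^ n *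
          (exp (- pseries g z) ^ n * inverse (pseries \<phi> z)))" by blast
    then have cs: "summable (\<lambda>k. cmod (c k))" by (simp add: has_abs_pseries_def)
    have f_eq: "f i = (\<lambda>l. pseries c (cis (-l)) * kernel \<mu> m l)"
    proof
      fix l
      let ?z = "cis (-l)"
      have z: "?z ^ \<mu> = cis (- (real \<mu> * l))" by (simp add: Complex.DeMoivre)
      have "pseries c ?z = ((1 - ?z) * inverse (1 - of_real (s i) * ?z ^ \<mu>)) ^ n *
          (exp (- pseries g ?z) ^ n * inverse (pseries \<phi> ?z))"
        using c by (simp add: has_abs_pseries_def)
      then have "pseries c ?z * kernel \<mu> m l = (cis (of_int m * l) * \<theta> l * ((1 - ?z) * inverse (1 - of_real (s i) * ?z ^ \<mu>)) ^ n) *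
          (Q \<mu> ?z * (exp (- pseries g ?z) ^ n * inverse (pseries \<phi> ?z)))"
        unfolding kernel_def kernel_eq(1)[OF \<mu>] by (simp only: mult_ac)
      also have "\<dots> = (cis (of_int m * l) * \<theta> l * ((1 - ?z) * inverse (1 - of_real (s i) * ?z ^ \<mu>)) ^ n) *
          ((\<Sum>i<\<mu>. ?z ^ i) ^ n * inverse (pseries \<phi> ?z))"
        by (simp only: Q_inverse)
      also have "\<dots> = cis (of_int m * l) * (((1 - ?z) * (\<Sum>i<\<mu>. ?z ^ i)) * inverse (1 - of_real (s i) * ?z ^ \<mu>)) ^ n * \<theta> l / \<Phi> l"
        by (simp only: power_mult_distrib divide_inverse \<Phi>_def mult_ac)
      also have "(1 - ?z) * (\<Sum>i<\<mu>. ?z ^ i) = 1 - ?z ^ \<mu>" by (rule one_diff_power_eq[symmetric])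
      finally show "f i l = pseries c ?z * kernel \<mu> m l"
        unfolding z f_def T_def q_def by (rule sym)
    qed
    show ?thesis unfolding f_eq by (rule kernel_series(3)[OF \<mu> cs])
  qed
  have lim: "(\<lambda>i. mse M (e m) (f i)) \<longlonglongrightarrow> 0"
  proof -
    have "mse M (e m) (f i) = 1 / (2 * pi) * (\<integral>l. (cmod (1 - q i l))\<^sup>2 \<partial>circle)" for i
    proof -
      have "(\<lambda>l. cis (of_int m * l) * q i l) \<in> borel_measurable borel"
        by (intro borel_measurable_times cis_int_measurable q_meas)
      then have "mse M (e m) (f i) = 1 / (2 * pi) * mse circle (\<lambda>l. cis (of_int m * l)) (\<lambda>l. cis (of_int m * l) * q i l)"
        unfolding e_def f_def by (rule T_mse[OF cis_int_measurable])
      also have "mse circle (\<lambda>l. cis (of_int m * l)) (\<lambda>l. cis (of_int m * l) * q i l) = (\<integral>l. (cmod (1 - q i l))\<^sup>2 \<partial>circle)"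
      proof -
        have "cis (of_int m * l) - cis (of_int m * l) * q i l = cis (of_int m * l) * (1 - q i l)" for l
          by (simp add: right_diff_distrib)
        then show ?thesis unfolding mse_def by (simp only: norm_mult norm_cis mult_1)
      qed
      finally show ?thesis .
    qed
    moreover have "(\<lambda>i. \<integral>l. (cmod (1 - q i l))\<^sup>2 \<partial>circle) \<longlonglongrightarrow> (\<integral>l. 0 \<partial>circle)"
    proof (rule integral_dominated_convergence[where w = "\<lambda>_. (1 + 2 ^ n)\<^sup>2"])
      show "(\<lambda>l. (cmod (1 - q i l))\<^sup>2) \<in> borel_measurable circle" for i
      proof (rule measurable_circle)
        note [measurable] = q_meas
        show "(\<lambda>l. (cmod (1 - q i l))\<^sup>2) \<in> borel_measurable borel" by measurable
      qed
      show "AE l in circle. norm ((cmod (1 - q i l))\<^sup>2) \<le> (1 + 2 ^ n)\<^sup>2" for i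
      proof (rule AE_I2)
        fix l
        have "cmod (1 - q i l) \<le> 1 + 2 ^ n"
          using norm_triangle_ineq4[of 1 "q i l"] q_bound[of i l] by simp
        then have "(cmod (1 - q i l))\<^sup>2 \<le> (1 + 2 ^ n)\<^sup>2" by (rule power_mono) simp
        then show "norm ((cmod (1 - q i l))\<^sup>2) \<le> (1 + 2 ^ n)\<^sup>2" by simp
      qed
      show "AE l in circle. (\<lambda>i. (cmod (1 - q i l))\<^sup>2) \<longlonglongrightarrow> 0"
        using AE_circle_cis_neq_1[OF \<mu>]
      proof eventually_elim
        case (elim l)
        let ?\<zeta> = "cis (- (real \<mu> * l))"
        have ne: "1 - of_real 1 * ?\<zeta> \<noteq> 0" using elim by simp
        have "(\<lambda>i. (cmod (1 - q i l))\<^sup>2) \<longlonglongrightarrow> (cmod (1 - ((1 - ?\<zeta>) * inverse (1 - of_real 1 * ?\<zeta>)) ^ n))\<^sup>2"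
          unfolding q_def by (intro tendsto_intros s_lim ne)
        moreover have "(1 - ?\<zeta>) * inverse (1 - of_real 1 * ?\<zeta>) = 1" using ne by simp
        ultimately show ?case by simp
      qed
    qed simp_all
    ultimately show ?thesis
      using tendsto_mult[OF tendsto_const[of "1 / (2 * pi)"], of "\<lambda>i. \<integral>l. (cmod (1 - q i l))\<^sup>2 \<partial>circle" 0] by simp
  qed
  show ?thesis by (rule L2_span_limit_seq[OF S e_L2 f_span lim])
qed

lemma kernel_in_span_e:
  assumes "\<mu> > 0"
  shows "kernel \<mu> m \<in> L2_span M {e k | k. k \<le> m}"
  unfolding kernel_eq_e_series[OF assms] by (rule e_series(3)[OF phi_mu_series(1)[OF assms]])

text \<open>For every step the observed increments have the same past as the innovations.\<close>
lemma L2_minus_eq: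
  assumes \<mu>: "\<mu> > 0"
  shows "L2_minus n \<mu> F = L2_span M {e k | k. k \<le> -1}"
proof -
  have eq: "{(\<lambda>l. cis (of_int k * l) * incr_kernel n (int \<mu>) l) | k. k \<le> (-1::int)} = {kernel \<mu> k | k. k \<le> -1}"
    by (simp only: kernel_def[abs_def])
  have kernel: "{kernel \<mu> k | k. k \<le> -1} \<subseteq> L2 M" using kernel_L2[OF \<mu>] by blast
  have E: "{e k | k. k \<le> -1} \<subseteq> L2 M" using e_L2 by blast
  show ?thesis
    unfolding L2_minus_def eq
  proof (intro equalityI L2_span_subset kernel E subsetI)
    fix x assume "x \<in> {kernel \<mu> k | k. k \<le> -1}"
    then obtain k where k: "k \<le> -1" "x = kernel \<mu> k" by blast
    have "{e j | j. j \<le> k} \<subseteq> L2_span M {e k | k. k \<le> -1}"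
    proof
      fix y assume "y \<in> {e j | j. j \<le> k}"
      then obtain j where "j \<le> k" "y = e j" by blast
      then show "y \<in> L2_span M {e k | k. k \<le> -1}"
        using k(1) by (intro L2_span_base[OF E] CollectI exI[of _ j] conjI) simp_all
    qed
    from subsetD[OF L2_span_subset[OF E this] kernel_in_span_e[OF \<mu>]] show "x \<in> L2_span M {e k | k. k \<le> -1}"
      unfolding k(2) .
  next
    fix x assume "x \<in> {e k | k. k \<le> -1}"
    then obtain k where k: "k \<le> -1" "x = e k" by blast
    have "{kernel \<mu> j | j. j \<le> k} \<subseteq> L2_span M {kernel \<mu> k | k. k \<le> -1}"
    proof
      fix y assume "y \<in> {kernel \<mu> j | j. j \<le> k}"
      then obtain j where "j \<le> k" "y = kernel \<mu> j" by blast
      then show "y \<in> L2_span M {kernel \<mu> k | k. k \<le> -1}"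
        using k(1) by (intro L2_span_base[OF kernel] CollectI exI[of _ j] conjI) simp_all
    qed
    from subsetD[OF L2_span_subset[OF kernel this] e_in_span_kernel[OF \<mu>]] show "x \<in> L2_span M {kernel \<mu> k | k. k \<le> -1}"
      unfolding k(2) .
  qed
qed

section \<open>The optimal estimate\<close>

definition r_coeff :: "nat \<Rightarrow> nat \<Rightarrow> (nat \<Rightarrow> complex) \<Rightarrow> nat \<Rightarrow> complex" where
  "r_coeff \<mu> N a j = vec_index (r_vec n \<phi> \<mu> N a) j"

text \<open>The coefficient of \<open>z ^ (m + 1)\<close> in the product of
  \<open>\<Sum>k\<le>N. b_coeff n \<mu> N a k * z ^ (-k)\<close> and the series with coefficients \<open>phi_mu\<close>.\<close>
definition \<beta> :: "nat \<Rightarrow> nat \<Rightarrow> (nat \<Rightarrow> complex) \<Rightarrow> nat \<Rightarrow> complex" where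
  "\<beta> \<mu> N a m = (\<Sum>k\<le>N. b_coeff n \<mu> N a k * phi_mu n \<phi> \<mu> (m + Suc k))"

text \<open>The kernel of \<open>A_functional\<close> plus \<open>V_functional\<close>, by \<open>functional_eq_increments\<close>.\<close>
definition target :: "nat \<Rightarrow> nat \<Rightarrow> (nat \<Rightarrow> complex) \<Rightarrow> real \<Rightarrow> complex" where
  "target \<mu> N a l = (\<Sum>k\<le>N. b_coeff n \<mu> N a k * kernel \<mu> (int k) l)"

text \<open>The part of \<open>target\<close> that cannot be predicted.\<close>
definition future :: "nat \<Rightarrow> nat \<Rightarrow> (nat \<Rightarrow> complex) \<Rightarrow> real \<Rightarrow> complex" where
  "future \<mu> N a l = (\<Sum>j\<le>N. r_coeff \<mu> N a j * e (int j) l)"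

text \<open>The part of \<open>target\<close> in the closed span of \<open>e m\<close> with \<open>m \<le> -1\<close>.\<close>
definition past :: "nat \<Rightarrow> nat \<Rightarrow> (nat \<Rightarrow> complex) \<Rightarrow> real \<Rightarrow> complex" where
  "past \<mu> N a l = pseries (\<beta> \<mu> N a) (cis (-l)) * e (-1) l"

lemma \<beta>_summable:
  assumes "\<mu> > 0"
  shows "summable (\<lambda>m. cmod (\<beta> \<mu> N a m))"
proof (rule summable_comparison_test'[where N = 0])
  show "summable (\<lambda>m. \<Sum>k\<le>N. cmod (b_coeff n \<mu> N a k) * cmod (phi_mu n \<phi> \<mu> (m + Suc k)))"
    by (intro summable_sum summable_mult summable_ignore_initial_segment phi_mu_series(1)[OF assms])
  fix m
  have "cmod (\<beta> \<mu> N a m) \<le> (\<Sum>k\<le>N. cmod (b_coeff n \<mu> N a k) * cmod (phi_mu n \<phi> \<mu> (m + Suc k)))"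
    unfolding \<beta>_def by (rule order_trans[OF norm_sum]) (simp add: norm_mult)
  then show "norm (cmod (\<beta> \<mu> N a m)) \<le> (\<Sum>k\<le>N. cmod (b_coeff n \<mu> N a k) * cmod (phi_mu n \<phi> \<mu> (m + Suc k)))"
    by simp
qed

text \<open>Multiplying out \<open>\<Sum>k\<le>N. b_coeff n \<mu> N a k * cis (k * l)\<close> with the series in
  \<open>cis (-l)\<close> and separating nonnegative from negative frequencies.\<close>
lemma target_eq:
  assumes \<mu>: "\<mu> > 0"
  shows "target \<mu> N a l = future \<mu> N a l + past \<mu> N a l"
proof -
  let ?z = "cis (-l)" and ?b = "b_coeff n \<mu> N a"
  define p where "p = phi_mu n \<phi> \<mu>"
  have p: "summable (\<lambda>k. cmod (p k))" unfolding p_def by (rule phi_mu_series(1)[OF \<mu>])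
  have ps: "(\<lambda>k. p k * ?z ^ k) sums pseries p ?z" by (rule pseries_sums[OF p]) simp
  have shift: "cis (of_int (int k) * l) * ?z ^ (m + Suc k) = cis (of_int (-1) * l) * ?z ^ m" for k m
    by (simp add: Complex.DeMoivre cis_mult algebra_simps)
  \<comment> \<open>The terms of \<open>z ^ (-k) * pseries p z\<close> with exponent at least \<open>1\<close>, divided by \<open>z\<close>.\<close>
  have split: "(\<lambda>m. p (m + Suc k) * ?z ^ m) sums
      (cis l * (cis (of_int (int k) * l) * pseries p ?z - (\<Sum>j\<le>k. p j * cis (of_int (int (k - j)) * l))))" for k
  proof -
    have "(\<lambda>m. p (m + Suc k) * ?z ^ (m + Suc k)) sums (pseries p ?z - (\<Sum>j<Suc k. p j * ?z ^ j))"
      by (rule sums_split_initial_segment[OF ps])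
    then have "(\<lambda>m. cis l * cis (of_int (int k) * l) * (p (m + Suc k) * ?z ^ (m + Suc k))) sums
        (cis l * cis (of_int (int k) * l) * (pseries p ?z - (\<Sum>j<Suc k. p j * ?z ^ j)))"
      by (rule sums_mult)
    moreover have "cis l * cis (of_int (int k) * l) * (p (m + Suc k) * ?z ^ (m + Suc k)) = p (m + Suc k) * ?z ^ m" for m
    proof -
      have "cis l * cis (of_int (int k) * l) * (p (m + Suc k) * ?z ^ (m + Suc k)) =
          p (m + Suc k) * (cis l * (cis (of_int (int k) * l) * ?z ^ (m + Suc k)))" by (simp only: mult_ac)
      also have "cis l * (cis (of_int (int k) * l) * ?z ^ (m + Suc k)) = (cis l * cis (of_int (-1) * l)) * ?z ^ m"
        by (simp only: shift mult.assoc)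
      also have "cis l * cis (of_int (-1) * l) = 1" by (simp add: cis_mult)
      finally show ?thesis by simp
    qed
    moreover have "cis l * cis (of_int (int k) * l) * (pseries p ?z - (\<Sum>j<Suc k. p j * ?z ^ j)) =
        cis l * (cis (of_int (int k) * l) * pseries p ?z - (\<Sum>j\<le>k. p j * cis (of_int (int (k - j)) * l)))"
    proof -
      have "cis (of_int (int k) * l) * (\<Sum>j<Suc k. p j * ?z ^ j) = (\<Sum>j\<le>k. p j * cis (of_int (int (k - j)) * l))"
        unfolding sum_distrib_left lessThan_Suc_atMost
      proof (intro sum.cong refl)
        fix j assume "j \<in> {..k}"
        then have "cis (of_int (int k) * l) * ?z ^ j = cis (of_int (int (k - j)) * l)"
          by (simp add: Complex.DeMoivre cis_mult of_nat_diff left_diff_distrib)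
        then show "cis (of_int (int k) * l) * (p j * ?z ^ j) = p j * cis (of_int (int (k - j)) * l)"
          by (simp only: mult.left_commute)
      qed
      then show ?thesis by (simp only: right_diff_distrib mult.assoc)
    qed
    ultimately show ?thesis by (simp only:)
  qed
  have "(\<lambda>m. \<Sum>k\<le>N. ?b k * (p (m + Suc k) * ?z ^ m)) sums
      (\<Sum>k\<le>N. ?b k * (cis l * (cis (of_int (int k) * l) * pseries p ?z - (\<Sum>j\<le>k. p j * cis (of_int (int (k - j)) * l)))))"
    by (intro sums_sum sums_mult split)
  moreover have "(\<lambda>m. \<Sum>k\<le>N. ?b k * (p (m + Suc k) * ?z ^ m)) = (\<lambda>m. \<beta> \<mu> N a m * ?z ^ m)"
    by (simp add: \<beta>_def p_def sum_distrib_right mult.assoc)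
  ultimately have "pseries (\<beta> \<mu> N a) ?z =
      (\<Sum>k\<le>N. ?b k * (cis l * (cis (of_int (int k) * l) * pseries p ?z - (\<Sum>j\<le>k. p j * cis (of_int (int (k - j)) * l)))))"
    unfolding pseries_def[of "\<beta> \<mu> N a"] by (simp only: sums_unique[symmetric])
  then have "cis (of_int (-1) * l) * pseries (\<beta> \<mu> N a) ?z = (\<Sum>k\<le>N. ?b k * (cis (of_int (-1) * l) * cis l) *
      (cis (of_int (int k) * l) * pseries p ?z - (\<Sum>j\<le>k. p j * cis (of_int (int (k - j)) * l))))"
    by (simp only: sum_distrib_left mult_ac)
  also have "cis (of_int (-1) * l) * cis l = 1" by (simp add: cis_mult)
  finally have \<beta>: "cis (of_int (-1) * l) * pseries (\<beta> \<mu> N a) ?z =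
      (\<Sum>k\<le>N. ?b k * (cis (of_int (int k) * l) * pseries p ?z)) - (\<Sum>k\<le>N. \<Sum>j\<le>k. ?b k * (p j * cis (of_int (int (k - j)) * l)))"
    by (simp only: mult_1_right right_diff_distrib sum_subtractf sum_distrib_left)
  \<comment> \<open>Collecting the terms with exponent \<open>-m\<close>, where \<open>k = j + m\<close>, gives the entries of
    \<open>r_vec\<close>.\<close>
  have "(\<Sum>k\<le>N. \<Sum>j\<le>k. ?b k * (p j * cis (of_int (int (k - j)) * l))) =
      (\<Sum>k\<le>N. \<Sum>j\<le>k. ?b (j + (k - j)) * (p j * cis (of_int (int (k - j)) * l)))"
    by (intro sum.cong) auto
  also have "\<dots> = (\<Sum>(j, m)\<in>{(j, m). j + m \<le> N}. ?b (j + m) * (p j * cis (of_int (int m) * l)))"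
    by (rule sum.triangle_reindex_eq[symmetric])
  also have "\<dots> = (\<Sum>(j, m)\<in>{..N} \<times> {..N}. ?b (j + m) * (p j * cis (of_int (int m) * l)))"
    by (rule sum.mono_neutral_left) (auto, rule ccontr, simp add: b_coeff_eq_0)
  also have "\<dots> = (\<Sum>j\<le>N. \<Sum>m\<le>N. ?b (j + m) * (p j * cis (of_int (int m) * l)))"
    by (rule sum.cartesian_product[symmetric])
  also have "\<dots> = (\<Sum>m\<le>N. \<Sum>j\<le>N. ?b (j + m) * (p j * cis (of_int (int m) * l)))"
    by (rule sum.swap)
  also have "\<dots> = (\<Sum>m\<le>N. r_coeff \<mu> N a m * cis (of_int (int m) * l))"
  proof (intro sum.cong refl)
    fix m assume "m \<in> {..N}"
    then have "r_coeff \<mu> N a m = (\<Sum>j\<le>N. p j * ?b (m + j))"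
      by (simp add: r_coeff_def index_r_vec p_def)
    then have "r_coeff \<mu> N a m * cis (of_int (int m) * l) = (\<Sum>j\<le>N. p j * ?b (m + j) * cis (of_int (int m) * l))"
      by (simp only: sum_distrib_right)
    then show "(\<Sum>j\<le>N. ?b (j + m) * (p j * cis (of_int (int m) * l))) = r_coeff \<mu> N a m * cis (of_int (int m) * l)"
      by (simp only: add.commute[of m] mult_ac)
  qed
  finally have "(\<Sum>k\<le>N. ?b k * (cis (of_int (int k) * l) * pseries p ?z)) =
      (\<Sum>m\<le>N. r_coeff \<mu> N a m * cis (of_int (int m) * l)) + cis (of_int (-1) * l) * pseries (\<beta> \<mu> N a) ?z"
    unfolding \<beta> by simp
  moreover have "target \<mu> N a l = (\<Sum>k\<le>N. ?b k * (cis (of_int (int k) * l) * pseries p ?z)) * (\<theta> l / \<Phi> l)"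
    by (simp add: target_def kernel_def kernel_eq(2)[OF \<mu>] p_def sum_distrib_right sum_divide_distrib mult.assoc)
  moreover have "future \<mu> N a l = (\<Sum>m\<le>N. r_coeff \<mu> N a m * cis (of_int (int m) * l)) * (\<theta> l / \<Phi> l)"
    by (simp add: future_def e_def T_def sum_distrib_right sum_divide_distrib mult.assoc)
  moreover have "past \<mu> N a l = cis (of_int (-1) * l) * pseries (\<beta> \<mu> N a) ?z * (\<theta> l / \<Phi> l)"
    by (simp add: past_def e_shift)
  ultimately show ?thesis by (simp only: distrib_right)
qed

lemma target_stint:
  assumes "\<mu> > 0"
  shows "stint (target \<mu> N a) (\<lambda>\<omega>. \<Sum>k\<le>N. b_coeff n \<mu> N a k * increment n \<xi> (int k) (int \<mu>) \<omega>)"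
  unfolding target_def[abs_def] by (rule stint_sum[OF kernel_stint[OF assms]])

lemma past_L2: "\<mu> > 0 \<Longrightarrow> past \<mu> N a \<in> L2 M"
  unfolding past_def[abs_def] by (rule e_series(1)[OF \<beta>_summable])

lemma future_L2: "future \<mu> N a \<in> L2 M"
  unfolding future_def[abs_def] by (intro L2_sum L2_scale e_L2)

lemma past_in_L2_minus:
  assumes \<mu>: "\<mu> > 0"
  shows "past \<mu> N a \<in> L2_minus n \<mu> F"
  unfolding L2_minus_eq[OF \<mu>] past_def[abs_def] by (rule e_series(3)[OF \<beta>_summable[OF \<mu>]])

lemma past_stint:
  assumes \<mu>: "\<mu> > 0"
  shows "\<exists>Y. stint (past \<mu> N a) Y"
proof -
  have n: "(\<integral>\<omega>. (cmod (\<epsilon> (-1 - int k) \<omega>))\<^sup>2 \<partial>P) \<le> 1" for k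
    unfolding stint_norm[OF \<epsilon>_stint[of "-1 - int k"]] e_norm[of "-1 - int k"] by (rule order_refl)
  note s = L2_abs_series[where X = "\<lambda>k. \<epsilon> (-1 - int k)", OF \<epsilon>_series(1) n \<beta>_summable[OF \<mu>]]
  have "stint (past \<mu> N a) (\<lambda>\<omega>. \<Sum>k. \<beta> \<mu> N a k * \<epsilon> (-1 - int k) \<omega>)"
    unfolding past_def[abs_def]
    by (rule stint_limit_seq[OF e_series(1)[OF \<beta>_summable[OF \<mu>]] s(1) stint_sum[OF \<epsilon>_stint] e_series(2)[OF \<beta>_summable[OF \<mu>]] s(2)])
  then show ?thesis by (rule exI[of _ "\<lambda>\<omega>. \<Sum>k. \<beta> \<mu> N a k * \<epsilon> (-1 - int k) \<omega>"])
qed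

lemma future_orthogonal:
  assumes \<mu>: "\<mu> > 0" and v: "v \<in> L2_minus n \<mu> F"
  shows "(\<integral>l. future \<mu> N a l * cnj (v l) \<partial>M) = 0"
proof (rule inner_L2_span_eq_0[OF _ future_L2 _ v[unfolded L2_minus_eq[OF \<mu>]]])
  show "{e k | k. k \<le> -1} \<subseteq> L2 M" using e_L2 by blast
  fix s assume "s \<in> {e k | k. k \<le> -1}"
  then obtain k where k: "k \<le> -1" "s = e k" by blast
  have "(\<integral>l. future \<mu> N a l * cnj (s l) \<partial>M) = (\<integral>l. (\<Sum>j\<le>N. r_coeff \<mu> N a j * (e (int j) l * cnj (e k l))) \<partial>M)"
    unfolding k(2) future_def sum_distrib_right mult.assoc by (rule refl)
  also have "\<dots> = (\<Sum>j\<le>N. r_coeff \<mu> N a j * (\<integral>l. e (int j) l * cnj (e k l) \<partial>M))"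
    by (subst Bochner_Integration.integral_sum)
       (intro integrable_mult_right L2_mult_cnj_integrable e_L2, simp only: integral_mult_right_zero)
  also have "\<dots> = 0"
    unfolding e_inner using k(1) by (intro sum.neutral ballI) simp
  finally show "(\<integral>l. future \<mu> N a l * cnj (s l) \<partial>M) = 0" .
qed

lemma future_norm:
  "(\<integral>l. (cmod (future \<mu> N a l))\<^sup>2 \<partial>M) = (\<Sum>j\<le>N. (cmod (r_coeff \<mu> N a j))\<^sup>2)"
proof -
  have "complex_of_real (\<integral>l. (cmod (future \<mu> N a l))\<^sup>2 \<partial>M) = (\<integral>l. future \<mu> N a l * cnj (future \<mu> N a l) \<partial>M)"
    by (simp only: integral_complex_of_real[symmetric] complex_norm_square)
  also have "\<dots> = (\<integral>l. (\<Sum>i\<le>N. \<Sum>j\<le>N. r_coeff \<mu> N a i * cnj (r_coeff \<mu> N a j) * (e (int i) l * cnj (e (int j) l))) \<partial>M)"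
    by (simp add: future_def sum_product mult_ac)
  also have "\<dots> = (\<Sum>i\<le>N. \<Sum>j\<le>N. r_coeff \<mu> N a i * cnj (r_coeff \<mu> N a j) * (\<integral>l. e (int i) l * cnj (e (int j) l) \<partial>M))"
    by (simp add: Bochner_Integration.integral_sum L2_mult_cnj_integrable e_L2)
  also have "\<dots> = (\<Sum>i\<le>N. \<Sum>j\<le>N. if j = i then r_coeff \<mu> N a i * cnj (r_coeff \<mu> N a j) else 0)"
    unfolding e_inner by (intro sum.cong refl) simp
  also have "\<dots> = (\<Sum>i\<le>N. r_coeff \<mu> N a i * cnj (r_coeff \<mu> N a i))"
    by (simp add: sum.delta)
  also have "\<dots> = complex_of_real (\<Sum>j\<le>N. (cmod (r_coeff \<mu> N a j))\<^sup>2)"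
    by (simp only: complex_norm_square[symmetric] of_real_sum)
  finally show ?thesis by (simp only: of_real_eq_iff)
qed

lemma vec_poly_r: "vec_poly (r_vec n \<phi> \<mu> N a) (cis l) = (\<Sum>j\<le>N. r_coeff \<mu> N a j * cis (of_int (int j) * l))"
  by (simp add: vec_poly_def r_coeff_def Complex.DeMoivre lessThan_Suc_atMost)

lemma future_eq_T: "future \<mu> N a = T (\<lambda>l. vec_poly (r_vec n \<phi> \<mu> N a) (cis l))"
  by (rule ext) (simp add: future_def e_def T_def vec_poly_r sum_distrib_right sum_divide_distrib mult.assoc)

lemma future_norm_integral:
  "(\<integral>l. (cmod (future \<mu> N a l))\<^sup>2 \<partial>M) = 1 / (2 * pi) * (LINT l:{-pi..pi}|lborel. (cmod (vec_poly (r_vec n \<phi> \<mu> N a) (cis l)))\<^sup>2)"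
  unfolding future_eq_T
proof (subst T_norm)
  show "(\<lambda>l. vec_poly (r_vec n \<phi> \<mu> N a) (cis l)) \<in> borel_measurable borel"
    unfolding vec_poly_def by (intro borel_measurable_continuous_onI continuous_intros)
qed (simp only: integral_circle)

text \<open>Dividing by \<open>phi_mu\<close> is possible except at the finitely many zeros of the kernel,
  where \<open>inverse 0 = 0\<close> and the two sides may differ.\<close>
lemma spectral_char_AE:
  assumes \<mu>: "\<mu> > 0"
  shows "AE l in M. past \<mu> N a l = spectral_char n \<phi> \<mu> N a l * incr_kernel n (int \<mu>) l"
proof -
  have "AE l in circle. past \<mu> N a l = spectral_char n \<phi> \<mu> N a l * incr_kernel n (int \<mu>) l"
    using AE_circle_cis_neq_1[OF \<mu>]
  proof eventually_elim
    case (elim l)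
    let ?z = "cis (-l)" and ?K = "incr_kernel n (int \<mu>) l" and ?p = "pseries (phi_mu n \<phi> \<mu>) (cis (-l))"
    have "(1 - ?z) * (\<Sum>i<\<mu>. ?z ^ i) = 1 - ?z ^ \<mu>" by (rule one_diff_power_eq[symmetric])
    also have "\<dots> \<noteq> 0" using elim by (simp add: Complex.DeMoivre)
    finally have "(\<Sum>i<\<mu>. ?z ^ i) \<noteq> 0" by auto
    then have "Q \<mu> ?z \<noteq> 0" by (simp add: Q_def)
    then have p: "?p \<noteq> 0"
      using \<Phi>_nonzero[of l] by (subst phi_mu_series(2)[OF \<mu>]) (simp_all add: \<Phi>_def)
    have K: "inverse ?p * ?K = \<theta> l / \<Phi> l"
      unfolding kernel_eq(2)[OF \<mu>] using p by simp
    have B: "vec_poly (b_vec n \<mu> N a) (cis l) * ?K = target \<mu> N a l"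
      unfolding vec_poly_def target_def kernel_def sum_distrib_right dim_b_vec lessThan_Suc_atMost
      by (intro sum.cong refl) (simp add: index_b_vec Complex.DeMoivre)
    have R: "vec_poly (r_vec n \<phi> \<mu> N a) (cis l) * (\<theta> l / \<Phi> l) = future \<mu> N a l"
      unfolding future_eq_T T_def by simp
    have "spectral_char n \<phi> \<mu> N a l * ?K = target \<mu> N a l - future \<mu> N a l"
      unfolding spectral_char_def left_diff_distrib mult.assoc K R B by (rule refl)
    then show ?case by (simp add: target_eq[OF \<mu>])
  qed
  then show ?thesis
    unfolding density by (subst AE_density) (use weight_measurable in auto)
qed

lemma spectral_char_kernel_measurable:
  "(\<lambda>l. spectral_char n \<phi> \<mu> N a l * incr_kernel n (int \<mu>) l) \<in> borel_measurable M"
proof (intro measurable_M borel_measurable_times incr_kernel_measurable)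
  have v: "(\<lambda>l. vec_poly x (cis l)) \<in> borel_measurable borel" for x
    unfolding vec_poly_def by (intro borel_measurable_continuous_onI continuous_intros)
  show "spectral_char n \<phi> \<mu> N a \<in> borel_measurable borel"
    unfolding spectral_char_def[abs_def]
    by (intro borel_measurable_diff borel_measurable_times borel_measurable_inverse v pseries_cis_measurable)
qed

lemma spectral_char_in_L2_minus:
  assumes \<mu>: "\<mu> > 0"
  shows "(\<lambda>l. spectral_char n \<phi> \<mu> N a l * incr_kernel n (int \<mu>) l) \<in> L2_minus n \<mu> F"
  using L2_span_cong_AE[OF _ past_in_L2_minus[OF \<mu>, unfolded L2_minus_eq[OF \<mu>]] spectral_char_kernel_measurable spectral_char_AE[OF \<mu>]] e_L2
  unfolding L2_minus_eq[OF \<mu>] by blast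

lemma spectral_char_mse:
  assumes \<mu>: "\<mu> > 0" and h: "(\<lambda>l. h l * incr_kernel n (int \<mu>) l) \<in> L2 M"
  shows "mse M (past \<mu> N a) (\<lambda>l. h l * incr_kernel n (int \<mu>) l) =
    mse M (\<lambda>l. spectral_char n \<phi> \<mu> N a l * incr_kernel n (int \<mu>) l) (\<lambda>l. h l * incr_kernel n (int \<mu>) l)"
  by (rule mse_AE_cong[OF L2D(1)[OF past_L2[OF \<mu>]] L2D(1)[OF h] spectral_char_kernel_measurable spectral_char_AE[OF \<mu>]])

text \<open>The observed part \<open>V_functional\<close> cancels. The kernel of the error is \<open>future\<close>, which
  is orthogonal to all admissible kernels, plus the admissible difference between \<open>past\<close>
  and the kernel of the estimate.\<close>
lemma linear_estimate_error:
  assumes \<mu>: "\<mu> > 0" and est: "linear_estimate P n \<mu> N a \<xi> F Z h Y"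
  shows "mse P (A_functional N a \<xi>) Y = (\<integral>l. (cmod (future \<mu> N a l))\<^sup>2 \<partial>M) +
    mse M (past \<mu> N a) (\<lambda>l. h l * incr_kernel n (int \<mu>) l)"
proof -
  let ?h = "\<lambda>l. h l * incr_kernel n (int \<mu>) l"
  let ?G = "\<lambda>\<omega>. \<Sum>k\<le>N. b_coeff n \<mu> N a k * increment n \<xi> (int k) (int \<mu>) \<omega>"
  from est obtain W where h: "?h \<in> L2_minus n \<mu> F" and W: "stint ?h W"
    and Y: "Y = (\<lambda>\<omega>. - V_functional n \<mu> N a \<xi> \<omega> + W \<omega>)"
    unfolding linear_estimate_def by blast
  have "A_functional N a \<xi> \<omega> - Y \<omega> = ?G \<omega> - W \<omega>" for \<omega>
    unfolding functional_eq_increments[OF \<mu>, symmetric] Y by simp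
  then have "mse P (A_functional N a \<xi>) Y = mse P ?G W"
    by (simp only: mse_def)
  also have "\<dots> = mse M (target \<mu> N a) ?h"
    by (rule stint_mse[OF target_stint[OF \<mu>] W])
  also have "\<dots> = (\<integral>l. (cmod (future \<mu> N a l + (past \<mu> N a l - ?h l)))\<^sup>2 \<partial>M)"
    by (simp only: mse_def target_eq[OF \<mu>] add_diff_eq)
  also have "\<dots> = (\<integral>l. (cmod (future \<mu> N a l))\<^sup>2 \<partial>M) + (\<integral>l. (cmod (past \<mu> N a l - ?h l))\<^sup>2 \<partial>M)"
  proof (rule L2_Pythagoras[OF future_L2])
    have h2: "?h \<in> L2 M" by (rule has_stochastic_integralD(1)[OF W])
    show "(\<lambda>l. past \<mu> N a l - ?h l) \<in> L2 M" by (rule L2_diff[OF past_L2[OF \<mu>] h2])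
    have E: "{e k | k. k \<le> -1} \<subseteq> L2 M" using e_L2 by blast
    have "(\<lambda>l. past \<mu> N a l + (-1) * ?h l) \<in> L2_minus n \<mu> F"
      using past_in_L2_minus[OF \<mu>] h unfolding L2_minus_eq[OF \<mu>] by (intro L2_span_add L2_span_scale E)
    then have "(\<lambda>l. past \<mu> N a l - ?h l) \<in> L2_minus n \<mu> F"
      by (simp only: mult_minus1 add_uminus_conv_diff)
    then show "(\<integral>l. future \<mu> N a l * cnj (past \<mu> N a l - ?h l) \<partial>M) = 0"
      by (rule future_orthogonal[OF \<mu>])
  qed
  finally show ?thesis by (simp only: mse_def)
qed

lemma spectral_char_estimate_exists:
  assumes \<mu>: "\<mu> > 0"
  shows "\<exists>Y. linear_estimate P n \<mu> N a \<xi> F Z (spectral_char n \<phi> \<mu> N a) Y"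
proof -
  obtain W where "stint (past \<mu> N a) W" using past_stint[OF \<mu>] by blast
  then have "stint (\<lambda>l. spectral_char n \<phi> \<mu> N a l * incr_kernel n (int \<mu>) l) W"
    by (rule stint_cong_AE[OF _ spectral_char_kernel_measurable spectral_char_AE[OF \<mu>]])
  then have "linear_estimate P n \<mu> N a \<xi> F Z (spectral_char n \<phi> \<mu> N a) (\<lambda>\<omega>. - V_functional n \<mu> N a \<xi> \<omega> + W \<omega>)"
    unfolding linear_estimate_def by (intro conjI spectral_char_in_L2_minus[OF \<mu>] exI[of _ W] refl)
  then show ?thesis by (rule exI[of _ "\<lambda>\<omega>. - V_functional n \<mu> N a \<xi> \<omega> + W \<omega>"])
qed

lemma spectral_char_estimate_mse:
  assumes \<mu>: "\<mu> > 0" and est: "linear_estimate P n \<mu> N a \<xi> F Z (spectral_char n \<phi> \<mu> N a) Y"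
  shows "mse P (A_functional N a \<xi>) Y = (\<integral>l. (cmod (future \<mu> N a l))\<^sup>2 \<partial>M)"
proof -
  have "(\<lambda>l. spectral_char n \<phi> \<mu> N a l * incr_kernel n (int \<mu>) l) \<in> L2 M"
    using est has_stochastic_integralD(1) unfolding linear_estimate_def by blast
  then show ?thesis
    unfolding linear_estimate_error[OF \<mu> est] by (simp only: spectral_char_mse[OF \<mu>] mse_same add_0_right)
qed

text \<open>By \<open>linear_estimate_error\<close> the excess over the minimum is the distance of the kernel
  from \<open>past\<close>, so an optimal estimate has almost everywhere the same kernel, and the
  stochastic integral does not see null sets.\<close>
lemma optimal_iff:
  assumes \<mu>: "\<mu> > 0"
  shows "optimal_linear_estimate P n \<mu> N a \<xi> F Z Y \<longleftrightarrow>
    linear_estimate P n \<mu> N a \<xi> F Z (spectral_char n \<phi> \<mu> N a) Y"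
proof
  assume est: "linear_estimate P n \<mu> N a \<xi> F Z (spectral_char n \<phi> \<mu> N a) Y"
  show "optimal_linear_estimate P n \<mu> N a \<xi> F Z Y"
    unfolding optimal_linear_estimate_def
  proof (intro conjI allI impI)
    show "\<exists>h. linear_estimate P n \<mu> N a \<xi> F Z h Y" using est by (rule exI[of _ "spectral_char n \<phi> \<mu> N a"])
    fix h' Y' assume "linear_estimate P n \<mu> N a \<xi> F Z h' Y'"
    from linear_estimate_error[OF \<mu> this]
    show "mse P (A_functional N a \<xi>) Y \<le> mse P (A_functional N a \<xi>) Y'"
      unfolding spectral_char_estimate_mse[OF \<mu> est] by (simp add: mse_nonneg)
  qed
next
  assume opt: "optimal_linear_estimate P n \<mu> N a \<xi> F Z Y"
  then obtain h where est: "linear_estimate P n \<mu> N a \<xi> F Z h Y"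
    unfolding optimal_linear_estimate_def by blast
  let ?h = "\<lambda>l. h l * incr_kernel n (int \<mu>) l"
  let ?s = "\<lambda>l. spectral_char n \<phi> \<mu> N a l * incr_kernel n (int \<mu>) l"
  from est obtain W where W: "stint ?h W" and Y: "Y = (\<lambda>\<omega>. - V_functional n \<mu> N a \<xi> \<omega> + W \<omega>)"
    unfolding linear_estimate_def by blast
  have h2: "?h \<in> L2 M" by (rule has_stochastic_integralD(1)[OF W])
  obtain Y0 where Y0: "linear_estimate P n \<mu> N a \<xi> F Z (spectral_char n \<phi> \<mu> N a) Y0"
    using spectral_char_estimate_exists[OF \<mu>] by blast
  have "mse P (A_functional N a \<xi>) Y \<le> mse P (A_functional N a \<xi>) Y0"
    using opt Y0 unfolding optimal_linear_estimate_def by blast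
  then have "mse M (past \<mu> N a) ?h \<le> 0"
    unfolding linear_estimate_error[OF \<mu> est] spectral_char_estimate_mse[OF \<mu> Y0] by simp
  then have zero: "mse M (past \<mu> N a) ?h = 0"
    using mse_nonneg[of M "past \<mu> N a" ?h] by linarith
  have "AE l in M. past \<mu> N a l = ?h l"
    by (rule mse_eq_0_AE[OF past_L2[OF \<mu>] h2 zero])
  with spectral_char_AE[OF \<mu>, of N a] have "AE l in M. ?h l = ?s l"
    by eventually_elim simp
  then have "stint ?s W"
    by (rule stint_cong_AE[OF W spectral_char_kernel_measurable])
  then show "linear_estimate P n \<mu> N a \<xi> F Z (spectral_char n \<phi> \<mu> N a) Y"
    unfolding linear_estimate_def by (intro conjI spectral_char_in_L2_minus[OF \<mu>] exI[of _ W] Y)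
qed

lemma optimal_mse:
  assumes \<mu>: "\<mu> > 0" and opt: "optimal_linear_estimate P n \<mu> N a \<xi> F Z Y"
  shows "mse P (A_functional N a \<xi>) Y =
      1 / (2 * pi) * (LINT l:{-pi..pi}|lborel. (cmod (vec_poly (r_vec n \<phi> \<mu> N a) (cis l)))\<^sup>2)"
    and "mse P (A_functional N a \<xi>) Y = (euclid_norm (r_vec n \<phi> \<mu> N a))\<^sup>2"
proof -
  note m = spectral_char_estimate_mse[OF \<mu> iffD1[OF optimal_iff[OF \<mu>] opt]]
  show "mse P (A_functional N a \<xi>) Y =
      1 / (2 * pi) * (LINT l:{-pi..pi}|lborel. (cmod (vec_poly (r_vec n \<phi> \<mu> N a) (cis l)))\<^sup>2)"
    unfolding m by (rule future_norm_integral)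
  show "mse P (A_functional N a \<xi>) Y = (euclid_norm (r_vec n \<phi> \<mu> N a))\<^sup>2"
    unfolding m future_norm euclid_norm_def r_coeff_def dim_r_vec lessThan_Suc_atMost
    by (rule real_sqrt_pow2[symmetric]) (intro sum_nonneg zero_le_power2)
qed

end

theorem theorem3p3:
  fixes P :: "'a measure"
    and \<xi> :: "int \<Rightarrow> 'a \<Rightarrow> complex"
    and n \<mu> N :: nat
    and F f :: "real \<Rightarrow> real"
    and Z :: "real set \<Rightarrow> 'a \<Rightarrow> complex"
    and \<phi> a :: "nat \<Rightarrow> complex"
  assumes "prob_space P"
    and "n \<ge> 1" and "\<mu> > 0"
    and "\<And>m. \<xi> m \<in> borel_measurable P"
    and "stationary_increments P n \<xi>"
    and "zero_mean_increments P n \<xi>"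
    and "spectral_representation P n \<xi> F Z"
    and "has_spectral_density F f"
    and "canonical_factorization f \<phi>"
  shows
    "(\<exists>\<epsilon>. innovation_sequence P n \<xi> \<epsilon> \<and>
        (\<forall>\<nu>>0. \<forall>m. moving_average P \<epsilon> (phi_mu n \<phi> \<nu>) m (increment n \<xi> m (int \<nu>)))) \<and>
     (\<exists>Y. optimal_linear_estimate P n \<mu> N a \<xi> F Z Y) \<and>
     (\<forall>Y. optimal_linear_estimate P n \<mu> N a \<xi> F Z Y \<longleftrightarrow>
        linear_estimate P n \<mu> N a \<xi> F Z (spectral_char n \<phi> \<mu> N a) Y) \<and>
     (\<forall>Y. optimal_linear_estimate P n \<mu> N a \<xi> F Z Y \<longrightarrow>
        mse P (A_functional N a \<xi>) Y =
          1 / (2 * pi) * (LINT l:{-pi..pi}|lborel. (cmod (vec_poly (r_vec n \<phi> \<mu> N a) (cis l)))\<^sup>2) \<and>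
        mse P (A_functional N a \<xi>) Y = (euclid_norm (r_vec n \<phi> \<mu> N a))\<^sup>2)"
proof -
  obtain g where g: "summable (\<lambda>k. cmod (g k))" "\<And>k. Im (g k) = 0"
    "\<And>l. l \<in> {-pi..pi} \<Longrightarrow> 2 * Re (pseries g (cis (-l))) = ln ((cmod (incr_kernel 1 1 l))\<^sup>2)"
    using outer_log_series by blast
  note dens = spectral_measure_density(1)[OF assms(8,9)]
  have "emeasure (spectral_measure F) (space (spectral_measure F)) \<noteq> \<infinity>"
  proof -
    have "emeasure (spectral_measure F) {-pi..<pi} = ennreal (F pi)"
      by (rule spectral_measure_density(2)[OF assms(8,9)]) (use pi_gt_zero in simp)
    moreover have "space (spectral_measure F) = {-pi..<pi}"
      unfolding dens by simp
    ultimately show ?thesis by simp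
  qed
  then have fin: "finite_measure (spectral_measure F)" by (rule finite_measureI)
  interpret canonical_increments P F Z \<xi> n \<phi> g
  proof (intro canonical_increments.intro orth_measure.intro canonical_increments_axioms.intro)
    show "finite_measure (spectral_measure F)" by (rule fin)
    show "orthogonal_stochastic_measure P (spectral_measure F) Z"
      using assms(7) by (simp add: spectral_representation_def)
    show "prob_space P" by (rule assms(1))
    show "(\<integral>\<omega>. increment n \<xi> m \<nu> \<omega> \<partial>P) = 0" for m \<nu>
      using assms(6) by (simp add: zero_mean_increments_def)
    show "has_stochastic_integral P (spectral_measure F) Z
        (\<lambda>l. cis (of_int m * l) * incr_kernel n \<nu> l) (increment n \<xi> m \<nu>)" if "\<nu> > 0" for m \<nu>
      using assms(7) that by (simp add: spectral_representation_def)
    show "spectral_measure F = density circle (\<lambda>l. ennreal ((cmod (pseries \<phi> (cis (-l))))\<^sup>2 / (2 * pi)))"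
      by (rule dens)
    show "conv_radius \<phi> > 1" using assms(9) by (simp add: canonical_factorization_def)
    show "pseries \<phi> z \<noteq> 0" if "cmod z \<le> 1" for z
      using assms(9) that by (simp add: canonical_factorization_def)
  qed (fact g)+
  show ?thesis
  proof (intro conjI)
    show "\<exists>\<epsilon>. innovation_sequence P n \<xi> \<epsilon> \<and>
        (\<forall>\<nu>>0. \<forall>m. moving_average P \<epsilon> (phi_mu n \<phi> \<nu>) m (increment n \<xi> m (int \<nu>)))"
      using innovations increment_moving_average by (intro exI[of _ \<epsilon>] conjI allI impI)
    show "\<exists>Y. optimal_linear_estimate P n \<mu> N a \<xi> F Z Y"
      unfolding optimal_iff[OF assms(3)] by (rule spectral_char_estimate_exists[OF assms(3)])
    show "\<forall>Y. optimal_linear_estimate P n \<mu> N a \<xi> F Z Y \<longleftrightarrow>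
        linear_estimate P n \<mu> N a \<xi> F Z (spectral_char n \<phi> \<mu> N a) Y"
      using optimal_iff[OF assms(3)] by (intro allI)
    show "\<forall>Y. optimal_linear_estimate P n \<mu> N a \<xi> F Z Y \<longrightarrow>
        mse P (A_functional N a \<xi>) Y =
          1 / (2 * pi) * (LINT l:{-pi..pi}|lborel. (cmod (vec_poly (r_vec n \<phi> \<mu> N a) (cis l)))\<^sup>2) \<and>
        mse P (A_functional N a \<xi>) Y = (euclid_norm (r_vec n \<phi> \<mu> N a))\<^sup>2"
      using optimal_mse[OF assms(3)] by (intro allI impI conjI)
  qed
qed

end
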